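(* Let $\alpha\in\left(0,\frac{n+1}{2}\right)$ and let $\mathbf{W}_\alpha=\{\mathbf{W}_\alpha(\varphi);\varphi\in L^2(\mathbb{R}_+;\mathcal{W}^{-\alpha,2})\}$ be the centered Gaussian family with covariance $$\mathbf{E}\left(\mathbf{W}_\alpha(\varphi)\mathbf{W}_\alpha(\psi)\right)=\int_{\mathbb{R}_+}\int_{\mathbf{H}^n}\big[(-\Delta)^{-\alpha}\varphi\big](t,q)\big[(-\Delta)^{-\alpha}\psi\big](t,q)\,d\mu(q)\,dt.$$ Then for any $x\in\mathbf{H}^n$, $$\{\mathbf{W}_\alpha(\varphi\circ L_x),\ \varphi\in L^2(\mathbb{R}_+;\mathcal{W}^{-\alpha,2})\}\stackrel{\mathcal{D}}{=}\{\mathbf{W}_\alpha(\varphi),\ \varphi\in L^2(\mathbb{R}_+;\mathcal{W}^{-\alpha,2})\}.$$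
   Context: Let $n\ge1$. The Heisenberg group $\mathbf{H}^n$ is $\mathbb{R}^n\times\mathbb{R}^n\times\mathbb{R}$ with product $(x,y,z)\star(x',y',z')=(x+x',y+y',z+z'+2\sum_{i=1}^n(x_i'y_i-x_iy_i'))$; $\mu$ is Lebesgue measure on $\mathbb{R}^{2n+1}$. Let $X_i=\partial_{x_i}+2y_i\partial_z$, $Y_i=\partial_{y_i}-2x_i\partial_z$ and $\Delta=\sum_{i=1}^n(X_i^2+Y_i^2)$, essentially self-adjoint on $C_0^\infty(\mathbb{R}^{2n+1})\subset L^2(\mathbf{H}^n,\mu)$; $\Delta$ also denotes its self-adjoint extension, and $(-\Delta)^{-\alpha}$ is defined by the spectral theorem, with domain $\mathcal{W}^{-\alpha,2}\subset L^2(\mathbf{H}^n,\mu)$. $L^2(\mathbb{R}_+;\mathcal{W}^{-\alpha,2})$ is the space of measurable $\varphi$ on $\mathbb{R}_+\times\mathbf{H}^n$ with $\varphi(t,\cdot)\in\mathcal{W}^{-\alpha,2}$ for a.e. $t$ and $\int_{\mathbb{R}_+}\|(-\Delta)^{-\alpha}\varphi(t,\cdot)\|_{L^2(\mu)}^2dt<\infty$. For $x\in\mathbf{H}^n$, $L_x y=x\star y$ is the left translation and $(\varphi\circ L_x)(t,q)=\varphi(t,L_xq)$. $\stackrel{\mathcal{D}}{=}$ denotes equality in law of the two families. *)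

theory Defs
  imports "HOL-Probability.Probability"
begin

section \<open>The real Hilbert space \<open>L\<^sup>2\<close> of Lebesgue measure\<close>

definition square_integrable :: "('a::euclidean_space \<Rightarrow> real) \<Rightarrow> bool" where
  "square_integrable f \<longleftrightarrow>
     f \<in> borel_measurable lborel \<and> integrable lborel (\<lambda>x. (f x)\<^sup>2)"

lemma square_integrable_zero: "square_integrable (\<lambda>_. 0)"
  by (simp add: square_integrable_def)

lemma square_integrable_mult_integrable:
  assumes "square_integrable f" "square_integrable g"
  shows "integrable lborel (\<lambda>x. f x * g x)"
proof (rule Bochner_Integration.integrable_bound)
  show "integrable lborel (\<lambda>x. (f x)\<^sup>2 + (g x)\<^sup>2)"
    using assms by (simp add: square_integrable_def)
  show "(\<lambda>x. f x * g x) \<in> borel_measurable lborel"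
    using assms by (auto simp: square_integrable_def)
  have "\<bar>a * b\<bar> \<le> a\<^sup>2 + b\<^sup>2" for a b :: real
  proof -
    have "0 \<le> (\<bar>a\<bar> - \<bar>b\<bar>)\<^sup>2" by simp
    then have "2 * (\<bar>a\<bar> * \<bar>b\<bar>) \<le> a\<^sup>2 + b\<^sup>2"
      by (simp add: power2_diff)
    moreover have "0 \<le> \<bar>a\<bar> * \<bar>b\<bar>" by simp
    ultimately show ?thesis unfolding abs_mult by linarith
  qed
  then show "AE x in lborel. norm (f x * g x) \<le> norm ((f x)\<^sup>2 + (g x)\<^sup>2)"
    by simp
qed

lemma square_integrable_add:
  assumes "square_integrable f" "square_integrable g"
  shows "square_integrable (\<lambda>x. f x + g x)"
  using assms square_integrable_mult_integrable[OF assms]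
  by (auto simp: square_integrable_def power2_sum mult.assoc)

lemma square_integrable_scale:
  assumes "square_integrable f"
  shows "square_integrable (\<lambda>x. c * f x)"
  using assms by (auto simp: square_integrable_def power_mult_distrib)

lemma square_integrable_uminus:
  assumes "square_integrable f"
  shows "square_integrable (\<lambda>x. - f x)"
  using assms by (simp add: square_integrable_def)

quotient_type (overloaded) 'a L2 = "'a::euclidean_space \<Rightarrow> real" / partial:
  "\<lambda>f g. square_integrable f \<and> square_integrable g \<and> (AE x in lborel. f x = g x)"
proof (rule part_equivpI)
  show "\<exists>f::'a \<Rightarrow> real. square_integrable f \<and> square_integrable f \<and> (AE x in lborel. f x = f x)"
    using square_integrable_zero by auto
  show "symp (\<lambda>f g :: 'a \<Rightarrow> real. square_integrable f \<and> square_integrable g \<and>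
      (AE x in lborel. f x = g x))"
    by (auto intro!: sympI)
  show "transp (\<lambda>f g :: 'a \<Rightarrow> real. square_integrable f \<and> square_integrable g \<and>
      (AE x in lborel. f x = g x))"
    by (auto intro!: transpI)
qed

instantiation L2 :: (euclidean_space) real_inner
begin

lift_definition zero_L2 :: "'a L2" is "\<lambda>_. 0"
  by (simp add: square_integrable_zero)

lift_definition plus_L2 :: "'a L2 \<Rightarrow> 'a L2 \<Rightarrow> 'a L2" is "\<lambda>f g x. f x + g x"
  by (auto simp: square_integrable_add)

lift_definition uminus_L2 :: "'a L2 \<Rightarrow> 'a L2" is "\<lambda>f x. - f x"
  by (auto simp: square_integrable_uminus)

definition minus_L2 :: "'a L2 \<Rightarrow> 'a L2 \<Rightarrow> 'a L2" where
  "minus_L2 u v = u + - v"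

lift_definition scaleR_L2 :: "real \<Rightarrow> 'a L2 \<Rightarrow> 'a L2" is "\<lambda>c f x. c * f x"
  by (auto simp: square_integrable_scale)

lift_definition inner_L2 :: "'a L2 \<Rightarrow> 'a L2 \<Rightarrow> real" is "\<lambda>f g. LINT x|lborel. f x * g x"
  by (rule integral_cong_AE) (auto simp: square_integrable_def)

definition norm_L2 :: "'a L2 \<Rightarrow> real" where
  "norm_L2 u = sqrt (inner u u)"

definition sgn_L2 :: "'a L2 \<Rightarrow> 'a L2" where
  "sgn_L2 u = inverse (norm u) *\<^sub>R u"

definition dist_L2 :: "'a L2 \<Rightarrow> 'a L2 \<Rightarrow> real" where
  "dist_L2 u v = norm (u - v)"

definition uniformity_L2 :: "('a L2 \<times> 'a L2) filter" where
  "uniformity_L2 = (INF e\<in>{0<..}. principal {(x, y). dist x y < e})"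

definition open_L2 :: "'a L2 set \<Rightarrow> bool" where
  "open_L2 U \<longleftrightarrow> (\<forall>x\<in>U. eventually (\<lambda>(x', y). x' = x \<longrightarrow> y \<in> U) uniformity)"

instance
proof
  fix u v w :: "'a L2" and a b :: real
  show "u + v + w = u + (v + w)"
    by transfer (auto simp: square_integrable_add add.assoc)
  show "u + v = v + u"
    by transfer (auto simp: square_integrable_add add.commute)
  show "0 + u = u"
    by transfer auto
  show "- u + u = 0"
    by transfer (auto simp: square_integrable_zero)
  show "u - v = u + - v"
    by (simp add: minus_L2_def)
  show "a *\<^sub>R (u + v) = a *\<^sub>R u + a *\<^sub>R v"
    by transfer (auto simp: square_integrable_add square_integrable_scale distrib_left)
  show "(a + b) *\<^sub>R u = a *\<^sub>R u + b *\<^sub>R u"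
    by transfer (auto simp: square_integrable_add square_integrable_scale distrib_right)
  show "a *\<^sub>R b *\<^sub>R u = (a * b) *\<^sub>R u"
    by transfer (auto simp: square_integrable_scale mult.assoc)
  show "1 *\<^sub>R u = u"
    by transfer auto
  show "dist u v = norm (u - v)"
    by (simp add: dist_L2_def)
  show "sgn u = inverse (norm u) *\<^sub>R u"
    by (simp add: sgn_L2_def)
  show "uniformity = (INF e\<in>{0<..}. principal {(x::'a L2, y). dist x y < e})"
    by (simp add: uniformity_L2_def)
  show "open U \<longleftrightarrow> (\<forall>x\<in>U. eventually (\<lambda>(x', y). x' = x \<longrightarrow> y \<in> U) uniformity)"
    for U :: "'a L2 set"
    by (simp add: open_L2_def)
  show "inner u v = inner v u"
    by transfer (simp add: mult.commute)
  show "inner (u + v) w = inner u w + inner v w"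
  proof (transfer, goal_cases)
    case (1 f g h)
    then show ?case
      using square_integrable_mult_integrable[of f h] square_integrable_mult_integrable[of g h]
      by (simp add: distrib_right)
  qed
  show "inner (a *\<^sub>R u) v = a * inner u v"
    by transfer (simp add: mult.assoc)
  show "0 \<le> inner u u"
    by transfer simp
  show "inner u u = 0 \<longleftrightarrow> u = 0"
  proof (transfer, goal_cases)
    case (1 f)
    then have "integrable lborel (\<lambda>x. f x * f x)"
      by (simp add: square_integrable_mult_integrable)
    then have "(LINT x|lborel. f x * f x) = 0 \<longleftrightarrow> (AE x in lborel. f x * f x = 0)"
      by (rule integral_nonneg_eq_0_iff_AE) simp
    with 1 show ?case by (simp add: square_integrable_zero)
  qed
  show "norm u = sqrt (inner u u)"
    by (simp add: norm_L2_def)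
qed

end

text \<open>The class of a square integrable function; unspecified for other functions.\<close>

definition L2_of :: "('a::euclidean_space \<Rightarrow> real) \<Rightarrow> 'a L2" where
  "L2_of f = abs_L2 f"


section \<open>Spectral calculus\<close>

definition projection_valued_measure :: "(real set \<Rightarrow> 'h::real_inner \<Rightarrow> 'h) \<Rightarrow> bool" where
  "projection_valued_measure E \<longleftrightarrow>
     (\<forall>B\<in>sets borel. linear (E B) \<and> (\<forall>u v. inner (E B u) v = inner u (E B v))) \<and>
     (\<forall>B\<in>sets borel. \<forall>C\<in>sets borel. \<forall>u. E (B \<inter> C) u = E B (E C u)) \<and>
     (\<forall>u. E UNIV u = u) \<and>
     (\<forall>B u. range B \<subseteq> sets borel \<and> disjoint_family B \<longrightarrow>
        (\<lambda>i::nat. E (B i) u) sums E (\<Union>i. B i) u)"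

definition scalar_spectral_measure ::
  "(real set \<Rightarrow> 'h::real_inner \<Rightarrow> 'h) \<Rightarrow> 'h \<Rightarrow> real measure" where
  "scalar_spectral_measure E u =
     measure_of UNIV (sets borel) (\<lambda>B. ennreal (inner (E B u) u))"

definition simple_spectral_integral ::
  "(real set \<Rightarrow> 'h::real_inner \<Rightarrow> 'h) \<Rightarrow> (real \<Rightarrow> real) \<Rightarrow> 'h \<Rightarrow> 'h" where
  "simple_spectral_integral E s u = (\<Sum>c\<in>range s. c *\<^sub>R E (s -` {c}) u)"

text \<open>Operators, in general unbounded, are represented by their graphs.
  The operator \<open>\<integral> h dE\<close> has domain \<open>{u. \<integral> h\<^sup>2 d\<langle>E u, u\<rangle> < \<infinity>}\<close>; its value at \<open>u\<close> is the limit of the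
  integrals of simple functions converging to \<open>h\<close> in the \<open>L\<^sup>2\<close> space of \<open>\<langle>E u, u\<rangle>\<close>.\<close>

definition spectral_integral ::
  "(real set \<Rightarrow> 'h::real_inner \<Rightarrow> 'h) \<Rightarrow> (real \<Rightarrow> real) \<Rightarrow> ('h \<times> 'h) set" where
  "spectral_integral E h = {(u, g).
     (\<integral>\<^sup>+ l. ennreal ((h l)\<^sup>2) \<partial>scalar_spectral_measure E u) < \<infinity> \<and>
     (\<exists>s. (\<forall>k::nat. simple_function borel (s k)) \<and>
       (\<lambda>k. \<integral>\<^sup>+ l. ennreal ((h l - s k l)\<^sup>2) \<partial>scalar_spectral_measure E u) \<longlonglongrightarrow> 0 \<and>
       (\<lambda>k. simple_spectral_integral E (s k) u) \<longlonglongrightarrow> g)}"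

definition spectral_resolution ::
  "('h::real_inner \<times> 'h) set \<Rightarrow> (real set \<Rightarrow> 'h \<Rightarrow> 'h) \<Rightarrow> bool" where
  "spectral_resolution A E \<longleftrightarrow>
     projection_valued_measure E \<and> spectral_integral E (\<lambda>l. l) = A"

text \<open>The operator \<open>h(A)\<close>, for \<open>A\<close> self-adjoint on a Hilbert space and \<open>h\<close> a Borel function. By the
  spectral theorem a resolution \<open>E\<close> of \<open>A\<close> exists and is unique on the Borel sets, so the
  existential quantifier selects the spectral resolution of \<open>A\<close>.\<close>

definition functional_calculus ::
  "('h::real_inner \<times> 'h) set \<Rightarrow> (real \<Rightarrow> real) \<Rightarrow> ('h \<times> 'h) set" where
  "functional_calculus A h =
     {(u, g). \<exists>E. spectral_resolution A E \<and> (u, g) \<in> spectral_integral E h}"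


section \<open>The Heisenberg group and its sub-Laplacian\<close>

type_synonym 'n heis = "(real ^ 'n) \<times> (real ^ 'n) \<times> real"

definition heis_mult :: "'n::finite heis \<Rightarrow> 'n heis \<Rightarrow> 'n heis"  (infixl \<open>\<star>\<close> 70) where
  "p \<star> p' = (case (p, p') of ((x, y, z), (x', y', z')) \<Rightarrow>
     (x + x', y + y', z + z' + 2 * (\<Sum>i\<in>UNIV. x' $ i * y $ i - x $ i * y' $ i)))"

definition dir_deriv :: "'a::real_normed_vector \<Rightarrow> ('a \<Rightarrow> real) \<Rightarrow> 'a \<Rightarrow> real" where
  "dir_deriv v f p = frechet_derivative f (at p) v"

primrec Ck :: "nat \<Rightarrow> ('a::real_normed_vector \<Rightarrow> real) \<Rightarrow> bool" where
  "Ck 0 f \<longleftrightarrow> continuous_on UNIV f"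
| "Ck (Suc k) f \<longleftrightarrow> f differentiable_on UNIV \<and> (\<forall>v. Ck k (dir_deriv v f))"

definition test_function :: "('a::real_normed_vector \<Rightarrow> real) \<Rightarrow> bool" where
  "test_function f \<longleftrightarrow> (\<forall>k. Ck k f) \<and> compact (closure {p. f p \<noteq> 0})"

definition heis_X :: "'n::finite \<Rightarrow> ('n heis \<Rightarrow> real) \<Rightarrow> 'n heis \<Rightarrow> real" where
  "heis_X i f = (\<lambda>(x, y, z).
     dir_deriv (axis i 1, 0, 0) f (x, y, z) + 2 * y $ i * dir_deriv (0, 0, 1) f (x, y, z))"

definition heis_Y :: "'n::finite \<Rightarrow> ('n heis \<Rightarrow> real) \<Rightarrow> 'n heis \<Rightarrow> real" where
  "heis_Y i f = (\<lambda>(x, y, z).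
     dir_deriv (0, axis i 1, 0) f (x, y, z) - 2 * x $ i * dir_deriv (0, 0, 1) f (x, y, z))"

definition sub_laplacian :: "('n::finite heis \<Rightarrow> real) \<Rightarrow> 'n heis \<Rightarrow> real" where
  "sub_laplacian f p = (\<Sum>i\<in>UNIV. heis_X i (heis_X i f) p + heis_Y i (heis_Y i f) p)"

text \<open>The sub-Laplacian is essentially self-adjoint on the test functions, so its self-adjoint
  extension is the closure of its graph.\<close>

definition sub_laplacian_L2 :: "('n::finite heis L2 \<times> 'n heis L2) set" where
  "sub_laplacian_L2 = closure {(L2_of f, L2_of (sub_laplacian f)) | f. test_function f}"

text \<open>The operator \<open>(- \<Delta>)\<close> to the power \<open>- \<alpha>\<close>. The value \<open>0 powr - \<alpha> = 0\<close> is immaterial: the sub-Laplacian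
  is nonpositive and injective on \<open>L\<^sup>2\<close>, so the spectral resolution lives on the positive reals.\<close>

definition neg_power_graph :: "real \<Rightarrow> ('n::finite heis L2 \<times> 'n heis L2) set" where
  "neg_power_graph \<alpha> =
     functional_calculus {(u, - v) | u v. (u, v) \<in> sub_laplacian_L2} (\<lambda>l. l powr - \<alpha>)"

definition neg_power_domain :: "real \<Rightarrow> 'n::finite heis L2 set" where
  "neg_power_domain \<alpha> = Domain (neg_power_graph \<alpha>)"

definition neg_power :: "real \<Rightarrow> 'n::finite heis L2 \<Rightarrow> 'n heis L2" where
  "neg_power \<alpha> u = (THE g. (u, g) \<in> neg_power_graph \<alpha>)"

abbreviation half_line :: "real measure" where
  "half_line \<equiv> restrict_space lborel {0..}"

text \<open>Functions on the product of the half-line with the group are given as functions on the whole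
  line; their values at negative times play no role.\<close>

definition L2_half_line_domain :: "real \<Rightarrow> (real \<Rightarrow> 'n::finite heis \<Rightarrow> real) set" where
  "L2_half_line_domain \<alpha> = {\<phi>.
     case_prod \<phi> \<in> borel_measurable (half_line \<Otimes>\<^sub>M lborel) \<and>
     (AE t in half_line. square_integrable (\<phi> t) \<and> L2_of (\<phi> t) \<in> neg_power_domain \<alpha>) \<and>
     (\<integral>\<^sup>+ t. ennreal ((norm (neg_power \<alpha> (L2_of (\<phi> t))))\<^sup>2) \<partial>half_line) < \<infinity>}"


section \<open>Gaussian families\<close>

definition normal_law :: "real \<Rightarrow> real \<Rightarrow> real measure" where
  "normal_law m \<sigma> =
     (if \<sigma> = 0 then return borel m else density lborel (normal_density m \<sigma>))"

definition gaussian_family :: "'w measure \<Rightarrow> 'i set \<Rightarrow> ('i \<Rightarrow> 'w \<Rightarrow> real) \<Rightarrow> bool" where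
  "gaussian_family M I X \<longleftrightarrow>
     (\<forall>i\<in>I. X i \<in> borel_measurable M) \<and>
     (\<forall>J c. finite J \<and> J \<subseteq> I \<longrightarrow>
        (\<exists>m \<sigma>. 0 \<le> \<sigma> \<and> distr M borel (\<lambda>\<omega>. \<Sum>j\<in>J. c j * X j \<omega>) = normal_law m \<sigma>))"

definition centered_gaussian_family :: "'w measure \<Rightarrow> 'i set \<Rightarrow> ('i \<Rightarrow> 'w \<Rightarrow> real) \<Rightarrow> bool" where
  "centered_gaussian_family M I X \<longleftrightarrow>
     gaussian_family M I X \<and> (\<forall>i\<in>I. prob_space.expectation M (X i) = 0)"

definition law_of_family :: "'w measure \<Rightarrow> 'i set \<Rightarrow> ('i \<Rightarrow> 'w \<Rightarrow> real) \<Rightarrow> ('i \<Rightarrow> real) measure" where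
  "law_of_family M I X = distr M (Pi\<^sub>M I (\<lambda>_. borel)) (\<lambda>\<omega>. \<lambda>i\<in>I. X i \<omega>)"

end

theory Submission
  imports Defs
begin

text \<open>Left translation by \<open>x\<close> preserves Lebesgue measure, so it acts on \<open>L\<^sup>2\<close> by a unitary operator \<open>U\<close>, and
  it commutes with the fields \<open>X\<^sub>i\<close> and \<open>Y\<^sub>i\<close>, so \<open>U\<close> preserves the graph of the sub-Laplacian. Conjugation by \<open>U\<close> maps a
  spectral resolution of the sub-Laplacian to another one; since the resolution is unique, \<open>U\<close> commutes
  with \<open>(- \<Delta>)\<close> to the power \<open>- \<alpha>\<close>, and the covariance of the translated family is that of the
  original one. A centered Gaussian family is determined in law by its covariance.

  Uniqueness of the resolution is indispensable because the powers are defined by a description, which is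
  unspecified for a graph that is not single valued. Measurability in time also needs an argument:
  the half-line carries the Borel sets, for which a function equal almost everywhere to a measurable one
  need not be measurable.\<close>

section \<open>Gaussian families are determined by their covariance\<close>

text \<open>Completeness of L2 enters through the uniqueness of the resolution. The comparison of
  two resolutions applies the operator repeatedly to vectors in the range of \<open>E B\<close> with
  \<open>B\<close> bounded. That such vectors lie in its domain is shown by making integrals of
  simple functions a Cauchy sequence.

  The covariances are compared under the integral over time. The Bochner integral of a function that
  is not measurable is 0 by convention, so integrands that agree almost everywhere have equal
  integrals only once both are known to be measurable. The difficulty is that the power acts on each
  time slice separately, while only the joint measurability of \<phi> is given. The way out is weak
  measurability: scalars \<open>inner (E B u) v\<close> depend measurably on time when
  \<open>u\<close> and \<open>v\<close> are the classes of slices, finite sums of such scalars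
  inherit this, and the inner products of the powers are limits of these sums along a sequence of
  simple functions that is the same for all times.\<close>

lemma (in prob_space) integrable_bounded_real:
  fixes f :: "'a \<Rightarrow> real"
  assumes "f \<in> borel_measurable M" "\<And>\<omega>. \<bar>f \<omega>\<bar> \<le> B"
  shows "integrable M f"
  using assms by (intro integrable_const_bound[where B = B]) auto

text \<open>Splitting the characteristic function into real and imaginary part turns Levy's theorem
  into a statement about real expectations with a weight, the form in which the coordinates are
  treated one after the other below.\<close>

lemma (in prob_space) char_distr_density:
  fixes X p :: "'a \<Rightarrow> real"
  assumes [measurable]: "X \<in> borel_measurable M" "p \<in> borel_measurable M"
    and p: "\<And>\<omega>. 0 \<le> p \<omega>" "\<And>\<omega>. p \<omega> \<le> B"
  shows "char (distr (density M p) borel X) t =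
    of_real (expectation (\<lambda>\<omega>. p \<omega> * cos (t * X \<omega>))) + \<i> * of_real (expectation (\<lambda>\<omega>. p \<omega> * sin (t * X \<omega>)))"
proof -
  have pB: "\<bar>p \<omega> * r\<bar> \<le> B" if "\<bar>r\<bar> \<le> 1" for \<omega> r
    using mult_mono[OF p(2)[of \<omega>] that] p[of \<omega>] by (simp add: abs_mult)
  have I: "integrable M (\<lambda>\<omega>. p \<omega> * cos (t * X \<omega>))" "integrable M (\<lambda>\<omega>. p \<omega> * sin (t * X \<omega>))"
    by (intro integrable_bounded_real[where B = B] pB; simp)+
  have "char (distr (density M p) borel X) t = (CLINT \<omega>|M. p \<omega> *\<^sub>R iexp (t * X \<omega>))"
    using p by (simp add: char_def integral_distr integral_density)
  also have "\<dots> = (CLINT \<omega>|M. of_real (p \<omega> * cos (t * X \<omega>)) + \<i> * of_real (p \<omega> * sin (t * X \<omega>)))"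
    by (intro Bochner_Integration.integral_cong refl)
      (simp add: exp_Euler scaleR_conv_of_real flip: cos_of_real sin_of_real, simp add: algebra_simps)
  also have "\<dots> = of_real (expectation (\<lambda>\<omega>. p \<omega> * cos (t * X \<omega>))) + \<i> * of_real (expectation (\<lambda>\<omega>. p \<omega> * sin (t * X \<omega>)))"
    using I by (subst Bochner_Integration.integral_add) (auto simp del: of_real_mult)
  finally show ?thesis .
qed

text \<open>Divided by their common mass, both weights become probability densities. Under these the
  characteristic functions of \<open>X\<close> and \<open>Y\<close> agree, so the two laws do. The
  lower bound 1 on the weights keeps the mass away from 0.\<close>

lemma (in prob_space) expectation_positive_weight_eqI:
  fixes X Y p q :: "'a \<Rightarrow> real"
  assumes [measurable]: "X \<in> borel_measurable M" "Y \<in> borel_measurable M"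
      "p \<in> borel_measurable M" "q \<in> borel_measurable M"
    and p: "\<And>\<omega>. 1 \<le> p \<omega>" "\<And>\<omega>. p \<omega> \<le> B" and q: "\<And>\<omega>. 1 \<le> q \<omega>" "\<And>\<omega>. q \<omega> \<le> B"
    and cos: "\<And>t. expectation (\<lambda>\<omega>. p \<omega> * cos (t * X \<omega>)) = expectation (\<lambda>\<omega>. q \<omega> * cos (t * Y \<omega>))"
    and sin: "\<And>t. expectation (\<lambda>\<omega>. p \<omega> * sin (t * X \<omega>)) = expectation (\<lambda>\<omega>. q \<omega> * sin (t * Y \<omega>))"
    and [measurable]: "A \<in> sets borel"
  shows "expectation (\<lambda>\<omega>. p \<omega> * indicator A (X \<omega>)) = expectation (\<lambda>\<omega>. q \<omega> * indicator A (Y \<omega>))"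
proof -
  define m where "m = expectation p"
  \<comment> \<open>At \<open>t = 0\<close> the cosine hypothesis says that both weights have the
    same total mass.\<close>
  have q_eq: "expectation q = m"
    using cos[of 0] by (simp add: m_def)
  have int_p: "integrable M p" and int_q: "integrable M q"
    using p q order_trans[OF zero_le_one p(1)] order_trans[OF zero_le_one q(1)]
    by (auto intro!: integrable_bounded_real[where B = B])
  have "1 \<le> m"
    unfolding m_def using integral_mono[OF _ int_p, of "\<lambda>_. 1"] p by (simp add: prob_space)
  have dist: "real_distribution (distr (density M (\<lambda>\<omega>. r \<omega> / m)) borel Z)"
    if [measurable]: "r \<in> borel_measurable M" "Z \<in> borel_measurable M"
      and r: "\<And>\<omega>. 1 \<le> r \<omega>" "expectation r = m" "integrable M r" for r Z :: "'a \<Rightarrow> real"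
  proof -
    have "(\<integral>\<^sup>+ \<omega>. ennreal (r \<omega> / m) \<partial>M) = ennreal (expectation (\<lambda>\<omega>. r \<omega> / m))"
      using r order_trans[OF zero_le_one r(1)] \<open>1 \<le> m\<close> by (intro nn_integral_eq_integral) auto
    also have "\<dots> = 1"
      using r(2) \<open>1 \<le> m\<close> by simp
    finally have "prob_space (density M (\<lambda>\<omega>. r \<omega> / m))"
      by (intro prob_spaceI) (simp add: emeasure_density cong: nn_integral_cong)
    then show ?thesis
      by (rule prob_space.real_distribution_distr) simp
  qed
  have meas: "expectation (\<lambda>\<omega>. r \<omega> * indicator A (Z \<omega>)) = m * measure (distr (density M (\<lambda>\<omega>. r \<omega> / m)) borel Z) A"
    if [measurable]: "r \<in> borel_measurable M" "Z \<in> borel_measurable M"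
      and r: "\<And>\<omega>. 1 \<le> r \<omega>" for r Z :: "'a \<Rightarrow> real"
  proof -
    have "measure (distr (density M (\<lambda>\<omega>. r \<omega> / m)) borel Z) A
        = (LINT x|distr (density M (\<lambda>\<omega>. r \<omega> / m)) borel Z. indicator A x)"
      by simp
    also have "\<dots> = expectation (\<lambda>\<omega>. (r \<omega> / m) * indicator A (Z \<omega>))"
      using order_trans[OF zero_le_one r] \<open>1 \<le> m\<close>
      by (subst integral_distr, simp, simp, subst integral_density) auto
    also have "\<dots> = expectation (\<lambda>\<omega>. r \<omega> * indicator A (Z \<omega>)) / m"
      by simp
    finally show ?thesis
      using \<open>1 \<le> m\<close> by simp
  qed
  have "distr (density M (\<lambda>\<omega>. p \<omega> / m)) borel X = distr (density M (\<lambda>\<omega>. q \<omega> / m)) borel Y"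
  proof (rule Levy_uniqueness)
    have "char (distr (density M (\<lambda>\<omega>. p \<omega> / m)) borel X) t
        = char (distr (density M (\<lambda>\<omega>. q \<omega> / m)) borel Y) t" for t
      using p q \<open>1 \<le> m\<close> order_trans[OF zero_le_one p(1)] order_trans[OF zero_le_one q(1)] cos[of t] sin[of t]
      by (subst (1 2) char_distr_density[where B = "B / m"]) (auto intro: divide_right_mono)
    then show "char (distr (density M (\<lambda>\<omega>. p \<omega> / m)) borel X) = char (distr (density M (\<lambda>\<omega>. q \<omega> / m)) borel Y)"
      by auto
  qed (intro dist; use p q q_eq m_def int_p int_q in simp)+
  then show ?thesis
    using meas[of p X] meas[of q Y] p q by simp
qed

text \<open>Adding the constant 2 to the weight makes it positive, so that Levy's uniqueness theorem for
  probability measures applies.\<close>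

lemma (in prob_space) expectation_weight_eqI:
  fixes X Y Z Z' :: "'a \<Rightarrow> real"
  assumes [measurable]: "X \<in> borel_measurable M" "Y \<in> borel_measurable M"
      "Z \<in> borel_measurable M" "Z' \<in> borel_measurable M"
    and Z: "\<And>\<omega>. \<bar>Z \<omega>\<bar> \<le> 1" "\<And>\<omega>. \<bar>Z' \<omega>\<bar> \<le> 1"
    and cos: "\<And>t. expectation (\<lambda>\<omega>. cos (t * X \<omega>)) = expectation (\<lambda>\<omega>. cos (t * Y \<omega>))"
    and sin: "\<And>t. expectation (\<lambda>\<omega>. sin (t * X \<omega>)) = expectation (\<lambda>\<omega>. sin (t * Y \<omega>))"
    and Zcos: "\<And>t. expectation (\<lambda>\<omega>. Z \<omega> * cos (t * X \<omega>)) = expectation (\<lambda>\<omega>. Z' \<omega> * cos (t * Y \<omega>))"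
    and Zsin: "\<And>t. expectation (\<lambda>\<omega>. Z \<omega> * sin (t * X \<omega>)) = expectation (\<lambda>\<omega>. Z' \<omega> * sin (t * Y \<omega>))"
    and [measurable]: "A \<in> sets borel"
  shows "expectation (\<lambda>\<omega>. Z \<omega> * indicator A (X \<omega>)) = expectation (\<lambda>\<omega>. Z' \<omega> * indicator A (Y \<omega>))"
proof -
  have le: "\<bar>a * b\<bar> \<le> 1" if "\<bar>a\<bar> \<le> 1" "\<bar>b\<bar> \<le> 1" for a b :: real
    using mult_mono[OF that] by (simp add: abs_mult)
  have split: "expectation (\<lambda>\<omega>. (2 + W \<omega>) * f (V \<omega>)) = 2 * expectation (\<lambda>\<omega>. f (V \<omega>)) + expectation (\<lambda>\<omega>. W \<omega> * f (V \<omega>))"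
    if [measurable]: "W \<in> borel_measurable M" "V \<in> borel_measurable M" "f \<in> borel_measurable borel"
      and W: "\<And>\<omega>. \<bar>W \<omega>\<bar> \<le> 1" and f: "\<And>x. \<bar>f x\<bar> \<le> 1" for W V :: "'a \<Rightarrow> real" and f :: "real \<Rightarrow> real"
  proof -
    have "integrable M (\<lambda>\<omega>. f (V \<omega>))" "integrable M (\<lambda>\<omega>. W \<omega> * f (V \<omega>))"
      using le[OF W f] f by (auto intro!: integrable_bounded_real[where B = 1])
    then show ?thesis
      by (simp add: distrib_right)
  qed
  \<comment> \<open>The constant weight 2 is the contribution without \<open>Z\<close>; subtracting
    it from the identity for \<open>2 + Z\<close> leaves the weight \<open>Z\<close>.\<close>
  have 0: "expectation (\<lambda>\<omega>. 2 * indicator A (X \<omega>)) = expectation (\<lambda>\<omega>. 2 * indicator A (Y \<omega>) :: real)"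
    by (rule expectation_positive_weight_eqI[where B = 2]) (auto simp: cos sin)
  have b: "1 \<le> 2 + Z \<omega>" "2 + Z \<omega> \<le> 3" "1 \<le> 2 + Z' \<omega>" "2 + Z' \<omega> \<le> 3" for \<omega>
    using Z[of \<omega>] by (auto simp: abs_le_iff)
  have "expectation (\<lambda>\<omega>. (2 + Z \<omega>) * indicator A (X \<omega>)) = expectation (\<lambda>\<omega>. (2 + Z' \<omega>) * indicator A (Y \<omega>))"
  proof (rule expectation_positive_weight_eqI[where B = 3])
    fix t
    show "expectation (\<lambda>\<omega>. (2 + Z \<omega>) * cos (t * X \<omega>)) = expectation (\<lambda>\<omega>. (2 + Z' \<omega>) * cos (t * Y \<omega>))"
      using split[of Z X "\<lambda>x. cos (t * x)"] split[of Z' Y "\<lambda>x. cos (t * x)"] Z cos Zcos by simp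
    show "expectation (\<lambda>\<omega>. (2 + Z \<omega>) * sin (t * X \<omega>)) = expectation (\<lambda>\<omega>. (2 + Z' \<omega>) * sin (t * Y \<omega>))"
      using split[of Z X "\<lambda>x. sin (t * x)"] split[of Z' Y "\<lambda>x. sin (t * x)"] Z sin Zsin by simp
  qed (use b in auto)
  moreover have "expectation (\<lambda>\<omega>. (2 + W \<omega>) * indicator A (V \<omega>)) = 2 * expectation (\<lambda>\<omega>. indicator A (V \<omega>)) + expectation (\<lambda>\<omega>. W \<omega> * indicator A (V \<omega>))"
    if "W \<in> borel_measurable M" "V \<in> borel_measurable M" "\<And>\<omega>. \<bar>W \<omega>\<bar> \<le> 1" for W V :: "'a \<Rightarrow> real"
    using that by (intro split) (auto simp: indicator_def)
  ultimately show ?thesis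
    using 0 Z by simp
qed

text \<open>A Cramer--Wold device: the factors \<open>exp (\<i> c\<^sub>j X\<^sub>j)\<close> of a character are replaced by indicators one
  at a time.\<close>

lemma (in prob_space) joint_law_eqI:
  fixes X Y :: "'i \<Rightarrow> 'a \<Rightarrow> real"
  assumes J: "finite J"
    and X[measurable]: "\<And>j. j \<in> J \<Longrightarrow> X j \<in> borel_measurable M"
    and Y[measurable]: "\<And>j. j \<in> J \<Longrightarrow> Y j \<in> borel_measurable M"
    and eq: "\<And>c. distr M borel (\<lambda>\<omega>. \<Sum>j\<in>J. c j * X j \<omega>) = distr M borel (\<lambda>\<omega>. \<Sum>j\<in>J. c j * Y j \<omega>)"
    and K: "K \<subseteq> J" and A: "\<And>j. j \<in> K \<Longrightarrow> A j \<in> sets borel"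
  shows "expectation (\<lambda>\<omega>. (\<Prod>j\<in>K. indicator (A j) (X j \<omega>)) * cos (\<Sum>j\<in>J. c j * X j \<omega>)) =
      expectation (\<lambda>\<omega>. (\<Prod>j\<in>K. indicator (A j) (Y j \<omega>)) * cos (\<Sum>j\<in>J. c j * Y j \<omega>)) \<and>
    expectation (\<lambda>\<omega>. (\<Prod>j\<in>K. indicator (A j) (X j \<omega>)) * sin (\<Sum>j\<in>J. c j * X j \<omega>)) =
      expectation (\<lambda>\<omega>. (\<Prod>j\<in>K. indicator (A j) (Y j \<omega>)) * sin (\<Sum>j\<in>J. c j * Y j \<omega>))"
  using finite_subset[OF K J] K A
proof (induction K arbitrary: c rule: finite_induct)
  case empty
  have *: "expectation (\<lambda>\<omega>. f (\<Sum>j\<in>J. c j * X j \<omega>)) = expectation (\<lambda>\<omega>. f (\<Sum>j\<in>J. c j * Y j \<omega>))"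
    if [measurable]: "f \<in> borel_measurable borel" for f :: "real \<Rightarrow> real"
    using arg_cong[OF eq[of c], of "\<lambda>N. integral\<^sup>L N f"] by (simp add: integral_distr)
  show ?case
    by (simp add: *[of cos] *[of sin])
next
  case (insert k K)
  have k: "k \<in> J" and KJ: "\<And>j. j \<in> K \<Longrightarrow> j \<in> J" using insert.prems by auto
  note X[OF k, measurable] Y[OF k, measurable]
  have [measurable]: "A j \<in> sets borel" if "j \<in> insert k K" for j
    using insert.prems that by auto
  have IH: "expectation (\<lambda>\<omega>. (\<Prod>j\<in>K. indicator (A j) (X j \<omega>)) * cos (\<Sum>j\<in>J. c j * X j \<omega>)) =
      expectation (\<lambda>\<omega>. (\<Prod>j\<in>K. indicator (A j) (Y j \<omega>)) * cos (\<Sum>j\<in>J. c j * Y j \<omega>))"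
    "expectation (\<lambda>\<omega>. (\<Prod>j\<in>K. indicator (A j) (X j \<omega>)) * sin (\<Sum>j\<in>J. c j * X j \<omega>)) =
      expectation (\<lambda>\<omega>. (\<Prod>j\<in>K. indicator (A j) (Y j \<omega>)) * sin (\<Sum>j\<in>J. c j * Y j \<omega>))" for c
    using insert.IH[of c] insert.prems by auto
  define PX PY where "PX = (\<lambda>\<omega>. \<Prod>j\<in>K. indicator (A j) (X j \<omega>) :: real)"
    and "PY = (\<lambda>\<omega>. \<Prod>j\<in>K. indicator (A j) (Y j \<omega>) :: real)"
  define LX LY where "LX = (\<lambda>c \<omega>. \<Sum>j\<in>J. c j * X j \<omega>)" and "LY = (\<lambda>c \<omega>. \<Sum>j\<in>J. c j * Y j \<omega>)"
  have [measurable]: "PX \<in> borel_measurable M" "PY \<in> borel_measurable M"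
    unfolding PX_def PY_def using KJ by (auto intro!: borel_measurable_prod borel_measurable_indicator' simp: space_borel)
  have [measurable]: "LX c \<in> borel_measurable M" "LY c \<in> borel_measurable M" for c
    unfolding LX_def LY_def by (auto intro!: borel_measurable_sum)
  have P: "\<bar>PX \<omega>\<bar> \<le> 1" "\<bar>PY \<omega>\<bar> \<le> 1" for \<omega>
    unfolding PX_def PY_def abs_prod by (auto intro!: prod_le_1)
  have le: "\<bar>PX \<omega> * r\<bar> \<le> 1" "\<bar>PY \<omega> * r\<bar> \<le> 1" if "\<bar>r\<bar> \<le> 1" for \<omega> r
    using mult_mono[OF P(1)[of \<omega>] that] mult_mono[OF P(2)[of \<omega>] that] by (auto simp: abs_mult)
  \<comment> \<open>Raising the coefficient at \<open>k\<close> by \<open>t\<close> adds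
    \<open>t * X k\<close> to the phase. This is why the induction hypothesis is needed for every
    \<open>c\<close>.\<close>
  have up: "LX (c(k := c k + t)) \<omega> = LX c \<omega> + t * X k \<omega>" "LY (c(k := c k + t)) \<omega> = LY c \<omega> + t * Y k \<omega>" for c t \<omega>
    using J k by (auto simp: LX_def LY_def sum.remove[of J k] distrib_right)
  have C: "expectation (\<lambda>\<omega>. PX \<omega> * cos (LX c \<omega> + t * X k \<omega>)) = expectation (\<lambda>\<omega>. PY \<omega> * cos (LY c \<omega> + t * Y k \<omega>))"
    and S: "expectation (\<lambda>\<omega>. PX \<omega> * sin (LX c \<omega> + t * X k \<omega>)) = expectation (\<lambda>\<omega>. PY \<omega> * sin (LY c \<omega> + t * Y k \<omega>))" for c t
    using IH[of "c(k := c k + t)"] by (simp_all only: PX_def PY_def up[unfolded LX_def LY_def] LX_def LY_def)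
  note int = integrable_bounded_real[where B = 1]
  have ints: "integrable M (\<lambda>\<omega>. PX \<omega> * cos (LX c \<omega> + t * X k \<omega>))" "integrable M (\<lambda>\<omega>. PX \<omega> * sin (LX c \<omega> + t * X k \<omega>))"
    "integrable M (\<lambda>\<omega>. PY \<omega> * cos (LY c \<omega> + t * Y k \<omega>))" "integrable M (\<lambda>\<omega>. PY \<omega> * sin (LY c \<omega> + t * Y k \<omega>))" for t
    by (intro int le; simp)+
  note C' = C[of c] and S' = S[of c]
  \<comment> \<open>Product-to-sum formulas express the separated factors through the induction
    hypothesis at \<open>t\<close> and \<open>- t\<close>; the form \<open>a + - b\<close> matches
    the latter.\<close>
  have trig: "cos a * cos b = (cos (a + b) + cos (a + - b)) / 2" "cos a * sin b = (sin (a + b) - sin (a + - b)) / 2"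
    "sin a * cos b = (sin (a + b) + sin (a + - b)) / 2" "sin a * sin b = (cos (a + - b) - cos (a + b)) / 2" for a b :: real
    by (simp_all add: cos_add sin_add cos_diff sin_diff)
  have E: "expectation (\<lambda>\<omega>. PX \<omega> * cos (LX c \<omega>) * cos (t * X k \<omega>)) = expectation (\<lambda>\<omega>. PY \<omega> * cos (LY c \<omega>) * cos (t * Y k \<omega>))"
    "expectation (\<lambda>\<omega>. PX \<omega> * cos (LX c \<omega>) * sin (t * X k \<omega>)) = expectation (\<lambda>\<omega>. PY \<omega> * cos (LY c \<omega>) * sin (t * Y k \<omega>))"
    "expectation (\<lambda>\<omega>. PX \<omega> * sin (LX c \<omega>) * cos (t * X k \<omega>)) = expectation (\<lambda>\<omega>. PY \<omega> * sin (LY c \<omega>) * cos (t * Y k \<omega>))"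
    "expectation (\<lambda>\<omega>. PX \<omega> * sin (LX c \<omega>) * sin (t * X k \<omega>)) = expectation (\<lambda>\<omega>. PY \<omega> * sin (LY c \<omega>) * sin (t * Y k \<omega>))" for t
    using ints[of t] ints[of "- t"] C'[of t] C'[of "- t"] S'[of t] S'[of "- t"]
    by (simp_all add: mult.assoc trig distrib_left right_diff_distrib)
  \<comment> \<open>Coefficients concentrated at \<open>k\<close> give the law of the single
    variable \<open>X k\<close>, the part without weight that the lemma on weights asks for.\<close>
  have O: "expectation (\<lambda>\<omega>. cos (t * X k \<omega>)) = expectation (\<lambda>\<omega>. cos (t * Y k \<omega>))"
    "expectation (\<lambda>\<omega>. sin (t * X k \<omega>)) = expectation (\<lambda>\<omega>. sin (t * Y k \<omega>))" for t
  proof -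
    have *: "(\<Sum>j\<in>J. (if j = k then t else 0) * Z j \<omega>) = t * Z k \<omega>" for Z :: "'i \<Rightarrow> 'a \<Rightarrow> real" and \<omega>
      using J k by (simp add: if_distrib[where f = "\<lambda>c. c * _"] cong: if_cong)
    have "expectation (\<lambda>\<omega>. f (t * X k \<omega>)) = expectation (\<lambda>\<omega>. f (t * Y k \<omega>))"
      if [measurable]: "f \<in> borel_measurable borel" for f :: "real \<Rightarrow> real"
      using arg_cong[OF eq[of "\<lambda>j. if j = k then t else 0"], of "\<lambda>N. integral\<^sup>L N f"]
      unfolding * by (simp add: integral_distr)
    from this[of cos] this[of sin] show "expectation (\<lambda>\<omega>. cos (t * X k \<omega>)) = expectation (\<lambda>\<omega>. cos (t * Y k \<omega>))"
      "expectation (\<lambda>\<omega>. sin (t * X k \<omega>)) = expectation (\<lambda>\<omega>. sin (t * Y k \<omega>))"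
      by simp_all
  qed
  have "expectation (\<lambda>\<omega>. PX \<omega> * cos (LX c \<omega>) * indicator (A k) (X k \<omega>)) = expectation (\<lambda>\<omega>. PY \<omega> * cos (LY c \<omega>) * indicator (A k) (Y k \<omega>))"
    by (intro expectation_weight_eqI O E le) auto
  moreover have "expectation (\<lambda>\<omega>. PX \<omega> * sin (LX c \<omega>) * indicator (A k) (X k \<omega>)) = expectation (\<lambda>\<omega>. PY \<omega> * sin (LY c \<omega>) * indicator (A k) (Y k \<omega>))"
    by (intro expectation_weight_eqI O E le) auto
  ultimately show ?case
    using insert.hyps by (simp add: PX_def PY_def LX_def LY_def mult.assoc mult.left_commute mult.commute)
qed

text \<open>The cylinders over finitely many coordinates generate the product sigma-algebra. Their
  probabilities are expectations of products of indicators, which is the cosine identity of the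
  preceding lemma with \<open>K = J\<close> and all coefficients 0.\<close>

lemma (in prob_space) law_of_family_eqI:
  fixes X Y :: "'i \<Rightarrow> 'a \<Rightarrow> real"
  assumes X[measurable]: "\<And>j. j \<in> I \<Longrightarrow> X j \<in> borel_measurable M"
    and Y[measurable]: "\<And>j. j \<in> I \<Longrightarrow> Y j \<in> borel_measurable M"
    and eq: "\<And>J c. finite J \<Longrightarrow> J \<subseteq> I \<Longrightarrow>
      distr M borel (\<lambda>\<omega>. \<Sum>j\<in>J. c j * X j \<omega>) = distr M borel (\<lambda>\<omega>. \<Sum>j\<in>J. c j * Y j \<omega>)"
  shows "law_of_family M I X = law_of_family M I Y"
  unfolding law_of_family_def
proof (rule measure_eqI_PiM_infinite)
  have mX[measurable]: "(\<lambda>\<omega>. \<lambda>i\<in>I. X i \<omega>) \<in> measurable M (Pi\<^sub>M I (\<lambda>_. borel))"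
    and mY[measurable]: "(\<lambda>\<omega>. \<lambda>i\<in>I. Y i \<omega>) \<in> measurable M (Pi\<^sub>M I (\<lambda>_. borel))"
    by (auto intro!: measurable_restrict)
  show "finite_measure (distr M (Pi\<^sub>M I (\<lambda>_. borel)) (\<lambda>\<omega>. \<lambda>i\<in>I. X i \<omega>))"
    by (intro finite_measure_distr) simp
  fix A :: "'i \<Rightarrow> real set" and J
  assume J: "finite J" "J \<subseteq> I" and A: "\<And>i. i \<in> J \<Longrightarrow> A i \<in> sets borel"
  have em: "emeasure (distr M (Pi\<^sub>M I (\<lambda>_. borel)) (\<lambda>\<omega>. \<lambda>i\<in>I. Z i \<omega>)) (prod_emb I (\<lambda>_. borel) J (Pi\<^sub>E J A))
      = ennreal (expectation (\<lambda>\<omega>. \<Prod>j\<in>J. indicator (A j) (Z j \<omega>)))"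
    if Z: "\<And>j. j \<in> I \<Longrightarrow> Z j \<in> borel_measurable M" for Z :: "'i \<Rightarrow> 'a \<Rightarrow> real"
  proof -
    have mZ: "(\<lambda>\<omega>. \<lambda>i\<in>I. Z i \<omega>) \<in> measurable M (Pi\<^sub>M I (\<lambda>_. borel))"
      using Z by (auto intro!: measurable_restrict)
    have S: "prod_emb I (\<lambda>_. borel) J (Pi\<^sub>E J A) \<in> sets (Pi\<^sub>M I (\<lambda>_. borel))"
      using J A by (intro sets_PiM_I) auto
    define B where "B = (\<lambda>\<omega>. \<lambda>i\<in>I. Z i \<omega>) -` prod_emb I (\<lambda>_. borel) J (Pi\<^sub>E J A) \<inter> space M"
    have B: "B \<in> sets M" unfolding B_def using mZ S by (rule measurable_sets)
    have "\<omega> \<in> B \<longleftrightarrow> (\<forall>j\<in>J. Z j \<omega> \<in> A j)" if "\<omega> \<in> space M" for \<omega>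
      using that J by (auto simp: B_def prod_emb_def PiE_def Pi_def extensional_def subset_eq)
    then have ind: "(\<Prod>j\<in>J. indicator (A j) (Z j \<omega>)) = (indicator B \<omega> :: real)" if "\<omega> \<in> space M" for \<omega>
      using that J(1) by (auto simp: indicator_def intro!: prod.neutral)
    have "emeasure (distr M (Pi\<^sub>M I (\<lambda>_. borel)) (\<lambda>\<omega>. \<lambda>i\<in>I. Z i \<omega>)) (prod_emb I (\<lambda>_. borel) J (Pi\<^sub>E J A)) = emeasure M B"
      unfolding B_def using mZ S by (rule emeasure_distr)
    also have "\<dots> = ennreal (expectation (indicator B))"
      using B by (simp add: emeasure_eq_measure)
    also have "expectation (indicator B) = (expectation (\<lambda>\<omega>. \<Prod>j\<in>J. indicator (A j) (Z j \<omega>)) :: real)"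
      by (intro Bochner_Integration.integral_cong) (auto simp: ind)
    finally show ?thesis .
  qed
  have "expectation (\<lambda>\<omega>. \<Prod>j\<in>J. indicator (A j) (X j \<omega>)) = (expectation (\<lambda>\<omega>. \<Prod>j\<in>J. indicator (A j) (Y j \<omega>)) :: real)"
    using joint_law_eqI[OF J(1), of X Y J A "\<lambda>_. 0"] X Y J A eq by (auto simp: subset_eq)
  then show "emeasure (distr M (Pi\<^sub>M I (\<lambda>_. borel)) (\<lambda>\<omega>. \<lambda>i\<in>I. X i \<omega>)) (prod_emb I (\<lambda>_. borel) J (Pi\<^sub>E J A))
    = emeasure (distr M (Pi\<^sub>M I (\<lambda>_. borel)) (\<lambda>\<omega>. \<lambda>i\<in>I. Y i \<omega>)) (prod_emb I (\<lambda>_. borel) J (Pi\<^sub>E J A))"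
    using em[of X] em[of Y] X Y by (simp del: indicator_simps)
qed auto

section \<open>Mean and variance of Gaussian combinations\<close>

lemma normal_law_moments:
  assumes "0 \<le> \<sigma>"
  shows "integrable (normal_law m \<sigma>) (\<lambda>x. x)" "(LINT x|normal_law m \<sigma>. x) = m"
    "integrable (normal_law m \<sigma>) (\<lambda>x. x\<^sup>2)" "(LINT x|normal_law m \<sigma>. x\<^sup>2) = \<sigma>\<^sup>2 + m\<^sup>2"
proof -
  have "integrable (normal_law m \<sigma>) (\<lambda>x. x) \<and> (LINT x|normal_law m \<sigma>. x) = m \<and>
    integrable (normal_law m \<sigma>) (\<lambda>x. x\<^sup>2) \<and> (LINT x|normal_law m \<sigma>. x\<^sup>2) = \<sigma>\<^sup>2 + m\<^sup>2"
  proof (cases "\<sigma> = 0")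
    case True
    have law: "normal_law m \<sigma> = return borel m"
      using True by (simp add: normal_law_def)
    have int: "integrable (return borel m) f" if "f \<in> borel_measurable borel" for f :: "real \<Rightarrow> real"
      using that by (simp add: integrable_iff_bounded nn_integral_return)
    have "integrable (return borel m) (\<lambda>x. x)" "integrable (return borel m) (\<lambda>x. x\<^sup>2)"
      by (rule int, simp)+
    moreover have "(LINT x|return borel m. x) = m" "(LINT x|return borel m. x\<^sup>2) = m\<^sup>2"
      by (rule integral_return; simp)+
    ultimately show ?thesis
      unfolding law using True by simp
  next
    case False
    with assms have s: "0 < \<sigma>" by simp
    have 1: "has_bochner_integral lborel (\<lambda>x. normal_density m \<sigma> x * x) m"
      by (rule normal_moment_nz_1[OF s])
    have 2: "has_bochner_integral lborel (\<lambda>x. normal_density m \<sigma> x * (x - m)\<^sup>2) (\<sigma>\<^sup>2)"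
      using normal_moment_even[OF s, of m 1] by (simp add: eval_nat_numeral)
    have 0: "has_bochner_integral lborel (normal_density m \<sigma>) 1"
      using s by (simp add: has_bochner_integral_iff)
    \<comment> \<open>The second moment comes from the central one through
      \<open>x^2 = (x - m)^2 + 2 * m * x - m^2\<close>.\<close>
    have "has_bochner_integral lborel (\<lambda>x. normal_density m \<sigma> x * (x - m)\<^sup>2 + 2 * m * (normal_density m \<sigma> x * x)
        - m\<^sup>2 * normal_density m \<sigma> x) (\<sigma>\<^sup>2 + 2 * m * m - m\<^sup>2 * 1)"
      by (intro has_bochner_integral_add has_bochner_integral_diff has_bochner_integral_mult_right 0 1 2)
    then have 3: "has_bochner_integral lborel (\<lambda>x. normal_density m \<sigma> x * x\<^sup>2) (\<sigma>\<^sup>2 + m\<^sup>2)"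
      by (simp add: power2_eq_square algebra_simps)
    show ?thesis
      using False 1 3 by (simp add: normal_law_def integrable_density integral_density has_bochner_integral_iff)
  qed
  then show "integrable (normal_law m \<sigma>) (\<lambda>x. x)" "(LINT x|normal_law m \<sigma>. x) = m"
    "integrable (normal_law m \<sigma>) (\<lambda>x. x\<^sup>2)" "(LINT x|normal_law m \<sigma>. x\<^sup>2) = \<sigma>\<^sup>2 + m\<^sup>2"
    by auto
qed

text \<open>The parameters are read off by integrating over the law. Linearity needs
  \<open>X i\<close> and \<open>X i * X j\<close> to be integrable; an expectation equal to 0 does
  not tell this, because 0 is also the value for functions that are not integrable. Integrability
  comes from the one-element combinations, whose normal laws have finite moments.\<close>

lemma (in prob_space) centered_gaussian_combination:
  assumes G: "centered_gaussian_family M I X" and J: "finite J" "J \<subseteq> I"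
  obtains \<sigma> where "0 \<le> \<sigma>" "distr M borel (\<lambda>\<omega>. \<Sum>j\<in>J. c j * X j \<omega>) = normal_law 0 \<sigma>"
    "\<sigma>\<^sup>2 = (\<Sum>i\<in>J. \<Sum>j\<in>J. c i * c j * expectation (\<lambda>\<omega>. X i \<omega> * X j \<omega>))"
proof -
  have X[measurable]: "\<And>i. i \<in> I \<Longrightarrow> X i \<in> borel_measurable M"
    and E0: "\<And>i. i \<in> I \<Longrightarrow> expectation (X i) = 0"
    using G by (auto simp: centered_gaussian_family_def gaussian_family_def)
  have law: "\<exists>m \<sigma>. 0 \<le> \<sigma> \<and> distr M borel (\<lambda>\<omega>. \<Sum>j\<in>J. c j * X j \<omega>) = normal_law m \<sigma>"
    if "finite J" "J \<subseteq> I" for J c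
    using G that by (auto simp: centered_gaussian_family_def gaussian_family_def)
  have int: "integrable M (X i)" "integrable M (\<lambda>\<omega>. (X i \<omega>)\<^sup>2)" if i: "i \<in> I" for i
  proof -
    obtain m \<sigma> where "0 \<le> \<sigma>" and d: "distr M borel (X i) = normal_law m \<sigma>"
      using law[of "{i}" "\<lambda>_. 1"] i by auto
    then have "integrable (distr M borel (X i)) (\<lambda>x. x)" "integrable (distr M borel (X i)) (\<lambda>x. x\<^sup>2)"
      using normal_law_moments by (auto simp: d)
    then show "integrable M (X i)" "integrable M (\<lambda>\<omega>. (X i \<omega>)\<^sup>2)"
      using X[OF i] by (auto simp: integrable_distr_eq)
  qed
  have prod: "integrable M (\<lambda>\<omega>. X i \<omega> * X j \<omega>)" if ij: "i \<in> I" "j \<in> I" for i j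
  proof (rule Bochner_Integration.integrable_bound)
    show "integrable M (\<lambda>\<omega>. (X i \<omega>)\<^sup>2 + (X j \<omega>)\<^sup>2)"
      using int ij by simp
    show "(\<lambda>\<omega>. X i \<omega> * X j \<omega>) \<in> borel_measurable M" using ij by simp
    have "\<bar>a * b\<bar> \<le> a\<^sup>2 + b\<^sup>2" for a b :: real
      using sum_squares_bound[of "\<bar>a\<bar>" "\<bar>b\<bar>"] zero_le_mult_iff[of "\<bar>a\<bar>" "\<bar>b\<bar>"]
      unfolding abs_mult power2_abs by linarith
    then show "AE \<omega> in M. norm (X i \<omega> * X j \<omega>) \<le> norm ((X i \<omega>)\<^sup>2 + (X j \<omega>)\<^sup>2)"
      by simp
  qed
  obtain m \<sigma> where s: "0 \<le> \<sigma>" and d: "distr M borel (\<lambda>\<omega>. \<Sum>j\<in>J. c j * X j \<omega>) = normal_law m \<sigma>"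
    using law[OF J, of c] by auto
  have [measurable]: "(\<lambda>\<omega>. \<Sum>j\<in>J. c j * X j \<omega>) \<in> borel_measurable M"
    using J by (auto intro!: borel_measurable_sum)
  have "m = (LINT x|distr M borel (\<lambda>\<omega>. \<Sum>j\<in>J. c j * X j \<omega>). x)"
    using normal_law_moments(2)[OF s, of m] by (simp add: d)
  also have "\<dots> = (\<Sum>j\<in>J. c j * expectation (X j))"
    using J int by (subst integral_distr) (auto intro!: Bochner_Integration.integral_sum simp: subset_eq)
  also have "\<dots> = 0"
    using J E0 by (auto intro!: sum.neutral)
  finally have m: "m = 0" .
  have "\<sigma>\<^sup>2 = (LINT x|distr M borel (\<lambda>\<omega>. \<Sum>j\<in>J. c j * X j \<omega>). x\<^sup>2)"
    using normal_law_moments(4)[OF s, of 0] by (simp add: d m)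
  also have "\<dots> = expectation (\<lambda>\<omega>. \<Sum>i\<in>J. \<Sum>j\<in>J. c i * c j * (X i \<omega> * X j \<omega>))"
  proof -
    have "(\<Sum>j\<in>J. c j * X j \<omega>)\<^sup>2 = (\<Sum>i\<in>J. \<Sum>j\<in>J. c i * c j * (X i \<omega> * X j \<omega>))" for \<omega>
      unfolding power2_eq_square sum_product by (intro sum.cong refl) (simp add: mult_ac)
    then show ?thesis
      by (subst integral_distr) simp_all
  qed
  also have "\<dots> = (\<Sum>i\<in>J. \<Sum>j\<in>J. c i * c j * expectation (\<lambda>\<omega>. X i \<omega> * X j \<omega>))"
  proof -
    have int: "integrable M (\<lambda>\<omega>. c i * c j * (X i \<omega> * X j \<omega>))" if "i \<in> J" "j \<in> J" for i j
      using that J by (intro integrable_mult_right prod) auto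
    have "expectation (\<lambda>\<omega>. \<Sum>i\<in>J. \<Sum>j\<in>J. c i * c j * (X i \<omega> * X j \<omega>))
        = (\<Sum>i\<in>J. \<Sum>j\<in>J. expectation (\<lambda>\<omega>. c i * c j * (X i \<omega> * X j \<omega>)))"
      by (subst Bochner_Integration.integral_sum; intro sum.cong refl Bochner_Integration.integral_sum
        Bochner_Integration.integrable_sum int)
    then show ?thesis by simp
  qed
  finally show ?thesis
    using that s d m by simp
qed

lemma (in prob_space) centered_gaussian_law_eqI:
  assumes "centered_gaussian_family M I X" "centered_gaussian_family M I Y"
    and cov: "\<And>i j. i \<in> I \<Longrightarrow> j \<in> I \<Longrightarrow>
      expectation (\<lambda>\<omega>. X i \<omega> * X j \<omega>) = expectation (\<lambda>\<omega>. Y i \<omega> * Y j \<omega>)"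
  shows "law_of_family M I X = law_of_family M I Y"
proof (rule law_of_family_eqI)
  fix J c assume J: "finite J" "J \<subseteq> I"
  obtain s where s: "0 \<le> s" "distr M borel (\<lambda>\<omega>. \<Sum>j\<in>J. c j * X j \<omega>) = normal_law 0 s"
    "s\<^sup>2 = (\<Sum>i\<in>J. \<Sum>j\<in>J. c i * c j * expectation (\<lambda>\<omega>. X i \<omega> * X j \<omega>))"
    using centered_gaussian_combination[OF assms(1) J] by blast
  obtain s' where s': "0 \<le> s'" "distr M borel (\<lambda>\<omega>. \<Sum>j\<in>J. c j * Y j \<omega>) = normal_law 0 s'"
    "s'\<^sup>2 = (\<Sum>i\<in>J. \<Sum>j\<in>J. c i * c j * expectation (\<lambda>\<omega>. Y i \<omega> * Y j \<omega>))"
    using centered_gaussian_combination[OF assms(2) J] by blast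
  have "s\<^sup>2 = s'\<^sup>2"
    unfolding s(3) s'(3) using J cov by (intro sum.cong refl) (auto simp: subset_eq)
  then have "s = s'" using s(1) s'(1) by simp
  then show "distr M borel (\<lambda>\<omega>. \<Sum>j\<in>J. c j * X j \<omega>) = distr M borel (\<lambda>\<omega>. \<Sum>j\<in>J. c j * Y j \<omega>)"
    using s(2) s'(2) by simp
qed (use assms in \<open>auto simp: centered_gaussian_family_def gaussian_family_def\<close>)

text \<open>Injectivity makes a combination over \<open>J\<close> a combination of distinct members
  indexed by the image of \<open>J\<close>, with coefficients carried along the inverse of
  \<open>f\<close>.\<close>

lemma centered_gaussian_family_reindex:
  assumes G: "centered_gaussian_family M I X" and f: "inj_on f I" "f ` I \<subseteq> I"
  shows "centered_gaussian_family M I (\<lambda>i. X (f i))"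
  unfolding centered_gaussian_family_def gaussian_family_def
proof (intro conjI allI impI ballI)
  fix J and c :: "'b \<Rightarrow> real" assume J: "finite J \<and> J \<subseteq> I"
  have inj: "inj_on f J" using f(1) J by (auto intro: inj_on_subset)
  have "(\<Sum>j\<in>J. c j * X (f j) \<omega>) = (\<Sum>j\<in>f ` J. c (the_inv_into J f j) * X j \<omega>)" for \<omega>
    using inj by (simp add: sum.reindex the_inv_into_f_f)
  moreover have "finite (f ` J)" "f ` J \<subseteq> I" using J f(2) by auto
  moreover have "\<exists>m \<sigma>. 0 \<le> \<sigma> \<and> distr M borel (\<lambda>\<omega>. \<Sum>j\<in>K. d j * X j \<omega>) = normal_law m \<sigma>"
    if "finite K" "K \<subseteq> I" for K d
    using G that by (auto simp: centered_gaussian_family_def gaussian_family_def)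
  ultimately show "\<exists>m \<sigma>. 0 \<le> \<sigma> \<and> distr M borel (\<lambda>\<omega>. \<Sum>j\<in>J. c j * X (f j) \<omega>) = normal_law m \<sigma>"
    by presburger
next
  fix i assume "i \<in> I"
  then have "f i \<in> I" using f(2) by auto
  then show "X (f i) \<in> borel_measurable M" "prob_space.expectation M (X (f i)) = 0"
    using G by (auto simp: centered_gaussian_family_def gaussian_family_def)
qed

section \<open>Completeness of \<open>L\<^sup>2\<close>\<close>

lemma square_integrable_rep_L2: "square_integrable (rep_L2 u)"
  using Quotient3_rep_reflp[OF Quotient3_L2, of u] by auto

lemma L2_of_rep_L2 [simp]: "L2_of (rep_L2 u) = u"
  unfolding L2_of_def by (rule Quotient3_abs_rep[OF Quotient3_L2])

lemma L2_of_eq_iff: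
  assumes "square_integrable f" "square_integrable g"
  shows "L2_of f = L2_of g \<longleftrightarrow> (AE x in lborel. f x = g x)"
  using Quotient3_rel[OF Quotient3_L2, of f g] assms unfolding L2_of_def by auto

text \<open>No function is related to one outside L2, so both classes are the value of
  \<open>Abs_L2\<close> at the empty set: unspecified, but the same. This matters because a slice of
  \<phi> may leave L2 on a null set of times, and its class still occurs in the covariance.\<close>

lemma L2_of_not_square_integrable:
  fixes f g :: "'a::euclidean_space \<Rightarrow> real"
  assumes "\<not> square_integrable f" "\<not> square_integrable g"
  shows "L2_of f = L2_of g"
proof -
  let ?R = "\<lambda>f g :: 'a \<Rightarrow> real. square_integrable f \<and> square_integrable g \<and> (AE x in lborel. f x = g x)"
  have part: "part_equivp ?R"
    using square_integrable_zero
    by (intro part_equivpI) (auto intro!: sympI transpI)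
  have quot: "quot_type ?R Abs_L2 Rep_L2"
  proof (rule quot_type.intro)
    show "\<exists>f. ?R f f \<and> Rep_L2 u = Collect (?R f)" for u
      using L2.Rep_L2[of u] by simp
    show "Rep_L2 (Abs_L2 c) = c" if "\<exists>f. ?R f f \<and> c = Collect (?R f)" for c
      using that by (intro L2.Abs_L2_inverse) simp
  qed (use part in \<open>simp_all only: L2.Rep_L2_inverse L2.Rep_L2_inject\<close>)
  show ?thesis
    unfolding L2_of_def abs_L2_def quot_type.abs_def[OF quot] using assms by simp
qed

lemma L2_of_add: "square_integrable f \<Longrightarrow> square_integrable g \<Longrightarrow> L2_of (\<lambda>x. f x + g x) = L2_of f + L2_of g"
  unfolding L2_of_def by (rule plus_L2.abs_eq[symmetric]) (auto simp: eq_onp_def)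

lemma L2_of_scale: "square_integrable f \<Longrightarrow> L2_of (\<lambda>x. c * f x) = c *\<^sub>R L2_of f"
  unfolding L2_of_def by (rule scaleR_L2.abs_eq[symmetric]) auto

lemma square_integrable_diff: "square_integrable f \<Longrightarrow> square_integrable g \<Longrightarrow> square_integrable (\<lambda>x. f x - g x)"
  using square_integrable_add[of f "\<lambda>x. - g x"] square_integrable_uminus[of g] by simp

lemma L2_of_diff: "square_integrable f \<Longrightarrow> square_integrable g \<Longrightarrow> L2_of (\<lambda>x. f x - g x) = L2_of f - L2_of g"
  using L2_of_add[of f "\<lambda>x. (-1) * g x"] L2_of_scale[of g "-1"] square_integrable_scale[of g "-1"] by simp

lemma inner_L2_of:
  "square_integrable f \<Longrightarrow> square_integrable g \<Longrightarrow> inner (L2_of f) (L2_of g) = (LINT x|lborel. f x * g x)"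
  unfolding L2_of_def by (rule inner_L2.abs_eq) auto

lemma norm_L2_of:
  assumes "square_integrable f"
  shows "(norm (L2_of f))\<^sup>2 = (LINT x|lborel. (f x)\<^sup>2)"
  using inner_L2_of[OF assms assms] by (simp add: power2_norm_eq_inner) (simp add: power2_eq_square)

lemma nn_integral_norm_L2_of:
  assumes "square_integrable f"
  shows "(\<integral>\<^sup>+ x. ennreal ((f x)\<^sup>2) \<partial>lborel) = ennreal ((norm (L2_of f))\<^sup>2)"
  using assms by (simp add: norm_L2_of nn_integral_eq_integral square_integrable_def)

text \<open>The weights \<open>4\<^sup>k\<close> turn a bound on the squares of the increments into a geometric bound on the
  increments themselves.\<close>

lemma AE_convergent_of_increments:
  fixes f :: "nat \<Rightarrow> 'a::euclidean_space \<Rightarrow> real"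
  assumes f: "\<And>k. square_integrable (f k)"
    and incr: "\<And>k. norm (L2_of (f (Suc k)) - L2_of (f k)) \<le> (1/4) ^ k"
  shows "AE x in lborel. convergent (\<lambda>k. f k x)"
proof -
  have [measurable]: "f k \<in> borel_measurable lborel" for k
    using f by (simp add: square_integrable_def)
  define d where "d = (\<lambda>k x. f (Suc k) x - f k x)"
  have d: "square_integrable (d k)" for k
    unfolding d_def by (intro square_integrable_diff f)
  have [measurable]: "d k \<in> borel_measurable lborel" for k
    using d by (simp add: square_integrable_def)
  have nd: "(\<integral>\<^sup>+ x. ennreal ((d k x)\<^sup>2) \<partial>lborel) \<le> ennreal ((1/16) ^ k)" for k
  proof -
    have "(norm (L2_of (d k)))\<^sup>2 \<le> ((1/4) ^ k)\<^sup>2"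
      using incr[of k] by (intro power_mono) (simp_all add: d_def L2_of_diff f)
    also have "\<dots> = (1/16 :: real) ^ k"
      by (simp add: power2_eq_square flip: power_mult_distrib)
    finally show ?thesis
      by (simp add: nn_integral_norm_L2_of d ennreal_leI)
  qed
  have "(\<integral>\<^sup>+ x. (\<Sum>k. ennreal (4 ^ k * (d k x)\<^sup>2)) \<partial>lborel) = (\<Sum>k. \<integral>\<^sup>+ x. ennreal (4 ^ k * (d k x)\<^sup>2) \<partial>lborel)"
    by (intro nn_integral_suminf) simp
  also have "\<dots> \<le> (\<Sum>k. ennreal ((1/4) ^ k))"
  proof (intro suminf_le allI)
    fix k
    have "(\<integral>\<^sup>+ x. ennreal (4 ^ k * (d k x)\<^sup>2) \<partial>lborel) = ennreal (4 ^ k) * (\<integral>\<^sup>+ x. ennreal ((d k x)\<^sup>2) \<partial>lborel)"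
      by (simp add: ennreal_mult nn_integral_cmult)
    also have "\<dots> \<le> ennreal (4 ^ k) * ennreal ((1/16) ^ k)"
      using nd by (intro mult_left_mono) auto
    also have "\<dots> = ennreal ((1/4) ^ k)"
      by (simp flip: ennreal_mult power_mult_distrib)
    finally show "(\<integral>\<^sup>+ x. ennreal (4 ^ k * (d k x)\<^sup>2) \<partial>lborel) \<le> ennreal ((1/4) ^ k)" .
  qed auto
  also have "\<dots> = ennreal (\<Sum>k. (1/4) ^ k)"
    by (intro suminf_ennreal2) (auto intro!: summable_geometric)
  finally have "(\<integral>\<^sup>+ x. (\<Sum>k. ennreal (4 ^ k * (d k x)\<^sup>2)) \<partial>lborel) \<noteq> \<infinity>"
    by (auto simp: top_unique)
  then have "AE x in lborel. (\<Sum>k. ennreal (4 ^ k * (d k x)\<^sup>2)) \<noteq> \<infinity>"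
    by (rule nn_integral_PInf_AE[rotated]) simp
  then show ?thesis
  proof eventually_elim
    fix x
    define S where "S = (\<Sum>k. ennreal (4 ^ k * (d k x)\<^sup>2))"
    assume "(\<Sum>k. ennreal (4 ^ k * (d k x)\<^sup>2)) \<noteq> \<infinity>"
    then have "S \<noteq> \<infinity>" unfolding S_def .
    then obtain C where C: "0 \<le> C" "S = ennreal C"
      using ennreal_cases[of S] unfolding infinity_ennreal_def by metis
    have bound: "\<bar>d k x\<bar> \<le> sqrt C * (1/2) ^ k" for k
    proof -
      have "ennreal (4 ^ k * (d k x)\<^sup>2) \<le> S"
      proof -
        have "sum (\<lambda>k. ennreal (4 ^ k * (d k x)\<^sup>2)) {k} \<le> S"
          unfolding S_def by (rule sum_le_suminf) (rule summableI, rule finite.intros, rule finite.intros, rule zero_le)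
        then show ?thesis by (simp only: sum.insert sum.empty finite.intros empty_iff not_False_eq_True add_0_right)
      qed
      then have "4 ^ k * (d k x)\<^sup>2 \<le> C"
        unfolding C(2) using C(1) by simp
      moreover have "(2 ^ k * \<bar>d k x\<bar>)\<^sup>2 = (2 ^ k * 2 ^ k) * (d k x)\<^sup>2"
        unfolding power_mult_distrib power2_abs by (simp only: power2_eq_square)
      moreover have "(2 :: real) ^ k * 2 ^ k = 4 ^ k"
        unfolding power_mult_distrib[symmetric] by simp
      ultimately have "(2 ^ k * \<bar>d k x\<bar>)\<^sup>2 \<le> C"
        by simp
      then have "2 ^ k * \<bar>d k x\<bar> \<le> sqrt C"
        by (rule real_le_rsqrt)
      then show ?thesis
        by (simp add: power_divide field_simps)
    qed
    have "summable (\<lambda>k. d k x)"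
      by (rule summable_comparison_test'[where g = "\<lambda>k. sqrt C * (1/2) ^ k" and N = 0])
        (use bound in \<open>auto intro!: summable_mult summable_geometric\<close>)
    then have "convergent (\<lambda>n. \<Sum>k<n. d k x)"
      by (simp add: summable_iff_convergent)
    moreover have "(\<Sum>k<n. d k x) = f n x - f 0 x" for n
      unfolding d_def by (rule sum_lessThan_telescope)
    ultimately have "convergent (\<lambda>n. (f n x - f 0 x) + f 0 x)"
      by (intro convergent_add convergent_const) simp
    then show "convergent (\<lambda>k. f k x)"
      by simp
  qed
qed

text \<open>Riesz-Fischer: a subsequence with geometric increments converges almost everywhere,
  Fatou's lemma shows that its pointwise limit is also the limit in norm, and a Cauchy sequence
  converges along with any of its subsequences.\<close>

instance L2 :: (euclidean_space) complete_space
proof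
  fix s :: "nat \<Rightarrow> 'a L2" assume s: "Cauchy s"
  have "\<exists>N. \<forall>m\<ge>N. \<forall>n\<ge>N. dist (s m) (s n) < (1/4) ^ k" for k
    using s by (intro metric_CauchyD) auto
  then obtain N where N: "\<And>k m n. m \<ge> N k \<Longrightarrow> n \<ge> N k \<Longrightarrow> dist (s m) (s n) < (1/4) ^ k"
    by metis
  \<comment> \<open>The sum over all \<open>i \<le> k\<close> ensures \<open>N k \<le> r k\<close>;
    the summand \<open>k\<close> makes \<open>r\<close> strictly increasing even where
    \<open>N\<close> vanishes.\<close>
  define r where "r = (\<lambda>k. (\<Sum>i\<le>k. N i) + k)"
  have r_mono: "strict_mono r"
    by (rule strict_mono_Suc_iff[THEN iffD2]) (auto simp: r_def)
  have r_ge: "N k \<le> r k" for k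
    unfolding r_def using member_le_sum[of k "{..k}" N] by simp
  define f where "f k = rep_L2 (s (r k))" for k
  have f: "square_integrable (f k)" and sf: "L2_of (f k) = s (r k)" for k
    by (simp_all add: f_def square_integrable_rep_L2)
  have [measurable]: "f k \<in> borel_measurable lborel" for k
    using f by (simp add: square_integrable_def)
  have close: "norm (s (r m) - s (r n)) \<le> (1/4) ^ k" if "m \<ge> k" "n \<ge> k" for m n k
  proof -
    have "r k \<le> r m" "r k \<le> r n"
      using that r_mono by (simp_all add: strict_mono_less_eq)
    with r_ge[of k] N[of k "r m" "r n"] show ?thesis
      by (simp add: dist_norm)
  qed
  have conv: "AE x in lborel. convergent (\<lambda>k. f k x)"
    by (rule AE_convergent_of_increments[OF f]) (simp add: sf close)
  define F where "F = (\<lambda>x. lim (\<lambda>k. f k x))"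
  have [measurable]: "F \<in> borel_measurable lborel"
    unfolding F_def by (rule borel_measurable_lim_metric) simp
  have lim: "AE x in lborel. (\<lambda>k. f k x) \<longlonglongrightarrow> F x"
    using conv by (simp add: convergent_LIMSEQ_iff F_def)
  \<comment> \<open>With \<open>n\<close> fixed, the Cauchy bound on the difference of members
    \<open>m\<close> and \<open>n\<close> passes to the limit in \<open>m\<close>. For
    \<open>k = 0\<close> it puts \<open>F - f n\<close> into L2; for large \<open>k\<close> it gives
    convergence.\<close>
  have Fatou: "(\<integral>\<^sup>+ x. ennreal ((F x - f n x)\<^sup>2) \<partial>lborel) \<le> ennreal (((1/4) ^ k)\<^sup>2)" if "n \<ge> k" for n k
  proof -
    have "(\<integral>\<^sup>+ x. ennreal ((F x - f n x)\<^sup>2) \<partial>lborel)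
        = (\<integral>\<^sup>+ x. liminf (\<lambda>m. ennreal ((f m x - f n x)\<^sup>2)) \<partial>lborel)"
    proof (rule nn_integral_cong_AE, use lim in eventually_elim)
      fix x assume "(\<lambda>k. f k x) \<longlonglongrightarrow> F x"
      then have "(\<lambda>m. ennreal ((f m x - f n x)\<^sup>2)) \<longlonglongrightarrow> ennreal ((F x - f n x)\<^sup>2)"
        by (intro tendsto_intros)
      then show "ennreal ((F x - f n x)\<^sup>2) = liminf (\<lambda>m. ennreal ((f m x - f n x)\<^sup>2))"
        by (intro lim_imp_Liminf[symmetric]) auto
    qed
    also have "\<dots> \<le> liminf (\<lambda>m. \<integral>\<^sup>+ x. ennreal ((f m x - f n x)\<^sup>2) \<partial>lborel)"
      by (rule nn_integral_liminf) simp
    also have "\<dots> \<le> ennreal (((1/4) ^ k)\<^sup>2)"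
    proof (rule Liminf_le)
      show "\<forall>\<^sub>F m in sequentially. (\<integral>\<^sup>+ x. ennreal ((f m x - f n x)\<^sup>2) \<partial>lborel) \<le> ennreal (((1/4) ^ k)\<^sup>2)"
      proof (rule eventually_sequentiallyI[of k])
        fix m assume "k \<le> m"
        with close[OF this that] show "(\<integral>\<^sup>+ x. ennreal ((f m x - f n x)\<^sup>2) \<partial>lborel) \<le> ennreal (((1/4) ^ k)\<^sup>2)"
          by (subst nn_integral_norm_L2_of) (auto simp: square_integrable_diff f L2_of_diff sf intro!: ennreal_leI power_mono)
      qed
    qed simp
    finally show ?thesis .
  qed
  have diff: "square_integrable (\<lambda>x. F x - f n x)" for n
    using Fatou[of 0 n] unfolding square_integrable_def by (auto simp: integrable_iff_bounded le_less_trans)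
  then have F: "square_integrable F"
    using square_integrable_add[OF diff[of 0] f[of 0]] by simp
  have "(\<lambda>k. s (r k)) \<longlonglongrightarrow> L2_of F"
  proof (rule LIMSEQ_I)
    fix e :: real assume "0 < e"
    then obtain k where k: "(1/4) ^ k < e"
      using real_arch_pow_inv[of e "1/4"] by auto
    have "norm (s (r n) - L2_of F) < e" if "n \<ge> k" for n
    proof -
      have "ennreal ((norm (L2_of F - s (r n)))\<^sup>2) \<le> ennreal (((1/4) ^ k)\<^sup>2)"
        using Fatou[OF that] by (simp add: nn_integral_norm_L2_of diff L2_of_diff F f sf)
      then have "norm (L2_of F - s (r n)) \<le> (1/4) ^ k"
        by (simp add: power2_le_iff_abs_le)
      with k show ?thesis
        by (simp add: norm_minus_commute)
    qed
    then show "\<exists>no. \<forall>n\<ge>no. norm (s (r n) - L2_of F) < e"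
      by auto
  qed
  then have "s \<longlonglongrightarrow> L2_of F"
    using s r_mono by (intro Cauchy_converges_subseq[of s r]) (simp_all add: comp_def)
  then show "convergent s"
    by (rule convergentI)
qed

section \<open>Projection-valued measures\<close>

lemma square_diff_le: "(a - b)\<^sup>2 \<le> 2 * (c - a)\<^sup>2 + 2 * (c - b)\<^sup>2" for a b c :: real
proof -
  have "2 * (c - a)\<^sup>2 + 2 * (c - b)\<^sup>2 - (a - b)\<^sup>2 = (2 * c - a - b)\<^sup>2"
    by (simp add: power2_eq_square algebra_simps)
  then show ?thesis
    using zero_le_power2[of "2 * c - a - b"] by linarith
qed

lemma simple_functionD_borel:
  assumes "simple_function borel (s :: real \<Rightarrow> 'c)"
  shows "finite (range s)" "s -` {c} \<in> sets borel"
  using simple_functionD[OF assms] by simp_all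

locale pvm =
  fixes E :: "real set \<Rightarrow> 'h::real_inner \<Rightarrow> 'h"
  assumes pvm: "projection_valued_measure E"
begin

abbreviation \<mu> where "\<mu> \<equiv> scalar_spectral_measure E"

abbreviation S where "S \<equiv> simple_spectral_integral E"

lemma linear_E: "B \<in> sets borel \<Longrightarrow> linear (E B)"
  and E_sym: "B \<in> sets borel \<Longrightarrow> inner (E B u) v = inner u (E B v)"
  and E_Int: "B \<in> sets borel \<Longrightarrow> C \<in> sets borel \<Longrightarrow> E (B \<inter> C) u = E B (E C u)"
  and E_UNIV [simp]: "E UNIV u = u"
  and E_sums: "range F \<subseteq> sets borel \<Longrightarrow> disjoint_family F \<Longrightarrow> (\<lambda>i::nat. E (F i) u) sums E (\<Union>i. F i) u"
  using pvm unfolding projection_valued_measure_def by auto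

text \<open>The constant sequence of empty sets is disjoint, so additivity makes a series with
  constant term \<open>E {} u\<close> converge, which forces the term to vanish.\<close>

lemma E_empty [simp]: "E {} u = 0"
proof -
  have "summable (\<lambda>i::nat. E {} u)"
    using E_sums[of "\<lambda>_. {}" u] by (auto simp: disjoint_family_on_def sums_iff)
  then show ?thesis
    using summable_LIMSEQ_zero LIMSEQ_unique tendsto_const by metis
qed

lemma E_Un:
  assumes "B \<in> sets borel" "C \<in> sets borel" "B \<inter> C = {}"
  shows "E (B \<union> C) u = E B u + E C u"
proof -
  have "(\<lambda>n. E (binaryset B C n) u) sums E (\<Union>i. binaryset B C i) u"
    using assms by (intro E_sums) (auto simp: range_binaryset_eq disjoint_family_on_def binaryset_def)
  moreover have "(\<lambda>n. E (binaryset B C n) u) sums (E B u + E C u)"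
    by (rule binaryset_sums[where f = "\<lambda>A. E A u"]) simp
  ultimately show ?thesis
    by (simp add: UN_binaryset_eq sums_unique2)
qed

lemma E_UN:
  assumes "finite I" "\<And>i. i \<in> I \<Longrightarrow> B i \<in> sets borel" "disjoint_family_on B I"
  shows "E (\<Union>i\<in>I. B i) u = (\<Sum>i\<in>I. E (B i) u)"
  using assms
proof (induction I rule: finite_induct)
  case (insert i I)
  have "B i \<inter> (\<Union>j\<in>I. B j) = {}"
    using insert.prems(2) insert.hyps(2) by (auto simp: disjoint_family_on_def)
  moreover have "disjoint_family_on B I"
    using insert.prems(2) by (auto simp: disjoint_family_on_def)
  ultimately show ?case
    using insert by (simp add: E_Un sets.finite_UN)
qed simp

lemma E_idem: "B \<in> sets borel \<Longrightarrow> E B (E B u) = E B u"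
  using E_Int[of B B u] by simp

lemma E_commute: "B \<in> sets borel \<Longrightarrow> C \<in> sets borel \<Longrightarrow> E B (E C u) = E C (E B u)"
  by (metis E_Int Int_commute)

lemma inner_E: "B \<in> sets borel \<Longrightarrow> inner (E B u) u = (norm (E B u))\<^sup>2"
  by (metis E_idem E_sym power2_norm_eq_inner)

lemma inner_E_E: "B \<in> sets borel \<Longrightarrow> C \<in> sets borel \<Longrightarrow> inner (E B u) (E C v) = inner (E (B \<inter> C) u) v"
  by (metis E_Int E_sym Int_commute)

lemma norm_E_le: 
  assumes "B \<in> sets borel"
  shows "norm (E B u) \<le> norm u"
proof -
  have "norm (E B u) * norm (E B u) \<le> norm (E B u) * norm u"
    using inner_E[OF assms, of u] norm_cauchy_schwarz[of "E B u" u] by (simp add: power2_eq_square)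
  then show ?thesis
    by (cases "norm (E B u) = 0") auto
qed

lemma bounded_linear_E: "B \<in> sets borel \<Longrightarrow> bounded_linear (E B)"
  using linear_E norm_E_le
  by (intro bounded_linear_intro[of _ 1]) (auto simp: linear_add linear_scale)

lemma space_\<mu> [simp]: "space (\<mu> u) = UNIV"
  and sets_\<mu> [simp, measurable_cong]: "sets (\<mu> u) = sets borel"
  using sets.sigma_sets_eq[of "borel :: real measure"]
  by (simp_all add: scalar_spectral_measure_def space_measure_of_conv)

text \<open>\<open>measure_of\<close> returns the prescribed values only for a countably additive
  set function, so this is where additivity of \<open>E\<close> is used. The summands are
  nonnegative because each is the square of a norm.\<close>

lemma emeasure_\<mu>:
  assumes "B \<in> sets borel"
  shows "emeasure (\<mu> u) B = ennreal ((norm (E B u))\<^sup>2)"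
proof -
  have "emeasure (\<mu> u) B = ennreal (inner (E B u) u)"
  proof (rule emeasure_measure_of[OF scalar_spectral_measure_def])
    show "sets borel \<subseteq> Pow UNIV" "B \<in> sets (\<mu> u)" using assms by auto
    show "positive (sets (\<mu> u)) (\<lambda>B. ennreal (inner (E B u) u))"
      by (simp add: positive_def)
    show "countably_additive (sets (\<mu> u)) (\<lambda>B. ennreal (inner (E B u) u))"
    proof (rule countably_additiveI)
      fix F :: "nat \<Rightarrow> real set" assume F: "range F \<subseteq> sets (\<mu> u)" "disjoint_family F"
      have "(\<lambda>i. inner (E (F i) u) u) sums inner (E (\<Union>i. F i) u) u"
        using F by (intro bounded_linear.sums[OF bounded_linear_inner_left] E_sums) auto
      moreover have "0 \<le> inner (E (F i) u) u" for i
        using F by (subst inner_E) auto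
      ultimately show "(\<Sum>i. ennreal (inner (E (F i) u) u)) = ennreal (inner (E (\<Union>i. F i) u) u)"
        by (intro suminf_ennreal_eq)
    qed
  qed
  then show ?thesis by (simp add: inner_E assms)
qed

lemma emeasure_\<mu>_UNIV [simp]: "emeasure (\<mu> u) UNIV = ennreal ((norm u)\<^sup>2)"
  by (simp add: emeasure_\<mu>)

text \<open>\<open>E B\<close> commutes with \<open>E C\<close>, and \<open>E C\<close> is a
  contraction, so the spectral measure of \<open>E C u\<close> lies below that of \<open>u\<close>
  on every set.\<close>

lemma nn_integral_\<mu>_E_le:
  assumes C: "C \<in> sets borel"
  shows "(\<integral>\<^sup>+ l. f l \<partial>\<mu> (E C u)) \<le> (\<integral>\<^sup>+ l. f l \<partial>\<mu> u)"
proof (rule nn_integral_mono_measure)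
  have "emeasure (\<mu> (E C u)) B \<le> emeasure (\<mu> u) B" for B
  proof (cases "B \<in> sets borel")
    case True
    have "norm (E B (E C u)) \<le> norm (E B u)"
      using E_commute[OF True C, of u] norm_E_le[OF C] by simp
    then show ?thesis
      by (auto simp: emeasure_\<mu> True intro!: ennreal_leI power_mono)
  qed (simp add: emeasure_notin_sets)
  then show "\<mu> (E C u) \<le> \<mu> u"
    by (simp add: le_measure_iff le_fun_def)
qed simp

lemma AE_\<mu>:
  assumes B: "B \<in> sets borel" and u: "E B u = u"
  shows "AE l in \<mu> u. l \<in> B"
proof (rule AE_I')
  have "E (- B) u = E (- B \<inter> B) u"
    using B by (subst E_Int) (auto simp: u)
  then have "emeasure (\<mu> u) (- B) = 0"
    using B by (simp add: emeasure_\<mu>)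
  then show "- B \<in> null_sets (\<mu> u)"
    using B by (auto intro!: null_setsI)
qed auto


subsection \<open>Integrals of simple functions\<close>

text \<open>The defining sum runs over the values of one function. Here it is refined to the level
  sets of any \<open>p\<close> through which the function factors; with \<open>p\<close> the pair of
  two simple functions, both integrals run over the same partition and can be subtracted.\<close>

lemma S_comp:
  fixes p :: "real \<Rightarrow> 'c" and f :: "'c \<Rightarrow> real"
  assumes p: "simple_function borel p"
  shows "S (\<lambda>l. f (p l)) u = (\<Sum>z\<in>range p. f z *\<^sub>R E (p -` {z}) u)"
proof -
  note fin = simple_functionD_borel(1)[OF p] and meas = simple_functionD_borel(2)[OF p]
  have "c *\<^sub>R E ((\<lambda>l. f (p l)) -` {c}) u = (\<Sum>z\<in>{z \<in> range p. f z = c}. f z *\<^sub>R E (p -` {z}) u)" for c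
  proof -
    have "(\<lambda>l. f (p l)) -` {c} = (\<Union>z\<in>{z \<in> range p. f z = c}. p -` {z})"
      by auto
    then have "E ((\<lambda>l. f (p l)) -` {c}) u = (\<Sum>z\<in>{z \<in> range p. f z = c}. E (p -` {z}) u)"
      using fin meas by (simp only:) (rule E_UN; auto simp: disjoint_family_on_def)
    then show ?thesis
      by (simp add: scaleR_sum_right)
  qed
  then have "S (\<lambda>l. f (p l)) u = (\<Sum>c\<in>range (\<lambda>l. f (p l)). \<Sum>z\<in>{z \<in> range p. f z = c}. f z *\<^sub>R E (p -` {z}) u)"
    by (simp add: simple_spectral_integral_def)
  also have "\<dots> = (\<Sum>z\<in>range p. f z *\<^sub>R E (p -` {z}) u)"
    using sum.image_gen[OF fin, of "\<lambda>z. f z *\<^sub>R E (p -` {z}) u" f] by (simp add: image_image)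
  finally show ?thesis .
qed

lemma S_diff:
  assumes s: "simple_function borel s" and t: "simple_function borel t"
  shows "S (\<lambda>l. s l - t l) u = S s u - S t u"
proof -
  have p: "simple_function borel (\<lambda>l. (s l, t l))"
    using s t by (rule simple_function_Pair)
  show ?thesis
    using S_comp[OF p, of "\<lambda>z. fst z - snd z" u] S_comp[OF p, of fst u] S_comp[OF p, of snd u]
    by (simp add: sum_subtractf scaleR_left_diff_distrib)
qed

lemma S_const: "S (\<lambda>_. c) u = c *\<^sub>R u"
  by (simp add: simple_spectral_integral_def)

text \<open>Projections belonging to disjoint level sets have orthogonal ranges, so only the
  diagonal of the double sum survives.\<close>

lemma inner_S:
  assumes s: "simple_function borel s"
  shows "inner (S s u) (S s v) = (\<Sum>c\<in>range s. c\<^sup>2 * inner (E (s -` {c}) u) v)"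
proof -
  note fin = simple_functionD_borel(1)[OF s] and meas = simple_functionD_borel(2)[OF s]
  have "inner (S s u) (S s v) = (\<Sum>c\<in>range s. \<Sum>d\<in>range s. c * (d * inner (E (s -` {c} \<inter> s -` {d}) u) v))"
    unfolding simple_spectral_integral_def inner_sum_left inner_sum_right
    using meas by (subst sum.swap) (simp add: inner_E_E Int_commute mult.left_commute)
  also have "\<dots> = (\<Sum>c\<in>range s. \<Sum>d\<in>range s. if d = c then c\<^sup>2 * inner (E (s -` {c}) u) v else 0)"
  proof (intro sum.cong refl)
    fix c d :: real
    have "s -` {c} \<inter> s -` {d} = (if d = c then s -` {c} else {})" by auto
    then show "c * (d * inner (E (s -` {c} \<inter> s -` {d}) u) v) = (if d = c then c\<^sup>2 * inner (E (s -` {c}) u) v else 0)"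
      by (simp add: power2_eq_square)
  qed
  also have "\<dots> = (\<Sum>c\<in>range s. c\<^sup>2 * inner (E (s -` {c}) u) v)"
    using fin by (intro sum.cong refl) (simp add: sum.delta)
  finally show ?thesis .
qed

text \<open>The isometry on which the integral rests: simple functions in L2 of the spectral measure
  are carried to vectors of the same norm.\<close>

lemma norm_S:
  assumes s: "simple_function borel s"
  shows "ennreal ((norm (S s u))\<^sup>2) = (\<integral>\<^sup>+ l. ennreal ((s l)\<^sup>2) \<partial>\<mu> u)"
proof -
  note fin = simple_functionD_borel(1)[OF s] and meas = simple_functionD_borel(2)[OF s]
  have split: "ennreal ((s l)\<^sup>2) = (\<Sum>c\<in>range s. ennreal (c\<^sup>2) * indicator (s -` {c}) l)" for l
  proof -
    have "(\<Sum>c\<in>range s. ennreal (c\<^sup>2) * indicator (s -` {c}) l) = (\<Sum>c\<in>range s. if c = s l then ennreal (c\<^sup>2) else 0)"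
      by (intro sum.cong refl) (auto simp: indicator_def)
    also have "\<dots> = ennreal ((s l)\<^sup>2)"
      using fin by (simp add: sum.delta')
    finally show ?thesis by simp
  qed
  have "(\<integral>\<^sup>+ l. ennreal ((s l)\<^sup>2) \<partial>\<mu> u) = (\<Sum>c\<in>range s. ennreal (c\<^sup>2) * emeasure (\<mu> u) (s -` {c}))"
    unfolding split using meas by (simp add: nn_integral_sum nn_integral_cmult_indicator)
  also have "\<dots> = (\<Sum>c\<in>range s. ennreal (c\<^sup>2 * (norm (E (s -` {c}) u))\<^sup>2))"
    using meas by (simp add: emeasure_\<mu> ennreal_mult)
  also have "\<dots> = ennreal (\<Sum>c\<in>range s. c\<^sup>2 * (norm (E (s -` {c}) u))\<^sup>2)"
    by (intro sum_ennreal) simp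
  also have "(\<Sum>c\<in>range s. c\<^sup>2 * (norm (E (s -` {c}) u))\<^sup>2) = (norm (S s u))\<^sup>2"
    using inner_S[OF s, of u u] meas by (simp add: power2_norm_eq_inner[of "S s u"] inner_E)
  finally show ?thesis by simp
qed

lemma norm_S_diff:
  assumes s: "simple_function borel s" and t: "simple_function borel t"
  shows "ennreal ((norm (S s u - S t u))\<^sup>2) = (\<integral>\<^sup>+ l. ennreal ((s l - t l)\<^sup>2) \<partial>\<mu> u)"
  using norm_S[OF simple_function_diff[OF s t]] S_diff[OF s t] by simp

lemma E_S:
  assumes C: "C \<in> sets borel" and s: "simple_function borel s"
  shows "E C (S s u) = S s (E C u)"
  using simple_functionD_borel(2)[OF s]
  by (simp add: simple_spectral_integral_def linear_sum[OF linear_E[OF C]] linear_scale[OF linear_E[OF C]]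
      E_commute[OF C])


subsection \<open>Integrals of Borel functions\<close>

text \<open>Both approximants are compared with \<open>h\<close>. This yields the uniqueness of the
  value of the integral as well as the Cauchy property behind its existence.\<close>

lemma norm_S_diff_le:
  assumes h [measurable]: "h \<in> borel_measurable borel"
    and s: "simple_function borel s" and t: "simple_function borel t"
  shows "ennreal ((norm (S s u - S t u))\<^sup>2) \<le>
    2 * (\<integral>\<^sup>+ l. ennreal ((h l - s l)\<^sup>2) \<partial>\<mu> u) + 2 * (\<integral>\<^sup>+ l. ennreal ((h l - t l)\<^sup>2) \<partial>\<mu> u)"
proof -
  have [measurable]: "s \<in> borel_measurable borel" "t \<in> borel_measurable borel"
    using s t by (auto intro: borel_measurable_simple_function)
  have "ennreal ((norm (S s u - S t u))\<^sup>2) = (\<integral>\<^sup>+ l. ennreal ((s l - t l)\<^sup>2) \<partial>\<mu> u)"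
    by (rule norm_S_diff[OF s t])
  also have "\<dots> \<le> (\<integral>\<^sup>+ l. 2 * ennreal ((h l - s l)\<^sup>2) + 2 * ennreal ((h l - t l)\<^sup>2) \<partial>\<mu> u)"
  proof (rule nn_integral_mono)
    fix l
    have "ennreal ((s l - t l)\<^sup>2) \<le> ennreal (2 * (h l - s l)\<^sup>2 + 2 * (h l - t l)\<^sup>2)"
      by (intro ennreal_leI square_diff_le)
    then show "ennreal ((s l - t l)\<^sup>2) \<le> 2 * ennreal ((h l - s l)\<^sup>2) + 2 * ennreal ((h l - t l)\<^sup>2)"
      by (simp add: ennreal_mult)
  qed
  also have "\<dots> = 2 * (\<integral>\<^sup>+ l. ennreal ((h l - s l)\<^sup>2) \<partial>\<mu> u) + 2 * (\<integral>\<^sup>+ l. ennreal ((h l - t l)\<^sup>2) \<partial>\<mu> u)"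
    by (simp add: nn_integral_add nn_integral_cmult)
  finally show ?thesis .
qed

lemma spectral_integral_unique:
  assumes h: "h \<in> borel_measurable borel"
    and g: "(u, g) \<in> spectral_integral E h" "(u, g') \<in> spectral_integral E h"
  shows "g = g'"
proof -
  obtain s where s: "\<And>k. simple_function borel (s k)"
    "(\<lambda>k. \<integral>\<^sup>+ l. ennreal ((h l - s k l)\<^sup>2) \<partial>\<mu> u) \<longlonglongrightarrow> 0" "(\<lambda>k. S (s k) u) \<longlonglongrightarrow> g"
    using g(1) by (auto simp: spectral_integral_def)
  obtain t where t: "\<And>k. simple_function borel (t k)"
    "(\<lambda>k. \<integral>\<^sup>+ l. ennreal ((h l - t k l)\<^sup>2) \<partial>\<mu> u) \<longlonglongrightarrow> 0" "(\<lambda>k. S (t k) u) \<longlonglongrightarrow> g'"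
    using g(2) by (auto simp: spectral_integral_def)
  have "(\<lambda>k. 2 * (\<integral>\<^sup>+ l. ennreal ((h l - s k l)\<^sup>2) \<partial>\<mu> u) + 2 * (\<integral>\<^sup>+ l. ennreal ((h l - t k l)\<^sup>2) \<partial>\<mu> u)) \<longlonglongrightarrow> 2 * 0 + 2 * 0"
    by (rule tendsto_add[OF ennreal_tendsto_cmult[OF _ s(2)] ennreal_tendsto_cmult[OF _ t(2)]]) simp_all
  then have lim0: "(\<lambda>k. 2 * (\<integral>\<^sup>+ l. ennreal ((h l - s k l)\<^sup>2) \<partial>\<mu> u) + 2 * (\<integral>\<^sup>+ l. ennreal ((h l - t k l)\<^sup>2) \<partial>\<mu> u)) \<longlonglongrightarrow> 0"
    by (simp only: mult_zero_right add_0_left)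
  have "(\<lambda>k. ennreal ((norm (S (s k) u - S (t k) u))\<^sup>2)) \<longlonglongrightarrow> 0"
    by (rule tendsto_sandwich[OF always_eventually always_eventually tendsto_const lim0])
      (intro allI zero_le norm_S_diff_le[OF h s(1) t(1)])+
  then have "(\<lambda>k. (norm (S (s k) u - S (t k) u))\<^sup>2) \<longlonglongrightarrow> 0"
    by (subst (asm) ennreal_tendsto_0_iff) auto
  moreover have "(\<lambda>k. (norm (S (s k) u - S (t k) u))\<^sup>2) \<longlonglongrightarrow> (norm (g - g'))\<^sup>2"
    by (intro tendsto_intros s(3) t(3))
  ultimately have "(norm (g - g'))\<^sup>2 = 0"
    by (rule LIMSEQ_unique[symmetric])
  then show ?thesis by simp
qed

lemma spectral_integral_E:
  assumes C: "C \<in> sets borel" and ug: "(u, g) \<in> spectral_integral E h"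
  shows "(E C u, E C g) \<in> spectral_integral E h"
proof -
  obtain s where s: "\<And>k. simple_function borel (s k)"
    "(\<lambda>k. \<integral>\<^sup>+ l. ennreal ((h l - s k l)\<^sup>2) \<partial>\<mu> u) \<longlonglongrightarrow> 0" "(\<lambda>k. S (s k) u) \<longlonglongrightarrow> g"
    and fin: "(\<integral>\<^sup>+ l. ennreal ((h l)\<^sup>2) \<partial>\<mu> u) < \<infinity>"
    using ug by (auto simp: spectral_integral_def)
  have "(\<integral>\<^sup>+ l. ennreal ((h l)\<^sup>2) \<partial>\<mu> (E C u)) < \<infinity>"
    using nn_integral_\<mu>_E_le[OF C] fin by (rule le_less_trans)
  moreover have "(\<lambda>k. \<integral>\<^sup>+ l. ennreal ((h l - s k l)\<^sup>2) \<partial>\<mu> (E C u)) \<longlonglongrightarrow> 0"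
    by (rule tendsto_sandwich[OF _ _ tendsto_const s(2)]) (auto intro!: always_eventually nn_integral_\<mu>_E_le[OF C])
  moreover have "(\<lambda>k. S (s k) (E C u)) \<longlonglongrightarrow> E C g"
    using bounded_linear.tendsto[OF bounded_linear_E[OF C] s(3)] by (simp add: E_S[OF C s(1)])
  ultimately show ?thesis
    using s(1) unfolding spectral_integral_def by blast
qed

end

text \<open>One sequence is fixed for all vectors. The bound by twice the modulus of
  \<open>h\<close> provides the dominating function for every spectral measure under which
  \<open>h\<close> is square integrable. Coefficients and level sets that do not vary with the
  vector are what later makes the integrals measurable in time.\<close>

definition simple_approx :: "(real \<Rightarrow> real) \<Rightarrow> nat \<Rightarrow> real \<Rightarrow> real" where
  "simple_approx h = (SOME s. (\<forall>k. simple_function borel (s k)) \<and>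
     (\<forall>l. (\<lambda>k. s k l) \<longlonglongrightarrow> h l) \<and> (\<forall>k l. \<bar>s k l\<bar> \<le> 2 * \<bar>h l\<bar>))"

lemma simple_approx:
  assumes "h \<in> borel_measurable borel"
  shows "simple_function borel (simple_approx h k)" "(\<lambda>k. simple_approx h k l) \<longlonglongrightarrow> h l"
    "\<bar>simple_approx h k l\<bar> \<le> 2 * \<bar>h l\<bar>"
proof -
  have "\<exists>s. (\<forall>k. simple_function borel (s k)) \<and>
     (\<forall>l. (\<lambda>k. s k l) \<longlonglongrightarrow> h l) \<and> (\<forall>k l. \<bar>s k l\<bar> \<le> 2 * \<bar>h l\<bar>)"
    using borel_measurable_implies_sequence_metric[OF assms, of 0] by (simp add: dist_norm)
  from someI_ex[OF this] show "simple_function borel (simple_approx h k)" "(\<lambda>k. simple_approx h k l) \<longlonglongrightarrow> h l"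
    "\<bar>simple_approx h k l\<bar> \<le> 2 * \<bar>h l\<bar>"
    unfolding simple_approx_def by blast+
qed

section \<open>Existence of the integral on its natural domain\<close>

locale complete_pvm = pvm E for E :: "real set \<Rightarrow> 'h::{real_inner, complete_space} \<Rightarrow> 'h"
begin

lemma simple_approx_tendsto:
  assumes h [measurable]: "h \<in> borel_measurable borel"
    and fin: "(\<integral>\<^sup>+ l. ennreal ((h l)\<^sup>2) \<partial>\<mu> u) < \<infinity>"
  shows "(\<lambda>k. \<integral>\<^sup>+ l. ennreal ((h l - simple_approx h k l)\<^sup>2) \<partial>\<mu> u) \<longlonglongrightarrow> 0"
proof -
  have [measurable]: "simple_approx h k \<in> borel_measurable borel" for k
    using simple_approx(1)[OF h] by (rule borel_measurable_simple_function)
  have "(\<lambda>k. \<integral>\<^sup>+ l. ennreal ((h l - simple_approx h k l)\<^sup>2) \<partial>\<mu> u) \<longlonglongrightarrow> (\<integral>\<^sup>+ l. 0 \<partial>\<mu> u)"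
  proof (rule nn_integral_dominated_convergence)
    \<comment> \<open>The approximant is at most twice \<open>h\<close> in modulus, so the error is
      at most three times \<open>h\<close>; 9 is the square of 3.\<close>
    show "AE l in \<mu> u. ennreal ((h l - simple_approx h k l)\<^sup>2) \<le> 9 * ennreal ((h l)\<^sup>2)" for k
    proof (rule AE_I2)
      fix l
      have "\<bar>h l - simple_approx h k l\<bar> \<le> 3 * \<bar>h l\<bar>"
        using simple_approx(3)[OF h, of k l] by linarith
      then have "(h l - simple_approx h k l)\<^sup>2 \<le> 9 * (h l)\<^sup>2"
        using power_mono[of "\<bar>h l - simple_approx h k l\<bar>" "3 * \<bar>h l\<bar>" 2] by (simp add: power_mult_distrib)
      then show "ennreal ((h l - simple_approx h k l)\<^sup>2) \<le> 9 * ennreal ((h l)\<^sup>2)"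
        by (metis ennreal_leI ennreal_mult ennreal_numeral zero_le_numeral zero_le_power2)
    qed
    show "(\<integral>\<^sup>+ l. 9 * ennreal ((h l)\<^sup>2) \<partial>\<mu> u) < \<infinity>"
      using fin by (simp add: nn_integral_cmult ennreal_mult_less_top)
    show "AE l in \<mu> u. (\<lambda>k. ennreal ((h l - simple_approx h k l)\<^sup>2)) \<longlonglongrightarrow> 0"
    proof (rule AE_I2)
      fix l
      have "(\<lambda>k. (h l - simple_approx h k l)\<^sup>2) \<longlonglongrightarrow> (h l - h l)\<^sup>2"
        by (intro tendsto_intros simple_approx(2)[OF h])
      then show "(\<lambda>k. ennreal ((h l - simple_approx h k l)\<^sup>2)) \<longlonglongrightarrow> 0"
        by (simp add: ennreal_tendsto_0_iff)
    qed
  qed measurable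
  then show ?thesis by simp
qed

lemma spectral_integral_exists:
  assumes h [measurable]: "h \<in> borel_measurable borel"
    and fin: "(\<integral>\<^sup>+ l. ennreal ((h l)\<^sup>2) \<partial>\<mu> u) < \<infinity>"
  obtains g where "(u, g) \<in> spectral_integral E h" "(\<lambda>k. S (simple_approx h k) u) \<longlonglongrightarrow> g"
proof -
  note s = simple_approx(1)[OF h]
  define d where "d k = (\<integral>\<^sup>+ l. ennreal ((h l - simple_approx h k l)\<^sup>2) \<partial>\<mu> u)" for k
  have d: "d \<longlonglongrightarrow> 0"
    unfolding d_def using simple_approx_tendsto[OF h fin] .
  have "Cauchy (\<lambda>k. S (simple_approx h k) u)"
  proof (rule metric_CauchyI)
    fix e :: real assume e: "0 < e"
    \<comment> \<open>Two errors below \<open>e^2 / 8\<close>, each counted twice, add up to at most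
      \<open>e^2 / 2\<close>, which is strictly below \<open>e^2\<close>.\<close>
    then have "ennreal (e\<^sup>2 / 8) > 0" by simp
    from order_tendstoD(2)[OF d this] obtain N where N: "\<And>k. k \<ge> N \<Longrightarrow> d k < ennreal (e\<^sup>2 / 8)"
      by (auto simp: eventually_sequentially)
    have "dist (S (simple_approx h m) u) (S (simple_approx h n) u) < e" if "m \<ge> N" "n \<ge> N" for m n
    proof -
      have "ennreal ((norm (S (simple_approx h m) u - S (simple_approx h n) u))\<^sup>2) \<le> 2 * d m + 2 * d n"
        unfolding d_def by (rule norm_S_diff_le[OF h s s])
      also have "\<dots> \<le> 2 * ennreal (e\<^sup>2 / 8) + 2 * ennreal (e\<^sup>2 / 8)"
        using N[OF that(1)] N[OF that(2)] by (intro add_mono mult_left_mono) auto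
      also have "\<dots> = ennreal (2 * (e\<^sup>2 / 8) + 2 * (e\<^sup>2 / 8))"
        by (subst ennreal_plus) (simp_all only: ennreal_mult ennreal_numeral zero_le_numeral zero_le_divide_iff zero_le_power2 zero_le_mult_iff simp_thms)
      finally have "(norm (S (simple_approx h m) u - S (simple_approx h n) u))\<^sup>2 \<le> e\<^sup>2 / 2"
        by (subst (asm) ennreal_le_iff) simp_all
      also have "\<dots> < e\<^sup>2" using e by simp
      finally show ?thesis
        using e by (simp add: dist_norm power2_less_imp_less)
    qed
    then show "\<exists>M. \<forall>m\<ge>M. \<forall>n\<ge>M. dist (S (simple_approx h m) u) (S (simple_approx h n) u) < e"
      by blast
  qed
  then obtain g where g: "(\<lambda>k. S (simple_approx h k) u) \<longlonglongrightarrow> g"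
    using Cauchy_convergent convergent_def by blast
  have "(u, g) \<in> spectral_integral E h"
    unfolding spectral_integral_def using fin s simple_approx_tendsto[OF h fin] g by blast
  then show ?thesis using that g by blast
qed

text \<open>Membership in the integral supplies some approximating sequence that may depend on
  \<open>u\<close>. Existence along the fixed sequence together with uniqueness of the value shows
  that the fixed sequence reaches it too.\<close>

lemma spectral_integral_limit:
  assumes h: "h \<in> borel_measurable borel" and ug: "(u, g) \<in> spectral_integral E h"
  shows "(\<lambda>k. S (simple_approx h k) u) \<longlonglongrightarrow> g"
proof -
  have "(\<integral>\<^sup>+ l. ennreal ((h l)\<^sup>2) \<partial>\<mu> u) < \<infinity>"
    using ug by (simp add: spectral_integral_def)
  from spectral_integral_exists[OF h this] obtain g' where
    "(u, g') \<in> spectral_integral E h" "(\<lambda>k. S (simple_approx h k) u) \<longlonglongrightarrow> g'"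
    by blast
  with spectral_integral_unique[OF h ug] show ?thesis by blast
qed

text \<open>The approximating sequence exists as soon as the integral of \<open>h^2\<close> is
  finite. Membership in the domain thus becomes a condition on a single number, which can be shown
  to be measurable when the vector varies.\<close>

lemma Domain_spectral_integral:
  assumes "h \<in> borel_measurable borel"
  shows "Domain (spectral_integral E h) = {u. (\<integral>\<^sup>+ l. ennreal ((h l)\<^sup>2) \<partial>\<mu> u) < \<infinity>}"
proof (intro set_eqI iffI)
  fix u assume "u \<in> Domain (spectral_integral E h)"
  then show "u \<in> {u. (\<integral>\<^sup>+ l. ennreal ((h l)\<^sup>2) \<partial>\<mu> u) < \<infinity>}"
    by (auto simp: spectral_integral_def)
next
  fix u assume "u \<in> {u. (\<integral>\<^sup>+ l. ennreal ((h l)\<^sup>2) \<partial>\<mu> u) < \<infinity>}"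
  then show "u \<in> Domain (spectral_integral E h)"
    using spectral_integral_exists[OF assms, of u] by blast
qed

text \<open>The isometry for \<open>h - c\<close>. With \<open>h\<close> the identity it computes
  the norm of \<open>(A - c) u\<close>, on which the upper and lower estimates for bands both
  rest.\<close>

lemma norm_spectral_integral_diff:
  assumes h [measurable]: "h \<in> borel_measurable borel" and ug: "(u, g) \<in> spectral_integral E h"
  shows "ennreal ((norm (g - c *\<^sub>R u))\<^sup>2) = (\<integral>\<^sup>+ l. ennreal ((h l - c)\<^sup>2) \<partial>\<mu> u)"
proof -
  have [measurable]: "simple_approx h k \<in> borel_measurable borel" for k
    using simple_approx(1)[OF h] by (rule borel_measurable_simple_function)
  have fin: "(\<integral>\<^sup>+ l. ennreal ((h l)\<^sup>2) \<partial>\<mu> u) < \<infinity>"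
    using ug by (simp add: spectral_integral_def)
  have "(\<lambda>k. \<integral>\<^sup>+ l. ennreal ((simple_approx h k l - c)\<^sup>2) \<partial>\<mu> u) \<longlonglongrightarrow> (\<integral>\<^sup>+ l. ennreal ((h l - c)\<^sup>2) \<partial>\<mu> u)"
  proof (rule nn_integral_dominated_convergence)
    \<comment> \<open>From \<open>(s - c)^2 \<le> 2 * s^2 + 2 * c^2\<close> and
      \<open>s^2 \<le> 4 * h^2\<close>.\<close>
    show "AE l in \<mu> u. ennreal ((simple_approx h k l - c)\<^sup>2) \<le> 8 * ennreal ((h l)\<^sup>2) + ennreal (2 * c\<^sup>2)" for k
    proof (rule AE_I2)
      fix l
      have "(simple_approx h k l)\<^sup>2 \<le> 4 * (h l)\<^sup>2"
        using power_mono[OF simple_approx(3)[OF h, of k l], of 2] by (simp add: power_mult_distrib)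
      then have "(simple_approx h k l - c)\<^sup>2 \<le> 8 * (h l)\<^sup>2 + 2 * c\<^sup>2"
        using square_diff_le[of "simple_approx h k l" c 0] by simp
      from ennreal_leI[OF this] show "ennreal ((simple_approx h k l - c)\<^sup>2) \<le> 8 * ennreal ((h l)\<^sup>2) + ennreal (2 * c\<^sup>2)"
        by (simp add: ennreal_mult)
    qed
    show "(\<integral>\<^sup>+ l. 8 * ennreal ((h l)\<^sup>2) + ennreal (2 * c\<^sup>2) \<partial>\<mu> u) < \<infinity>"
      using fin by (simp add: nn_integral_add nn_integral_cmult ennreal_mult_less_top)
    show "AE l in \<mu> u. (\<lambda>k. ennreal ((simple_approx h k l - c)\<^sup>2)) \<longlonglongrightarrow> ennreal ((h l - c)\<^sup>2)"
      by (intro AE_I2 tendsto_intros simple_approx(2)[OF h])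
  qed measurable
  moreover have "(\<integral>\<^sup>+ l. ennreal ((simple_approx h k l - c)\<^sup>2) \<partial>\<mu> u) = ennreal ((norm (S (simple_approx h k) u - c *\<^sub>R u))\<^sup>2)" for k
    unfolding S_const[symmetric] by (rule norm_S_diff[symmetric, OF simple_approx(1)[OF h] simple_function_const])
  moreover have "(\<lambda>k. ennreal ((norm (S (simple_approx h k) u - c *\<^sub>R u))\<^sup>2)) \<longlonglongrightarrow> ennreal ((norm (g - c *\<^sub>R u))\<^sup>2)"
    by (intro tendsto_intros spectral_integral_limit[OF h ug])
  ultimately show ?thesis
    using LIMSEQ_unique by (simp only:) blast
qed

text \<open>The spectral measure of a vector in the range of \<open>E B\<close> lives on the bounded
  set \<open>B\<close>, so the identity is square integrable and bounded by \<open>r\<close> around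
  \<open>c\<close> there. That \<open>A - c\<close> leads back into the range of \<open>E B\<close>
  is what allows the step to be iterated.\<close>

lemma spectral_band_step:
  assumes r: "0 \<le> r" and B: "B = {l. \<bar>l - c\<bar> \<le> r}" and u: "E B u = u"
  obtains g where "(u, g) \<in> spectral_integral E (\<lambda>l. l)" "E B (g - c *\<^sub>R u) = g - c *\<^sub>R u"
    "norm (g - c *\<^sub>R u) \<le> r * norm u"
proof -
  have [measurable]: "B \<in> sets borel" unfolding B by measurable
  have AE: "AE l in \<mu> u. \<bar>l - c\<bar> \<le> r"
    using AE_\<mu>[OF \<open>B \<in> sets borel\<close> u] by (simp add: B)
  have "(\<integral>\<^sup>+ l. ennreal (l\<^sup>2) \<partial>\<mu> u) \<le> (\<integral>\<^sup>+ l. ennreal ((\<bar>c\<bar> + r)\<^sup>2) \<partial>\<mu> u)"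
    by (rule nn_integral_mono_AE, use AE in eventually_elim) (auto intro!: ennreal_leI simp: abs_le_square_iff[symmetric])
  also have "\<dots> < \<infinity>"
    by (simp add: ennreal_mult_less_top)
  finally obtain g where g: "(u, g) \<in> spectral_integral E (\<lambda>l. l)"
    using spectral_integral_exists[of "\<lambda>l. l" u] by auto
  \<comment> \<open>Since \<open>E B\<close> fixes \<open>u\<close>, projecting the pair exhibits
    \<open>E B g\<close> as a second value at \<open>u\<close>, so it equals
    \<open>g\<close>.\<close>
  have "(u, E B g) \<in> spectral_integral E (\<lambda>l. l)"
    using spectral_integral_E[OF \<open>B \<in> sets borel\<close> g] unfolding u .
  then have "E B g = g"
    by (rule spectral_integral_unique[OF _ _ g, rotated]) simp
  then have EB: "E B (g - c *\<^sub>R u) = g - c *\<^sub>R u"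
    using u linear_diff[OF linear_E[OF \<open>B \<in> sets borel\<close>]] linear_scale[OF linear_E[OF \<open>B \<in> sets borel\<close>]] by simp
  have "ennreal ((norm (g - c *\<^sub>R u))\<^sup>2) = (\<integral>\<^sup>+ l. ennreal ((l - c)\<^sup>2) \<partial>\<mu> u)"
    by (rule norm_spectral_integral_diff[OF _ g]) simp
  also have "\<dots> \<le> (\<integral>\<^sup>+ l. ennreal (r\<^sup>2) \<partial>\<mu> u)"
    by (rule nn_integral_mono_AE, use AE in eventually_elim) (use r in \<open>auto intro!: ennreal_leI simp: abs_le_square_iff[symmetric]\<close>)
  also have "\<dots> = ennreal ((r * norm u)\<^sup>2)"
    by (simp add: ennreal_mult power_mult_distrib)
  finally have "norm (g - c *\<^sub>R u) \<le> r * norm u"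
    using r by (simp add: abs_le_square_iff[symmetric])
  with g EB show ?thesis using that by blast
qed

text \<open>The counterpart from below: on vectors whose spectral measure keeps distance
  \<open>s\<close> from \<open>c\<close>, the operator \<open>A - c\<close> expands by at least
  \<open>s\<close>.\<close>

lemma spectral_gap_bound:
  assumes s: "0 \<le> s" and C: "C = {l. s \<le> \<bar>l - c\<bar>}" and ug: "(u, g) \<in> spectral_integral E (\<lambda>l. l)"
  shows "s * norm (E C u) \<le> norm (E C (g - c *\<^sub>R u))"
proof -
  have [measurable]: "C \<in> sets borel" unfolding C by measurable
  have AE: "AE l in \<mu> (E C u). s \<le> \<bar>l - c\<bar>"
    using AE_\<mu>[OF \<open>C \<in> sets borel\<close> E_idem[OF \<open>C \<in> sets borel\<close>], of u] by (simp add: C)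
  have "ennreal ((s * norm (E C u))\<^sup>2) = (\<integral>\<^sup>+ l. ennreal (s\<^sup>2) \<partial>\<mu> (E C u))"
    by (simp add: ennreal_mult power_mult_distrib)
  also have "\<dots> \<le> (\<integral>\<^sup>+ l. ennreal ((l - c)\<^sup>2) \<partial>\<mu> (E C u))"
    by (rule nn_integral_mono_AE, use AE in eventually_elim) (use s in \<open>auto intro!: ennreal_leI simp: abs_le_square_iff[symmetric]\<close>)
  also have "\<dots> = ennreal ((norm (E C g - c *\<^sub>R E C u))\<^sup>2)"
    by (rule norm_spectral_integral_diff[symmetric, OF _ spectral_integral_E[OF _ ug]]) simp_all
  also have "E C g - c *\<^sub>R E C u = E C (g - c *\<^sub>R u)"
    by (simp add: linear_diff[OF linear_E] linear_scale[OF linear_E])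
  finally show ?thesis
    using s by (simp add: abs_le_square_iff[symmetric])
qed

end

subsection \<open>Uniqueness of the spectral resolution\<close>

text \<open>The range of \<open>E {l. \<bar>l - c\<bar> \<le> r}\<close> consists of the vectors \<open>u\<close> with
  \<open>\<parallel>(A - c)\<^sup>n u\<parallel> \<le> r\<^sup>n \<parallel>u\<parallel>\<close> for all \<open>n\<close>, so it depends on \<open>A\<close> only.\<close>

lemma spectral_band_decay:
  fixes E E' :: "real set \<Rightarrow> 'h::{real_inner, complete_space} \<Rightarrow> 'h"
  assumes "complete_pvm E" "complete_pvm E'"
    and eq: "spectral_integral E (\<lambda>l. l) = spectral_integral E' (\<lambda>l. l)"
    and r: "0 \<le> r" and s: "0 \<le> s" and u: "E {l. \<bar>l - c\<bar> \<le> r} u = u"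
  shows "s ^ n * norm (E' {l. s \<le> \<bar>l - c\<bar>} u) \<le> r ^ n * norm u"
proof -
  interpret E: complete_pvm E by fact
  interpret E': complete_pvm E' by fact
  define C where "C = {l. s \<le> \<bar>l - c\<bar>}"
  have [measurable]: "C \<in> sets borel" unfolding C_def by measurable
  have "s ^ n * norm (E' C u) \<le> r ^ n * norm u"
    using u
  proof (induction n arbitrary: u)
    case 0
    show ?case by (simp add: E'.norm_E_le)
  next
    case (Suc n)
    obtain g where g: "(u, g) \<in> spectral_integral E (\<lambda>l. l)"
      "E {l. \<bar>l - c\<bar> \<le> r} (g - c *\<^sub>R u) = g - c *\<^sub>R u" "norm (g - c *\<^sub>R u) \<le> r * norm u"
      using E.spectral_band_step[OF r refl Suc.prems] by blast
    have "s ^ Suc n * norm (E' C u) = s ^ n * (s * norm (E' C u))"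
      by simp
    \<comment> \<open>By \<open>eq\<close> the pair \<open>(u, g)\<close> belongs to both integrals,
      so the lower bound for \<open>E'\<close> applies to it. The new vector is again fixed by the
      band projection of \<open>E\<close>, as the induction hypothesis requires.\<close>
    also have "\<dots> \<le> s ^ n * norm (E' C (g - c *\<^sub>R u))"
      using E'.spectral_gap_bound[OF s C_def, of u g] g(1) s eq by (intro mult_left_mono) auto
    also have "\<dots> \<le> r ^ n * norm (g - c *\<^sub>R u)"
      by (rule Suc.IH[OF g(2)])
    also have "\<dots> \<le> r ^ n * (r * norm u)"
      using g(3) r by (intro mult_left_mono) auto
    finally show ?case by (simp add: mult_ac)
  qed
  then show ?thesis by (simp only: C_def)
qed

text \<open>For \<open>s > r\<close> the decay bounds the part of \<open>u\<close> at distance at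
  least \<open>s\<close> from \<open>c\<close> by multiples of \<open>(r / s) ^ n\<close>, so this
  part vanishes. The complement of the closed band is a countable union of such regions with
  \<open>s\<close> strictly above \<open>r\<close>.\<close>

lemma spectral_band_subset:
  fixes E E' :: "real set \<Rightarrow> 'h::{real_inner, complete_space} \<Rightarrow> 'h"
  assumes "complete_pvm E" "complete_pvm E'"
    and eq: "spectral_integral E (\<lambda>l. l) = spectral_integral E' (\<lambda>l. l)"
    and r: "0 \<le> r" and u: "E {l. \<bar>l - c\<bar> \<le> r} u = u"
  shows "E' {l. \<bar>l - c\<bar> \<le> r} u = u"
proof -
  interpret E: complete_pvm E by fact
  interpret E': complete_pvm E' by fact
  have zero: "E' {l. s \<le> \<bar>l - c\<bar>} u = 0" if s: "r < s" for s
  proof -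
    let ?x = "norm (E' {l. s \<le> \<bar>l - c\<bar>} u)"
    have "?x \<le> (r / s) ^ n * norm u" for n
      using spectral_band_decay[OF assms(1,2) eq r _ u, of s n] r s
      by (simp add: power_divide field_simps)
    moreover have "(\<lambda>n. (r / s) ^ n * norm u) \<longlonglongrightarrow> 0 * norm u"
      using r s by (intro tendsto_mult_right LIMSEQ_power_zero) auto
    ultimately have "?x \<le> 0 * norm u"
      by (intro LIMSEQ_le_const) auto
    then show ?thesis by simp
  qed
  define N where "N n = {l. r + 1 / real (Suc n) \<le> \<bar>l - c\<bar>}" for n
  have [measurable]: "N n \<in> sets borel" for n unfolding N_def by measurable
  have UN: "(\<Union>n. N n) = - {l. \<bar>l - c\<bar> \<le> r}"
  proof (intro set_eqI iffI)
    fix l assume "l \<in> - {l. \<bar>l - c\<bar> \<le> r}"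
    then have "0 < \<bar>l - c\<bar> - r" by simp
    then obtain n where "inverse (real (Suc n)) < \<bar>l - c\<bar> - r"
      using reals_Archimedean by blast
    then have "l \<in> N n" by (simp add: N_def inverse_eq_divide)
    then show "l \<in> (\<Union>n. N n)" by blast
  next
    fix l assume "l \<in> (\<Union>n. N n)"
    then obtain n where "r + 1 / real (Suc n) \<le> \<bar>l - c\<bar>" by (auto simp: N_def)
    moreover have "0 < 1 / real (Suc n)" by simp
    ultimately have "r < \<bar>l - c\<bar>" by linarith
    then show "l \<in> - {l. \<bar>l - c\<bar> \<le> r}" by simp
  qed
  have B [measurable]: "{l. \<bar>l - c\<bar> \<le> r} \<in> sets borel" by measurable
  have "E' (N n) u = 0" for n
    unfolding N_def by (rule zero) simp
  then have "emeasure (scalar_spectral_measure E' u) (\<Union>n. N n) = 0"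
    by (intro emeasure_UN_eq_0) (auto simp: E'.emeasure_\<mu>)
  then have "E' (- {l. \<bar>l - c\<bar> \<le> r}) u = 0"
    using B by (simp add: UN E'.emeasure_\<mu>)
  moreover have "u = E' {l. \<bar>l - c\<bar> \<le> r} u + E' (- {l. \<bar>l - c\<bar> \<le> r}) u"
    using E'.E_Un[OF B, of "- {l. \<bar>l - c\<bar> \<le> r}" u] B by (simp add: Compl_partition)
  ultimately show ?thesis by simp
qed

text \<open>Two orthogonal projections with the same range coincide: each fixes the range of the
  other, and symmetry turns this into equality of the bilinear forms.\<close>

lemma spectral_band_eq:
  fixes E E' :: "real set \<Rightarrow> 'h::{real_inner, complete_space} \<Rightarrow> 'h"
  assumes "complete_pvm E" "complete_pvm E'"
    and eq: "spectral_integral E (\<lambda>l. l) = spectral_integral E' (\<lambda>l. l)"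
    and r: "0 \<le> r"
  shows "E {l. \<bar>l - c\<bar> \<le> r} u = E' {l. \<bar>l - c\<bar> \<le> r} u"
proof -
  interpret E: complete_pvm E by fact
  interpret E': complete_pvm E' by fact
  define B where "B = {l. \<bar>l - c\<bar> \<le> r}"
  have B: "B \<in> sets borel" unfolding B_def by measurable
  have 1: "E' B (E B u) = E B u" for u
    unfolding B_def by (rule spectral_band_subset[OF assms(1,2) eq r]) (rule E.E_idem, fold B_def, rule B)
  have 2: "E B (E' B u) = E' B u" for u
    unfolding B_def by (rule spectral_band_subset[OF assms(2,1) eq[symmetric] r]) (rule E'.E_idem, fold B_def, rule B)
  have "inner (E B u - E' B u) v = 0" for v
  proof -
    have "inner (E B u) v = inner (E' B (E B u)) v" by (simp only: 1)
    also have "\<dots> = inner u (E B (E' B v))" by (simp only: E.E_sym[OF B] E'.E_sym[OF B])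
    also have "\<dots> = inner (E' B u) v" by (simp only: 2 E'.E_sym[OF B])
    finally show ?thesis by (simp add: inner_diff_left)
  qed
  from this[of "E B u - E' B u"] show ?thesis by (simp add: B_def)
qed

text \<open>A nonempty compact interval is the band around its midpoint, and compact intervals form
  a generator of the Borel sets that is stable under intersections.\<close>

lemma spectral_measure_unique:
  fixes E E' :: "real set \<Rightarrow> 'h::{real_inner, complete_space} \<Rightarrow> 'h"
  assumes "complete_pvm E" "complete_pvm E'"
    and eq: "spectral_integral E (\<lambda>l. l) = spectral_integral E' (\<lambda>l. l)"
  shows "scalar_spectral_measure E u = scalar_spectral_measure E' u"
proof -
  interpret E: complete_pvm E by fact
  interpret E': complete_pvm E' by fact
  have interval: "E {a..b} u = E' {a..b} u" for a b
  proof (cases "a \<le> b")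
    case True
    have "{a..b} = {l. \<bar>l - (a + b) / 2\<bar> \<le> (b - a) / 2}"
      by (auto simp: abs_le_iff field_simps)
    then show ?thesis
      using spectral_band_eq[OF assms, of "(b - a) / 2" "(a + b) / 2" u] True by simp
  qed simp
  show ?thesis
  proof (rule measure_eqI_generator_eq[where E = "range (\<lambda>(a, b). {a..b})" and \<Omega> = UNIV and A = "\<lambda>n. {- real n..real n}"])
    show "Int_stable (range (\<lambda>(a::real, b). {a..b}))"
      by (auto simp: Int_stable_def)
    show "sets (scalar_spectral_measure E u) = sigma_sets UNIV (range (\<lambda>(a, b). {a..b}))"
      "sets (scalar_spectral_measure E' u) = sigma_sets UNIV (range (\<lambda>(a, b). {a..b}))"
      by (simp_all add: borel_eq_atLeastAtMost)
    show "(\<Union>n. {- real n..real n}) = UNIV"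
    proof (intro set_eqI iffI UNIV_I)
      fix x :: real
      obtain n where "\<bar>x\<bar> \<le> real n" using real_arch_simple by blast
      then show "x \<in> (\<Union>n. {- real n..real n})" by (auto simp: abs_le_iff intro!: exI[of _ n])
    qed
  qed (auto simp: E.emeasure_\<mu> E'.emeasure_\<mu> interval)
qed

text \<open>Scalar measures determine only the quadratic form of \<open>E B\<close>. The difference
  \<open>D\<close> is symmetric with vanishing form; evaluated at \<open>u + D u\<close>, the form
  reduces to its cross terms, twice the square of the norm of \<open>D u\<close>.\<close>

lemma spectral_resolution_unique:
  fixes E E' :: "real set \<Rightarrow> 'h::{real_inner, complete_space} \<Rightarrow> 'h"
  assumes "spectral_resolution A E" "spectral_resolution A E'" and B: "B \<in> sets borel"
  shows "E B u = E' B u"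
proof -
  interpret E: complete_pvm E using assms(1) by unfold_locales (simp add: spectral_resolution_def)
  interpret E': complete_pvm E' using assms(2) by unfold_locales (simp add: spectral_resolution_def)
  define D where "D u = E B u - E' B u" for u
  have D_add: "D (u + v) = D u + D v" for u v
    unfolding D_def by (simp add: linear_add[OF E.linear_E[OF B]] linear_add[OF E'.linear_E[OF B]])
  have sym: "inner (D u) v = inner u (D v)" for u v
    unfolding D_def by (simp add: inner_diff_left inner_diff_right E.E_sym[OF B] E'.E_sym[OF B])
  have 0: "inner (D u) u = 0" for u
  proof -
    have "scalar_spectral_measure E u = scalar_spectral_measure E' u"
      using assms(1,2) E.complete_pvm_axioms E'.complete_pvm_axioms
      by (intro spectral_measure_unique) (auto simp: spectral_resolution_def)
    then have "emeasure (scalar_spectral_measure E u) B = emeasure (scalar_spectral_measure E' u) B"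
      by simp
    then have "(norm (E B u))\<^sup>2 = (norm (E' B u))\<^sup>2"
      by (simp add: E.emeasure_\<mu>[OF B] E'.emeasure_\<mu>[OF B])
    then show ?thesis
      by (simp add: D_def inner_diff_left E.inner_E[OF B] E'.inner_E[OF B])
  qed
  have "inner (D (u + D u)) (u + D u) = 2 * inner (D u) (D u)"
    using 0[of u] 0[of "D u"] sym[of "D u" u] by (simp add: D_add inner_add_left inner_add_right inner_commute)
  then have "D u = 0" using 0 by simp
  then show ?thesis by (simp add: D_def)
qed

text \<open>A resolution is determined on the Borel sets only. The integral looks at no other sets,
  since level sets of simple functions are Borel.\<close>

lemma spectral_integral_cong:
  assumes "\<And>B u. B \<in> sets borel \<Longrightarrow> E B u = E' B u"
  shows "spectral_integral E h = spectral_integral E' h"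
proof -
  have "scalar_spectral_measure E u = scalar_spectral_measure E' u" for u
    unfolding scalar_spectral_measure_def using assms by (intro measure_of_eq) (auto simp: sets.sigma_sets_eq[of "borel :: real measure", simplified])
  moreover have "simple_spectral_integral E s u = simple_spectral_integral E' s u" if "simple_function borel s" for s u
    unfolding simple_spectral_integral_def using simple_functionD_borel(2)[OF that] assms by simp
  ultimately have "(u, g) \<in> spectral_integral E h \<longleftrightarrow> (u, g) \<in> spectral_integral E' h" for u g
    unfolding spectral_integral_def by simp (intro conj_cong refl ex_cong1, auto)
  then show ?thesis by auto
qed

lemma functional_calculus_eq:
  fixes E :: "real set \<Rightarrow> 'h::{real_inner, complete_space} \<Rightarrow> 'h"
  assumes "spectral_resolution A E"
  shows "functional_calculus A h = spectral_integral E h"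
proof -
  have "spectral_integral E' h = spectral_integral E h" if "spectral_resolution A E'" for E'
    by (rule spectral_integral_cong) (rule spectral_resolution_unique[OF that assms])
  then show ?thesis
    using assms unfolding functional_calculus_def by blast
qed

lemma functional_calculus_unique:
  fixes A :: "('h::{real_inner, complete_space} \<times> 'h) set"
  assumes "h \<in> borel_measurable borel" "(u, g) \<in> functional_calculus A h" "(u, g') \<in> functional_calculus A h"
  shows "g = g'"
proof -
  obtain E where E: "spectral_resolution A E"
    using assms(2) by (auto simp: functional_calculus_def)
  interpret pvm E using E by unfold_locales (simp add: spectral_resolution_def)
  show ?thesis
    using assms spectral_integral_unique[OF assms(1)] unfolding functional_calculus_eq[OF E] by blast
qed


subsection \<open>Unitary invariance of the functional calculus\<close>

text \<open>The inverse is a parameter, so that conjugation has an explicit formula and exchanging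
  \<open>U\<close> and \<open>V\<close> gives another instance; for left translations it is the
  translation by the inverse element.\<close>

locale unitary =
  fixes U V :: "'h::real_inner \<Rightarrow> 'h"
  assumes linear_U: "linear U" and UV [simp]: "U (V u) = u" and VU [simp]: "V (U u) = u"
    and inner_U [simp]: "inner (U u) (U v) = inner u v"
begin

lemma norm_U [simp]: "norm (U u) = norm u"
  by (simp add: norm_eq_sqrt_inner)

lemma bounded_linear_U: "bounded_linear U"
  using linear_U by (intro bounded_linear_intro[of _ 1]) (auto simp: linear_add linear_scale)

lemma linear_V: "linear V"
proof (rule linearI)
  show "V (u + v) = V u + V v" for u v
    using linear_add[OF linear_U, of "V u" "V v"] VU[of "V u + V v"] by simp
  show "V (c *\<^sub>R u) = c *\<^sub>R V u" for c u
    using linear_scale[OF linear_U, of c "V u"] VU[of "c *\<^sub>R V u"] by simp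
qed

lemma inner_U_V: "inner (U u) v = inner u (V v)"
  using inner_U[of u "V v"] by simp

lemma inner_V_U: "inner u (U v) = inner (V u) v"
  using inner_U[of "V u" v] by simp

lemma projection_valued_measure_conj:
  assumes "projection_valued_measure E"
  shows "projection_valued_measure (\<lambda>B u. U (E B (V u)))"
proof -
  interpret pvm E by unfold_locales fact
  show ?thesis
    unfolding projection_valued_measure_def
  proof (intro conjI ballI allI impI)
    fix B :: "real set" and u v assume B: "B \<in> sets borel"
    show "linear (\<lambda>u. U (E B (V u)))"
      using linear_compose[OF linear_compose[OF linear_V linear_E[OF B]] linear_U] by (simp add: comp_def)
    show "inner (U (E B (V u))) v = inner u (U (E B (V v)))"
      by (simp only: inner_U_V inner_V_U E_sym[OF B])
    show "U (E (B \<inter> C) (V u)) = U (E B (V (U (E C (V u)))))" if "C \<in> sets borel" for C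
      by (simp add: E_Int[OF B that])
  next
    fix F :: "nat \<Rightarrow> real set" and u assume "range F \<subseteq> sets borel \<and> disjoint_family F"
    then show "(\<lambda>i. U (E (F i) (V u))) sums U (E (\<Union>i. F i) (V u))"
      by (intro bounded_linear.sums[OF bounded_linear_U] E_sums) auto
  qed simp
qed

lemma spectral_integral_conj:
  assumes "(u, g) \<in> spectral_integral E h"
  shows "(U u, U g) \<in> spectral_integral (\<lambda>B u. U (E B (V u))) h"
proof -
  have \<mu>: "scalar_spectral_measure (\<lambda>B u. U (E B (V u))) (U u) = scalar_spectral_measure E u"
    by (simp add: scalar_spectral_measure_def)
  have "simple_spectral_integral (\<lambda>B u. U (E B (V u))) s (U u) = U (simple_spectral_integral E s u)" for s
    by (simp add: simple_spectral_integral_def linear_sum[OF linear_U] linear_scale[OF linear_U])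
  moreover have "(\<lambda>k. U (f k)) \<longlonglongrightarrow> U g" if "f \<longlonglongrightarrow> g" for f :: "nat \<Rightarrow> 'h"
    using that by (rule bounded_linear.tendsto[OF bounded_linear_U])
  ultimately show ?thesis
    using assms unfolding spectral_integral_def mem_Collect_eq prod.case \<mu> by auto
qed

lemma unitary_inverse: "unitary V U"
proof (rule unitary.intro)
  show "inner (V u) (V v) = inner u v" for u v
    using inner_U[of "V u" "V v"] by simp
qed (simp_all add: linear_V)

lemma spectral_resolution_conj:
  assumes E: "spectral_resolution A E" and A: "\<And>u v. (u, v) \<in> A \<longleftrightarrow> (U u, U v) \<in> A"
  shows "spectral_resolution A (\<lambda>B u. U (E B (V u)))"
  unfolding spectral_resolution_def
proof
  show "projection_valued_measure (\<lambda>B u. U (E B (V u)))"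
    using E by (intro projection_valued_measure_conj) (simp add: spectral_resolution_def)
  have AE: "spectral_integral E (\<lambda>l. l) = A"
    using E by (simp add: spectral_resolution_def)
  show "spectral_integral (\<lambda>B u. U (E B (V u))) (\<lambda>l. l) = A"
  proof (intro set_eqI iffI)
    fix p assume "p \<in> A"
    then have "(V (fst p), V (snd p)) \<in> A" using A[of "V (fst p)" "V (snd p)"] by simp
    then have "(U (V (fst p)), U (V (snd p))) \<in> spectral_integral (\<lambda>B u. U (E B (V u))) (\<lambda>l. l)"
      unfolding AE[symmetric] by (rule spectral_integral_conj)
    then show "p \<in> spectral_integral (\<lambda>B u. U (E B (V u))) (\<lambda>l. l)" by simp
  next
    fix p assume "p \<in> spectral_integral (\<lambda>B u. U (E B (V u))) (\<lambda>l. l)"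
    then have "(fst p, snd p) \<in> spectral_integral (\<lambda>B u. U (E B (V u))) (\<lambda>l. l)" by simp
    \<comment> \<open>Conjugating back with \<open>U\<close> and \<open>V\<close> exchanged cancels
      the first conjugation and leaves the integral of \<open>E\<close> itself.\<close>
    from unitary.spectral_integral_conj[OF unitary_inverse this]
    have "(V (fst p), V (snd p)) \<in> A" by (simp add: AE)
    then show "p \<in> A" using A[of "V (fst p)" "V (snd p)"] by simp
  qed
qed

text \<open>The functional calculus asks for some resolution of \<open>A\<close>; the conjugated
  resolution is the witness for the image pair.\<close>

lemma functional_calculus_invariant:
  assumes A: "\<And>u v. (u, v) \<in> A \<longleftrightarrow> (U u, U v) \<in> A"
    and "(u, g) \<in> functional_calculus A h"
  shows "(U u, U g) \<in> functional_calculus A h"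
  using assms(2) spectral_resolution_conj[OF _ A] spectral_integral_conj
  unfolding functional_calculus_def by blast

end

section \<open>Left translations of the Heisenberg group\<close>

text \<open>The linear part of the left translation by \<open>p\<close>. Left translations are
  affine, so this is their differential at every point.\<close>

definition heis_twist :: "'n::finite heis \<Rightarrow> 'n heis \<Rightarrow> 'n heis" where
  "heis_twist p q = (fst q, fst (snd q),
     snd (snd q) + 2 * (\<Sum>i\<in>UNIV. fst q $ i * fst (snd p) $ i - fst p $ i * fst (snd q) $ i))"

lemma heis_mult_eq: "p \<star> q = p + heis_twist p q"
  by (cases p, cases q) (simp add: heis_mult_def heis_twist_def)

lemma linear_heis_twist: "linear (heis_twist p)"
proof (rule linearI)
  show "heis_twist p (q + r) = heis_twist p q + heis_twist p r" for q r
    by (simp add: heis_twist_def algebra_simps sum.distrib sum_subtractf)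
  show "heis_twist p (c *\<^sub>R q) = c *\<^sub>R heis_twist p q" for c q
    by (simp add: heis_twist_def algebra_simps sum_subtractf sum_distrib_left)
qed

lemma bounded_linear_heis_twist: "bounded_linear (heis_twist p)"
  using linear_heis_twist linear_conv_bounded_linear by blast

lemma heis_mult_has_derivative: "((\<star>) p has_derivative heis_twist p) (at q)"
proof -
  have "((\<lambda>q. p + heis_twist p q) has_derivative (\<lambda>v. 0 + heis_twist p v)) (at q)"
    by (intro derivative_intros bounded_linear_imp_has_derivative bounded_linear_heis_twist)
  then show ?thesis
    by (simp add: heis_mult_eq[abs_def])
qed

lemma continuous_heis_mult: "continuous_on A ((\<star>) p)"
  by (intro continuous_at_imp_continuous_on ballI has_derivative_continuous[OF heis_mult_has_derivative])

lemma measurable_heis_mult [measurable]: "(\<star>) p \<in> borel_measurable borel"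
  by (intro borel_measurable_continuous_onI continuous_heis_mult)

text \<open>\<open>- p\<close> is the group inverse because the alternating term of the product
  vanishes on \<open>p\<close> and \<open>- p\<close>.\<close>

lemma heis_mult_uminus [simp]: "p \<star> (- p \<star> q) = q" "- p \<star> (p \<star> q) = q"
  by (cases p, cases q, simp add: heis_mult_def algebra_simps sum.distrib sum_subtractf sum_negf)+

section \<open>Left invariance of Lebesgue measure\<close>

lemma nn_integral_lborel_plus:
  fixes f :: "'a::euclidean_space \<Rightarrow> ennreal"
  assumes [measurable]: "f \<in> borel_measurable borel"
  shows "(\<integral>\<^sup>+ u. f (c + u) \<partial>lborel) = (\<integral>\<^sup>+ u. f u \<partial>lborel)"
proof -
  have "(\<integral>\<^sup>+ u. f u \<partial>distr lborel borel ((+) c)) = (\<integral>\<^sup>+ u. f (c + u) \<partial>lborel)"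
    by (rule nn_integral_distr) simp_all
  then show ?thesis
    by (simp add: lborel_distr_plus)
qed

lemma nn_integral_lborel_prod:
  fixes f :: "'a::euclidean_space \<times> 'b::euclidean_space \<Rightarrow> ennreal"
  assumes "f \<in> borel_measurable borel"
  shows "(\<integral>\<^sup>+ p. f p \<partial>lborel) = (\<integral>\<^sup>+ u. \<integral>\<^sup>+ v. f (u, v) \<partial>lborel \<partial>lborel)"
  using lborel.nn_integral_fst[of f lborel] assms by (simp add: lborel_prod)

text \<open>For fixed \<open>x'\<close> and \<open>y'\<close> the last coordinate is merely
  translated, by the amount \<open>c x' y'\<close>. Integrating it first removes the shear, and two
  ordinary translations remain.\<close>

lemma nn_integral_heis_mult:
  fixes f :: "'n::finite heis \<Rightarrow> ennreal"
  assumes [measurable]: "f \<in> borel_measurable borel"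
  shows "(\<integral>\<^sup>+ q. f (p \<star> q) \<partial>lborel) = (\<integral>\<^sup>+ q. f q \<partial>lborel)"
proof -
  obtain x y z where p: "p = (x, y, z)" by (cases p)
  define c where "c = (\<lambda>x' y' :: real ^ 'n. z + 2 * (\<Sum>i\<in>UNIV. x' $ i * y $ i - x $ i * y' $ i))"
  have mult: "p \<star> (x', y', z') = (x + x', y + y', c x' y' + z')" for x' y' z'
    by (simp add: p heis_mult_def c_def)
  have "(\<integral>\<^sup>+ q. f (p \<star> q) \<partial>lborel)
      = (\<integral>\<^sup>+ x'. \<integral>\<^sup>+ y'. \<integral>\<^sup>+ z'. f (x + x', y + y', c x' y' + z') \<partial>lborel \<partial>lborel \<partial>lborel)"
    by (simp add: nn_integral_lborel_prod mult)
  also have "\<dots> = (\<integral>\<^sup>+ x'. \<integral>\<^sup>+ y'. \<integral>\<^sup>+ z'. f (x + x', y + y', z') \<partial>lborel \<partial>lborel \<partial>lborel)"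
    by (intro nn_integral_cong nn_integral_lborel_plus) measurable
  also have "\<dots> = (\<integral>\<^sup>+ x'. \<integral>\<^sup>+ y'. \<integral>\<^sup>+ z'. f (x + x', y', z') \<partial>lborel \<partial>lborel \<partial>lborel)"
    by (intro nn_integral_cong nn_integral_lborel_plus[where f = "\<lambda>y'. \<integral>\<^sup>+ z'. f (_, y', z') \<partial>lborel"]) measurable
  also have "\<dots> = (\<integral>\<^sup>+ x'. \<integral>\<^sup>+ y'. \<integral>\<^sup>+ z'. f (x', y', z') \<partial>lborel \<partial>lborel \<partial>lborel)"
    by (intro nn_integral_lborel_plus[where f = "\<lambda>x'. \<integral>\<^sup>+ y'. \<integral>\<^sup>+ z'. f (x', y', z') \<partial>lborel \<partial>lborel"]) measurable
  also have "\<dots> = (\<integral>\<^sup>+ q. f q \<partial>lborel)"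
    by (simp add: nn_integral_lborel_prod)
  finally show ?thesis .
qed

lemma distr_heis_mult: "distr lborel lborel ((\<star>) p) = lborel"
proof (rule measure_eqI)
  fix A assume "A \<in> sets (distr lborel lborel ((\<star>) p))"
  then have [measurable]: "A \<in> sets borel" by simp
  have "emeasure (distr lborel lborel ((\<star>) p)) A = (\<integral>\<^sup>+ q. indicator A q \<partial>distr lborel lborel ((\<star>) p))"
    by simp
  also have "\<dots> = (\<integral>\<^sup>+ q. indicator A (p \<star> q) \<partial>lborel)"
    by (subst nn_integral_distr) simp_all
  also have "\<dots> = emeasure lborel A"
    by (subst nn_integral_heis_mult) simp_all
  finally show "emeasure (distr lborel lborel ((\<star>) p)) A = emeasure lborel A" .
qed simp

lemma AE_heis_mult: "AE q in lborel. P q \<Longrightarrow> AE q in lborel. P (p \<star> q)"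
  by (rule AE_distrD[of _ lborel lborel]) (simp, simp only: distr_heis_mult)

lemma square_integrable_heis_mult:
  assumes "square_integrable f"
  shows "square_integrable (\<lambda>q. f (p \<star> q))"
proof -
  have [measurable]: "f \<in> borel_measurable borel" using assms by (simp add: square_integrable_def)
  have "integrable (distr lborel lborel ((\<star>) p)) (\<lambda>q. (f q)\<^sup>2)"
    using assms by (simp add: distr_heis_mult square_integrable_def)
  then have "integrable lborel (\<lambda>q. (f (p \<star> q))\<^sup>2)"
    by (rule integrable_distr[rotated]) simp
  then show ?thesis by (simp add: square_integrable_def)
qed

section \<open>Translations as unitary operators\<close>

definition translate :: "'n::finite heis \<Rightarrow> 'n heis L2 \<Rightarrow> 'n heis L2" where
  "translate p u = L2_of (\<lambda>q. rep_L2 u (p \<star> q))"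

text \<open>Any representative gives the same class, because a property that holds almost everywhere
  still does after translation.\<close>

lemma translate_L2_of:
  assumes f: "square_integrable f"
  shows "translate p (L2_of f) = L2_of (\<lambda>q. f (p \<star> q))"
proof -
  have r: "square_integrable (rep_L2 (L2_of f))" by (rule square_integrable_rep_L2)
  have "AE q in lborel. rep_L2 (L2_of f) q = f q"
    using L2_of_eq_iff[OF r f] by simp
  then have "AE q in lborel. rep_L2 (L2_of f) (p \<star> q) = f (p \<star> q)"
    by (rule AE_heis_mult)
  then show ?thesis
    unfolding translate_def by (subst L2_of_eq_iff) (auto intro: square_integrable_heis_mult r f)
qed

lemma L2_cases:
  obtains f where "square_integrable f" "u = L2_of f"
  using square_integrable_rep_L2[of u] L2_of_rep_L2[of u] by metis

interpretation translate: unitary "translate p" "translate (- p)" for p :: "'n::finite heis"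
proof (rule unitary.intro)
  show "linear (translate p)"
  proof (rule linearI)
    fix u v :: "'n heis L2" and c :: real
    obtain f where f: "square_integrable f" "u = L2_of f" by (rule L2_cases)
    obtain g where g: "square_integrable g" "v = L2_of g" by (rule L2_cases)
    show "translate p (u + v) = translate p u + translate p v"
      using f g by (simp add: translate_L2_of square_integrable_add square_integrable_heis_mult flip: L2_of_add)
    show "translate p (c *\<^sub>R u) = c *\<^sub>R translate p u"
      using f by (simp add: translate_L2_of square_integrable_scale square_integrable_heis_mult flip: L2_of_scale)
  qed
  fix u v :: "'n heis L2"
  obtain f where f: "square_integrable f" "u = L2_of f" by (rule L2_cases)
  obtain g where g: "square_integrable g" "v = L2_of g" by (rule L2_cases)
  show "translate p (translate (- p) u) = u" "translate (- p) (translate p u) = u"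
    using f by (simp_all add: translate_L2_of square_integrable_heis_mult)
  have [measurable]: "f \<in> borel_measurable borel" "g \<in> borel_measurable borel"
    using f(1) g(1) by (simp_all add: square_integrable_def)
  have "inner (translate p u) (translate p v) = (LINT q|lborel. f (p \<star> q) * g (p \<star> q))"
    using f g by (simp add: translate_L2_of square_integrable_heis_mult inner_L2_of)
  also have "\<dots> = (LINT q|distr lborel lborel ((\<star>) p). f q * g q)"
    by (subst integral_distr) simp_all
  also have "\<dots> = inner u v"
    using f g by (simp add: distr_heis_mult inner_L2_of)
  finally show "inner (translate p u) (translate p v) = inner u v" .
qed


section \<open>Left invariance of the sub-Laplacian\<close>

definition smooth :: "('a::real_normed_vector \<Rightarrow> real) \<Rightarrow> bool" where
  "smooth f \<longleftrightarrow> (\<forall>k. Ck k f)"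

lemma smooth_dir_deriv: "smooth f \<Longrightarrow> smooth (dir_deriv v f)"
  unfolding smooth_def using Ck.simps(2) by blast

lemma smooth_differentiable: "smooth f \<Longrightarrow> f differentiable at p"
  unfolding smooth_def using Ck.simps(2)[of 0 f] by (simp add: differentiable_on_def)

lemma smooth_continuous: "smooth f \<Longrightarrow> continuous_on A f"
  using smooth_differentiable differentiable_imp_continuous_within
  by (intro continuous_at_imp_continuous_on) blast

lemma has_derivative_dir_deriv:
  assumes "f differentiable at p"
  shows "(f has_derivative (\<lambda>v. dir_deriv v f p)) (at p)"
  using assms unfolding dir_deriv_def frechet_derivative_works by (simp add: eta_contract_eq)

lemma dir_deriv_eq: "(f has_derivative f') (at p) \<Longrightarrow> dir_deriv v f p = f' v"
  unfolding dir_deriv_def by (simp flip: frechet_derivative_at)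

lemma linear_dir_deriv: "f differentiable at p \<Longrightarrow> linear (\<lambda>v. dir_deriv v f p)"
  using has_derivative_dir_deriv has_derivative_linear by blast

lemma has_derivative_heis_mult_comp:
  assumes "f differentiable at (p \<star> q)"
  shows "((\<lambda>q. f (p \<star> q)) has_derivative (\<lambda>v. dir_deriv (heis_twist p v) f (p \<star> q))) (at q)"
  using diff_chain_at[OF heis_mult_has_derivative has_derivative_dir_deriv[OF assms]] by (simp add: comp_def)

lemma dir_deriv_heis_mult:
  assumes "f differentiable at (p \<star> q)"
  shows "dir_deriv v (\<lambda>q. f (p \<star> q)) q = dir_deriv (heis_twist p v) f (p \<star> q)"
  by (rule dir_deriv_eq[OF has_derivative_heis_mult_comp[OF assms]])

text \<open>The differential of a translation is constant in the point. A derivative of the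
  translate is therefore the translate of a derivative in another direction, without product-rule
  terms, and the induction closes because \<open>Ck\<close> quantifies over all directions.\<close>

lemma Ck_heis_mult: "Ck k f \<Longrightarrow> Ck k (\<lambda>q. f (p \<star> q))"
proof (induction k arbitrary: f)
  case 0
  then show ?case
    using continuous_on_compose2[of UNIV f UNIV "(\<star>) p"] continuous_heis_mult[of UNIV p] by simp
next
  case (Suc k)
  have f: "f differentiable at q" for q
    using Suc.prems by (simp add: differentiable_on_def del: split_paired_All)
  have "(\<lambda>q. f (p \<star> q)) differentiable at q" for q
    using has_derivative_heis_mult_comp[OF f] unfolding differentiable_def by blast
  moreover have "Ck k (dir_deriv v (\<lambda>q. f (p \<star> q)))" for v
  proof -
    have "dir_deriv v (\<lambda>q. f (p \<star> q)) = (\<lambda>q. dir_deriv (heis_twist p v) f (p \<star> q))"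
      using dir_deriv_heis_mult[OF f] by blast
    then show ?thesis
      using Suc.IH[of "dir_deriv (heis_twist p v) f"] Suc.prems by (simp del: split_paired_All)
  qed
  ultimately show ?case by (simp add: differentiable_on_def)
qed

lemma test_function_heis_mult:
  assumes "test_function f"
  shows "test_function (\<lambda>q. f (p \<star> q))"
proof -
  let ?K = "closure {q. f q \<noteq> 0}"
  have K: "compact ((\<star>) (- p) ` ?K)"
    using assms by (intro compact_continuous_image continuous_heis_mult) (simp add: test_function_def)
  have "q \<in> (\<star>) (- p) ` ?K" if "f (p \<star> q) \<noteq> 0" for q
  proof
    show "q = - p \<star> (p \<star> q)" by simp
    show "p \<star> q \<in> ?K" using that by (intro subsetD[OF closure_subset]) simp
  qed
  then have "closure {q. f (p \<star> q) \<noteq> 0} \<subseteq> (\<star>) (- p) ` ?K"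
    using compact_imp_closed[OF K] by (intro closure_minimal) auto
  then have "compact (closure {q. f (p \<star> q) \<noteq> 0})"
    using compact_Int_closed[OF K closed_closure, of "{q. f (p \<star> q) \<noteq> 0}"] by (simp add: inf.absorb2)
  then show ?thesis
    using assms by (simp add: test_function_def Ck_heis_mult)
qed

text \<open>The common shape of the fields X_i and Y_i: a constant direction plus a multiple of the
  central one. Both families use linear coefficients \<open>l\<close>, so one proof of invariance
  covers them.\<close>

definition heis_field :: "'n::finite heis \<Rightarrow> ('n heis \<Rightarrow> real) \<Rightarrow> ('n heis \<Rightarrow> real) \<Rightarrow> 'n heis \<Rightarrow> real" where
  "heis_field a l f p = dir_deriv a f p + l p * dir_deriv (0, 0, 1) f p"

lemma heis_X_eq: "heis_X i = heis_field (axis i 1, 0, 0) (\<lambda>p. 2 * fst (snd p) $ i)"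
  by (auto simp: heis_X_def heis_field_def fun_eq_iff)

lemma heis_Y_eq: "heis_Y i = heis_field (0, axis i 1, 0) (\<lambda>p. - 2 * fst p $ i)"
  by (auto simp: heis_Y_def heis_field_def fun_eq_iff)

lemma heis_field_has_derivative:
  assumes f: "smooth f" and l: "bounded_linear l"
  shows "(heis_field a l f has_derivative (\<lambda>v. dir_deriv v (dir_deriv a f) p +
    (l p * dir_deriv v (dir_deriv (0, 0, 1) f) p + l v * dir_deriv (0, 0, 1) f p))) (at p)"
proof -
  have "(dir_deriv w f has_derivative (\<lambda>v. dir_deriv v (dir_deriv w f) p)) (at p)" for w
    by (intro has_derivative_dir_deriv smooth_differentiable smooth_dir_deriv f)
  then show ?thesis
    unfolding heis_field_def[abs_def]
    by (intro has_derivative_add has_derivative_mult bounded_linear_imp_has_derivative l)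
qed

text \<open>Smoothness is stated for iterated derivatives in constant directions, so the second
  application of the field is expanded into those by the product rule.\<close>

lemma continuous_heis_field_twice:
  assumes f: "smooth f" and l: "bounded_linear l"
  shows "continuous_on UNIV (heis_field a l (heis_field a l f))"
proof -
  have eq: "heis_field a l (heis_field a l f) = (\<lambda>p.
      dir_deriv a (dir_deriv a f) p + (l p * dir_deriv a (dir_deriv (0, 0, 1) f) p + l a * dir_deriv (0, 0, 1) f p) +
      l p * (dir_deriv (0, 0, 1) (dir_deriv a f) p +
        (l p * dir_deriv (0, 0, 1) (dir_deriv (0, 0, 1) f) p + l (0, 0, 1) * dir_deriv (0, 0, 1) f p)))"
    using dir_deriv_eq[OF heis_field_has_derivative[OF f l]] by (simp add: heis_field_def[of a l "heis_field a l f"] fun_eq_iff)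
  show ?thesis
    unfolding eq
    by (intro continuous_intros smooth_continuous smooth_dir_deriv f linear_continuous_on l)
qed

text \<open>The differential of the translation tilts the direction \<open>a\<close> by
  \<open>l p\<close> along the centre, which is exactly the increase of the coefficient between
  \<open>q\<close> and \<open>p \<star> q\<close>.\<close>

lemma heis_field_heis_mult:
  assumes f: "\<And>q. f differentiable at q"
    and a: "heis_twist p a = a + l p *\<^sub>R (0, 0, 1)" and l: "\<And>q. l (heis_mult p q) = l p + l q"
  shows "heis_field a l (\<lambda>q. f (p \<star> q)) = (\<lambda>q. heis_field a l f (p \<star> q))"
proof
  fix q
  have "heis_twist p (0, 0, 1) = (0, 0, 1)" by (simp add: heis_twist_def)
  then have "heis_field a l (\<lambda>q. f (p \<star> q)) q
      = dir_deriv (a + l p *\<^sub>R (0, 0, 1)) f (p \<star> q) + l q * dir_deriv (0, 0, 1) f (p \<star> q)"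
    by (simp only: heis_field_def dir_deriv_heis_mult[OF f] a)
  also have "\<dots> = heis_field a l f (p \<star> q)"
    by (simp only: heis_field_def l linear_add[OF linear_dir_deriv[OF f]] linear_scale[OF linear_dir_deriv[OF f]])
      (simp add: distrib_right)
  finally show "heis_field a l (\<lambda>q. f (p \<star> q)) q = heis_field a l f (p \<star> q)" .
qed

lemma heis_field_twice_heis_mult:
  assumes f: "smooth f" and bl: "bounded_linear l"
    and a: "heis_twist p a = a + l p *\<^sub>R (0, 0, 1)" and l: "\<And>q. l (heis_mult p q) = l p + l q"
  shows "heis_field a l (heis_field a l (\<lambda>q. f (p \<star> q))) q = heis_field a l (heis_field a l f) (p \<star> q)"
proof -
  have "heis_field a l f differentiable at q" for q
    using heis_field_has_derivative[OF f bl] unfolding differentiable_def by blast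
  then show ?thesis
    by (simp only: heis_field_heis_mult[OF smooth_differentiable[OF f] a l] heis_field_heis_mult[OF _ a l])
qed

lemma heis_X_coeff: "bounded_linear (\<lambda>p::'n::finite heis. 2 * fst (snd p) $ i)"
  and heis_Y_coeff: "bounded_linear (\<lambda>p::'n::finite heis. - 2 * fst p $ i)"
  unfolding linear_conv_bounded_linear[symmetric] by (auto intro!: linearI simp: algebra_simps)

lemma sub_laplacian_heis_mult:
  assumes f: "smooth f"
  shows "sub_laplacian (\<lambda>q. f (p \<star> q)) = (\<lambda>q. sub_laplacian f (p \<star> q))"
proof
  fix q
  have X: "heis_X i (heis_X i (\<lambda>q. f (p \<star> q))) q = heis_X i (heis_X i f) (p \<star> q)" for i
    unfolding heis_X_eq
    by (rule heis_field_twice_heis_mult[OF f heis_X_coeff])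
      (simp_all add: heis_twist_def heis_mult_eq axis_def if_distrib if_distribR cong: if_cong)
  have Y: "heis_Y i (heis_Y i (\<lambda>q. f (p \<star> q))) q = heis_Y i (heis_Y i f) (p \<star> q)" for i
    unfolding heis_Y_eq
    by (rule heis_field_twice_heis_mult[OF f heis_Y_coeff])
      (simp_all add: heis_twist_def heis_mult_eq axis_def if_distrib if_distribR sum_negf cong: if_cong)
  show "sub_laplacian (\<lambda>q. f (p \<star> q)) q = sub_laplacian f (p \<star> q)"
    unfolding sub_laplacian_def X Y ..
qed

section \<open>Square integrability of test functions and of their sub-Laplacians\<close>

lemma dir_deriv_zero_outside:
  assumes K: "closed K" and f: "\<And>q. q \<notin> K \<Longrightarrow> f q = 0" and q: "q \<notin> K"
  shows "dir_deriv v f q = 0"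
proof -
  have "(f has_derivative (\<lambda>_. 0)) (at q)"
    by (rule has_derivative_transform_within_open[of "\<lambda>_. 0" _ _ _ "- K"]) (use assms in auto)
  then show ?thesis by (rule dir_deriv_eq)
qed

lemma heis_field_zero_outside:
  assumes "closed K" "\<And>q. q \<notin> K \<Longrightarrow> f q = 0" "q \<notin> K"
  shows "heis_field a l f q = 0"
  using dir_deriv_zero_outside[OF assms] by (simp add: heis_field_def)

lemma square_integrable_compact_support:
  fixes f :: "'a::euclidean_space \<Rightarrow> real"
  assumes K: "compact K" and f: "continuous_on UNIV f" and zero: "\<And>q. q \<notin> K \<Longrightarrow> f q = 0"
  shows "square_integrable f"
proof -
  have "integrable lborel (\<lambda>q. indicator K q *\<^sub>R (f q)\<^sup>2)"
    using K f by (intro borel_integrable_compact continuous_intros) (auto intro: continuous_on_subset)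
  also have "(\<lambda>q. indicator K q *\<^sub>R (f q)\<^sup>2) = (\<lambda>q. (f q)\<^sup>2)"
    using zero by (force simp: indicator_def fun_eq_iff)
  finally show ?thesis
    using borel_measurable_continuous_onI[OF f] by (simp add: square_integrable_def)
qed

lemma test_function_smooth: "test_function f \<Longrightarrow> smooth f"
  by (simp add: test_function_def smooth_def)

text \<open>\<open>L2_of\<close> is specified on square integrable functions only, so both
  components of a generator of the graph have to be in L2 before a translation can be computed on
  representatives.\<close>

lemma test_function_square_integrable:
  assumes "test_function (f :: 'n::finite heis \<Rightarrow> real)"
  shows "square_integrable f" "square_integrable (sub_laplacian f)"
proof -
  let ?K = "closure {q. f q \<noteq> 0}"
  have K: "compact ?K" using assms by (simp add: test_function_def)
  have zero: "f q = 0" if "q \<notin> ?K" for q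
    using that subsetD[OF closure_subset, of q "{q. f q \<noteq> 0}"] by auto
  note f = test_function_smooth[OF assms]
  show "square_integrable f"
    by (rule square_integrable_compact_support[OF K smooth_continuous[OF f] zero])
  have "heis_field a l (heis_field a l f) q = 0" if "q \<notin> ?K" for a l q
    by (rule heis_field_zero_outside[OF closed_closure _ that], rule heis_field_zero_outside[OF closed_closure zero])
  then have "sub_laplacian f q = 0" if "q \<notin> ?K" for q
    using that by (simp add: sub_laplacian_def heis_X_eq heis_Y_eq)
  moreover have "continuous_on UNIV (sub_laplacian f)"
    unfolding sub_laplacian_def[abs_def] heis_X_eq heis_Y_eq
    by (intro continuous_on_sum continuous_on_add continuous_heis_field_twice[OF f] heis_X_coeff heis_Y_coeff)
  ultimately show "square_integrable (sub_laplacian f)"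
    using square_integrable_compact_support[OF K] by blast
qed

text \<open>Translations permute the pairs coming from test functions, and a continuous map that
  sends these pairs into the closed graph sends their closure there too.\<close>

lemma sub_laplacian_L2_translate:
  fixes u v :: "'n::finite heis L2"
  assumes "(u, v) \<in> sub_laplacian_L2"
  shows "(translate p u, translate p v) \<in> sub_laplacian_L2"
proof -
  let ?G = "{(L2_of f, L2_of (sub_laplacian f)) | f. test_function f} :: ('n heis L2 \<times> 'n heis L2) set"
  let ?T = "\<lambda>w :: 'n heis L2 \<times> 'n heis L2. (translate p (fst w), translate p (snd w))"
  have "?T ` closure ?G \<subseteq> closure ?G"
  proof (rule image_closure_subset)
    show "continuous_on (closure ?G) ?T"
      by (intro continuous_intros linear_continuous_on_compose bounded_linear.continuous_on[OF translate.bounded_linear_U])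
    show "?T ` ?G \<subseteq> closure ?G"
    proof (rule image_subsetI)
      fix w assume "w \<in> ?G"
      then obtain f where f: "test_function f" "w = (L2_of f, L2_of (sub_laplacian f))" by auto
      have "?T w = (L2_of (\<lambda>q. f (p \<star> q)), L2_of (sub_laplacian (\<lambda>q. f (p \<star> q))))"
        using test_function_square_integrable[OF f(1)] test_function_smooth[OF f(1)]
        by (simp add: f(2) translate_L2_of sub_laplacian_heis_mult)
      then have "?T w \<in> ?G"
        using test_function_heis_mult[OF f(1), of p] by (intro CollectI exI conjI)
      then show "?T w \<in> closure ?G"
        by (rule subsetD[OF closure_subset])
    qed
  qed simp
  then show ?thesis
    using assms unfolding sub_laplacian_L2_def by force
qed

lemma sub_laplacian_L2_translate_iff:
  "(translate p u, translate p v) \<in> sub_laplacian_L2 \<longleftrightarrow> (u, v) \<in> sub_laplacian_L2"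
  using sub_laplacian_L2_translate[of u v p] sub_laplacian_L2_translate[of "translate p u" "translate p v" "- p"]
  by auto

section \<open>Powers of the sub-Laplacian commute with translations\<close>

lemma neg_power_graph_translate:
  fixes u g :: "'n::finite heis L2"
  assumes "(u, g) \<in> neg_power_graph \<alpha>"
  shows "(translate p u, translate p g) \<in> neg_power_graph \<alpha>"
  unfolding neg_power_graph_def
proof (rule translate.functional_calculus_invariant)
  show "(u, g) \<in> functional_calculus {(u, - v) | u v. (u, v) \<in> sub_laplacian_L2} (\<lambda>l. l powr - \<alpha>)"
    using assms by (simp add: neg_power_graph_def)
  show "(u, v) \<in> {(u, - v) | u v. (u, v) \<in> sub_laplacian_L2} \<longleftrightarrow>
      (translate p u, translate p v) \<in> {(u, - v) | u v. (u, v) \<in> sub_laplacian_L2}" for u v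
  proof -
    have *: "(u, v) \<in> {(u, - v) | u v. (u, v) \<in> sub_laplacian_L2} \<longleftrightarrow> (u, - v) \<in> sub_laplacian_L2"
      for u v :: "'n heis L2"
      by (auto intro!: exI[of _ "- v"])
    show ?thesis
      unfolding * using sub_laplacian_L2_translate_iff[of p u "- v"]
      by (simp add: linear_neg[OF translate.linear_U])
  qed
qed

lemma neg_power_eqI:
  assumes "(u, g) \<in> neg_power_graph \<alpha>"
  shows "neg_power \<alpha> u = g"
  unfolding neg_power_def
proof (rule the_equality)
  show "(u, g) \<in> neg_power_graph \<alpha>" by fact
  show "g' = g" if "(u, g') \<in> neg_power_graph \<alpha>" for g'
    using functional_calculus_unique[OF _ that[unfolded neg_power_graph_def] assms[unfolded neg_power_graph_def]]
    by simp
qed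

lemma neg_power_domain_translate:
  "translate p u \<in> neg_power_domain \<alpha> \<longleftrightarrow> u \<in> neg_power_domain \<alpha>"
  using neg_power_graph_translate[of u _ \<alpha> p] neg_power_graph_translate[of "translate p u" _ \<alpha> "- p"]
  by (auto simp: neg_power_domain_def Domain_iff)

lemma neg_power_translate:
  assumes "u \<in> neg_power_domain \<alpha>"
  shows "neg_power \<alpha> (translate p u) = translate p (neg_power \<alpha> u)"
proof -
  obtain g where g: "(u, g) \<in> neg_power_graph \<alpha>"
    using assms by (auto simp: neg_power_domain_def)
  then show ?thesis
    by (simp add: neg_power_eqI[OF g] neg_power_eqI[OF neg_power_graph_translate])
qed

section \<open>Measurability in the time variable\<close>

lemma square_integrable_measurable: "square_integrable f \<Longrightarrow> f \<in> borel_measurable borel"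
  by (simp add: square_integrable_def)

lemma square_integrable_bound:
  assumes "square_integrable f" "F \<in> borel_measurable borel" "\<And>q. \<bar>F q\<bar> \<le> \<bar>f q\<bar>"
  shows "square_integrable F"
proof -
  have "integrable lborel (\<lambda>q. (F q)\<^sup>2)"
    by (rule Bochner_Integration.integrable_bound[where f = "\<lambda>q. (f q)\<^sup>2"])
      (use assms in \<open>auto simp: square_integrable_def abs_le_square_iff[symmetric]\<close>)
  then show ?thesis using assms(2) by (simp add: square_integrable_def)
qed

lemma L2_of_tendsto:
  assumes f: "square_integrable f" and F [measurable]: "\<And>k. F k \<in> borel_measurable borel"
    and le: "\<And>k q. \<bar>F k q\<bar> \<le> \<bar>f q\<bar>" and lim: "\<And>q. (\<lambda>k. F k q) \<longlonglongrightarrow> f q"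
  shows "(\<lambda>k. L2_of (F k)) \<longlonglongrightarrow> L2_of f"
proof -
  have [measurable]: "f \<in> borel_measurable borel" using f by (simp add: square_integrable_def)
  have Fk: "square_integrable (F k)" for k
    by (rule square_integrable_bound[OF f F le])
  have "(\<lambda>k. \<integral>\<^sup>+ q. ennreal ((F k q - f q)\<^sup>2) \<partial>lborel) \<longlonglongrightarrow> (\<integral>\<^sup>+ q. 0 \<partial>(lborel :: 'a measure))"
  proof (rule nn_integral_dominated_convergence)
    show "AE q in lborel. ennreal ((F k q - f q)\<^sup>2) \<le> ennreal ((2 * f q)\<^sup>2)" for k
    proof (rule AE_I2)
      fix q
      have "\<bar>F k q - f q\<bar> \<le> \<bar>2 * f q\<bar>" using le[of k q] by linarith
      then show "ennreal ((F k q - f q)\<^sup>2) \<le> ennreal ((2 * f q)\<^sup>2)"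
        by (intro ennreal_leI) (simp only: abs_le_square_iff)
    qed
    show "(\<integral>\<^sup>+ q. ennreal ((2 * f q)\<^sup>2) \<partial>lborel) < \<infinity>"
      unfolding nn_integral_norm_L2_of[OF square_integrable_scale[OF f]] by simp
    show "AE q in lborel. (\<lambda>k. ennreal ((F k q - f q)\<^sup>2)) \<longlonglongrightarrow> 0"
    proof (rule AE_I2)
      fix q
      have "(\<lambda>k. (F k q - f q)\<^sup>2) \<longlonglongrightarrow> (f q - f q)\<^sup>2"
        by (intro tendsto_intros lim)
      then show "(\<lambda>k. ennreal ((F k q - f q)\<^sup>2)) \<longlonglongrightarrow> 0"
        by (simp add: ennreal_tendsto_0_iff)
    qed
  qed measurable
  moreover have "(\<integral>\<^sup>+ q. ennreal ((F k q - f q)\<^sup>2) \<partial>lborel) = ennreal ((norm (L2_of (F k) - L2_of f))\<^sup>2)" for k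
    unfolding L2_of_diff[OF Fk f, symmetric] by (rule nn_integral_norm_L2_of[OF square_integrable_diff[OF Fk f]])
  ultimately have "(\<lambda>k. ennreal ((norm (L2_of (F k) - L2_of f))\<^sup>2)) \<longlonglongrightarrow> 0"
    by simp
  then have "(\<lambda>k. (norm (L2_of (F k) - L2_of f))\<^sup>2) \<longlonglongrightarrow> 0"
    by (subst (asm) ennreal_tendsto_0_iff) auto
  then have "(\<lambda>k. norm (L2_of (F k) - L2_of f)) \<longlonglongrightarrow> 0"
    using tendsto_real_sqrt[of "\<lambda>k. (norm (L2_of (F k) - L2_of f))\<^sup>2" 0] by simp
  then show ?thesis
    by (simp add: LIM_zero_iff tendsto_norm_zero_iff)
qed

lemma square_integrable_sum_L2_of_sum:
  fixes h :: "nat \<Rightarrow> 'a::euclidean_space \<Rightarrow> real"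
  assumes "\<And>i. square_integrable (h i)"
  shows "square_integrable (\<lambda>q. \<Sum>i<k. h i q) \<and> L2_of (\<lambda>q. \<Sum>i<k. h i q) = (\<Sum>i<k. L2_of (h i))"
proof (induction k)
  case 0
  have "L2_of (\<lambda>_. 0) = (0 :: 'a L2)"
    using L2_of_scale[OF square_integrable_zero, of 0] by simp
  then show ?case by (simp add: square_integrable_zero)
next
  case (Suc k)
  then show ?case using assms by (simp add: square_integrable_add L2_of_add)
qed

lemma square_integrable_indicator:
  assumes "A \<in> sets borel" "emeasure lborel A < \<infinity>"
  shows "square_integrable (indicator A :: 'a::euclidean_space \<Rightarrow> real)"
proof -
  have "(\<lambda>q. (indicator A q :: real)\<^sup>2) = indicator A"
    by (auto simp: indicator_def fun_eq_iff)
  then show ?thesis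
    using assms by (simp add: square_integrable_def integrable_real_indicator)
qed

lemma square_integrable_ball: "square_integrable (indicator (ball 0 r) :: 'a::euclidean_space \<Rightarrow> real)"
  by (rule square_integrable_indicator[OF _ emeasure_lborel_ball_finite]) simp

lemma square_integrable_indicator_ball:
  fixes A :: "'a::euclidean_space set"
  assumes [measurable]: "A \<in> sets borel"
  shows "square_integrable (\<lambda>q. indicator A q * indicator (ball 0 r) q :: real)"
proof (rule square_integrable_bound[OF square_integrable_ball[of r]])
  show "(\<lambda>q. indicator A q * indicator (ball 0 r) q :: real) \<in> borel_measurable borel"
    by (intro borel_measurable_times borel_measurable_indicator) auto
qed (auto split: split_indicator)

text \<open>Measurability is tested against fixed vectors. The goal inside the locale is to replace
  the fixed vector by the class of a slice that varies with \<open>t\<close>, by induction over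
  jointly measurable functions.\<close>

locale weakly_measurable =
  fixes N :: "'t measure" and g :: "'t \<Rightarrow> 'b::euclidean_space L2"
  assumes weak [measurable]: "\<And>v. (\<lambda>t. inner (g t) v) \<in> borel_measurable N"
begin

lemma measurable_section:
  assumes "u \<in> borel_measurable (N \<Otimes>\<^sub>M (borel :: 'b measure))" "t \<in> space N"
  shows "(\<lambda>q. u (t, q)) \<in> borel_measurable borel"
  using measurable_compose[OF measurable_Pair1'[OF assms(2)] assms(1)] by simp

lemma measurable_inner_lim:
  assumes "\<And>k. (\<lambda>t. inner (g t) (w k t)) \<in> borel_measurable N"
    and "\<And>t. t \<in> space N \<Longrightarrow> (\<lambda>k. w k t) \<longlonglongrightarrow> z t"
  shows "(\<lambda>t. inner (g t) (z t)) \<in> borel_measurable N"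
proof (rule borel_measurable_LIMSEQ_real)
  show "(\<lambda>k. inner (g t) (w k t)) \<longlonglongrightarrow> inner (g t) (z t)" if "t \<in> space N" for t
    using assms(2)[OF that] by (intro tendsto_intros)
qed (rule assms(1))

text \<open>A Dynkin argument starting from rectangles. Cutting with a ball keeps the slices in L2
  at every stage, in particular for complements, where slices would otherwise have infinite
  measure.\<close>

lemma measurable_inner_indicator_ball:
  assumes "A \<in> sets (N \<Otimes>\<^sub>M (borel :: 'b measure))"
  shows "(\<lambda>t. inner (g t) (L2_of (\<lambda>q. indicator A (t, q) * indicator (ball 0 (real n)) q))) \<in> borel_measurable N"
proof -
  let ?G = "{a \<times> b | a b. a \<in> sets N \<and> b \<in> sets (borel :: 'b measure)}"
  let ?f = "\<lambda>A t q. indicator A (t, q) * indicator (ball 0 (real n)) q :: real"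
  have sq: "square_integrable (?f A t)" if "A \<in> sets (N \<Otimes>\<^sub>M (borel :: 'b measure))" "t \<in> space N" for A t
  proof -
    have "Pair t -` A \<in> sets borel" using that by (simp add: sets_Pair1)
    from square_integrable_indicator_ball[OF this, of "real n"] show ?thesis
      by (simp add: indicator_def)
  qed
  have sets: "sets (N \<Otimes>\<^sub>M (borel :: 'b measure)) = sigma_sets (space N \<times> UNIV) ?G"
    by (simp add: sets_pair_measure)
  have G: "?G \<subseteq> Pow (space N \<times> UNIV)"
    using sets.sets_into_space by blast
  show ?thesis
    using Int_stable_pair_measure_generator[of N "borel :: 'b measure"] G assms[unfolded sets]
  proof (induction rule: sigma_sets_induct_disjoint)
    case (basic A)
    then obtain a b where A: "A = a \<times> b" and [measurable]: "a \<in> sets N" "b \<in> sets borel"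
      by auto
    \<comment> \<open>On a rectangle the class is a scalar function of \<open>t\<close> times a
      fixed vector, so weak measurability applies directly.\<close>
    have "L2_of (?f A t) = indicator a t *\<^sub>R L2_of (\<lambda>q. indicator b q * indicator (ball 0 (real n)) q)" for t
      unfolding A indicator_times fst_conv snd_conv mult.assoc
      by (rule L2_of_scale square_integrable_indicator_ball)+ simp
    then show ?case by simp
  next
    case empty
    then show ?case by simp
  next
    case (compl A)
    have A: "A \<in> sets (N \<Otimes>\<^sub>M borel)" using compl.hyps by (simp add: sets)
    note b = square_integrable_ball[of "real n", where 'a = 'b]
    have eq: "inner (g t) (L2_of (?f (space N \<times> UNIV - A) t))
        = inner (g t) (L2_of (indicator (ball 0 (real n)))) - inner (g t) (L2_of (?f A t))" if t: "t \<in> space N" for t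
    proof -
      have "?f (space N \<times> UNIV - A) t = (\<lambda>q. indicator (ball 0 (real n)) q - ?f A t q)"
        using t by (auto simp: indicator_def)
      then show ?thesis
        by (simp add: L2_of_diff[OF b sq[OF A t]] inner_diff_right)
    qed
    show ?case
      by (rule measurable_cong[THEN iffD2, OF eq borel_measurable_diff[OF weak compl.IH]])
  next
    case (union A)
    have A: "A i \<in> sets (N \<Otimes>\<^sub>M borel)" for i using union.hyps by (auto simp: sets)
    have UA: "(\<Union>i. A i) \<in> sets (N \<Otimes>\<^sub>M borel)" using A by auto
    show ?case
    proof (rule measurable_inner_lim)
      fix t assume t: "t \<in> space N"
      have part: "(\<Sum>i<k. ?f (A i) t q) = ?f (\<Union>i<k. A i) t q" for k q
        using union.hyps(1)
        by (subst indicator_UN_disjoint) (auto simp: sum_distrib_right disjoint_family_on_def)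
      \<comment> \<open>Finite partial unions converge to the whole union in L2, dominated by its
        indicator, so the countable case is a limit of finite sums.\<close>
      have "(\<lambda>k. L2_of (\<lambda>q. \<Sum>i<k. ?f (A i) t q)) \<longlonglongrightarrow> L2_of (?f (\<Union>i. A i) t)"
      proof (rule L2_of_tendsto[OF sq[OF UA t]])
        have "square_integrable (\<lambda>q. \<Sum>i<k. ?f (A i) t q)" for k
          by (rule square_integrable_sum_L2_of_sum[THEN conjunct1]) (rule sq[OF A t])
        then show "(\<lambda>q. \<Sum>i<k. ?f (A i) t q) \<in> borel_measurable borel" for k
          by (rule square_integrable_measurable)
        show "\<bar>\<Sum>i<k. ?f (A i) t q\<bar> \<le> \<bar>?f (\<Union>i. A i) t q\<bar>" for k q
          unfolding part by (auto split: split_indicator)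
        show "(\<lambda>k. \<Sum>i<k. ?f (A i) t q) \<longlonglongrightarrow> ?f (\<Union>i. A i) t q" for q
          unfolding part by (intro tendsto_mult tendsto_const LIMSEQ_indicator_UN)
      qed
      then show "(\<lambda>k. \<Sum>i<k. L2_of (?f (A i) t)) \<longlonglongrightarrow> L2_of (?f (\<Union>i. A i) t)"
        using square_integrable_sum_L2_of_sum[of "\<lambda>i. ?f (A i) t", OF sq[OF A t]] by simp
    next
      show "(\<lambda>t. inner (g t) (\<Sum>i<k. L2_of (?f (A i) t))) \<in> borel_measurable N" for k
        using union.IH by (simp add: inner_sum_right)
    qed
  qed
qed

text \<open>Square integrability of the slices is carried through the induction. Nonnegativity makes
  it pass to the pieces: a summand, or a member of the increasing sequence, is bounded by the
  whole.\<close>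

lemma measurable_inner_nonneg:
  assumes u: "u \<in> borel_measurable (N \<Otimes>\<^sub>M (borel :: 'b measure))" "\<And>x. 0 \<le> u x"
    and "\<And>t. t \<in> space N \<Longrightarrow> square_integrable (\<lambda>q. u (t, q))"
  shows "(\<lambda>t. inner (g t) (L2_of (\<lambda>q. u (t, q)))) \<in> borel_measurable N"
  using u assms(3)
proof (induction u rule: borel_measurable_induct_real)
  case (set A)
  show ?case
  proof (rule measurable_inner_lim)
    show "(\<lambda>t. inner (g t) (L2_of (\<lambda>q. indicator A (t, q) * indicator (ball 0 (real n)) q))) \<in> borel_measurable N" for n
      by (rule measurable_inner_indicator_ball[OF set(1)])
    fix t assume t: "t \<in> space N"
    show "(\<lambda>n. L2_of (\<lambda>q. indicator A (t, q) * indicator (ball 0 (real n)) q)) \<longlonglongrightarrow> L2_of (\<lambda>q. indicator A (t, q))"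
    proof (rule L2_of_tendsto[OF set(2)[OF t]])
      have [measurable]: "(\<lambda>q. indicator A (t, q) :: real) \<in> borel_measurable borel"
        using set(2)[OF t] by (simp add: square_integrable_def)
      show "(\<lambda>q. indicator A (t, q) * indicator (ball 0 (real n)) q :: real) \<in> borel_measurable borel" for n
        by (intro borel_measurable_times borel_measurable_indicator) auto
      fix q :: 'b
      show "\<bar>indicator A (t, q) * indicator (ball 0 (real n)) q\<bar> \<le> \<bar>indicator A (t, q) :: real\<bar>" for n
        by (auto split: split_indicator)
      obtain m where m: "norm q < real m" using reals_Archimedean2 by blast
      have "\<forall>\<^sub>F n in sequentially. indicator A (t, q) * indicator (ball 0 (real n)) q = (indicator A (t, q) :: real)"
        using m by (intro eventually_sequentiallyI[of m]) (auto simp: indicator_def)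
      then show "(\<lambda>n. indicator A (t, q) * indicator (ball 0 (real n)) q) \<longlonglongrightarrow> (indicator A (t, q) :: real)"
        by (rule tendsto_eventually)
    qed
  qed
next
  case (mult u c)
  show ?case
  \<comment> \<open>For \<open>c = 0\<close> the hypothesis on the product says nothing about the
    slices of \<open>u\<close>, but the class is then that of the zero function at every
    time.\<close>
  proof (cases "c = 0")
    case False
    have u: "square_integrable (\<lambda>q. u (t, q))" if "t \<in> space N" for t
      using square_integrable_scale[OF mult.prems[OF that], of "1 / c"] False by simp
    have eq: "inner (g t) (L2_of (\<lambda>q. c * u (t, q))) = c * inner (g t) (L2_of (\<lambda>q. u (t, q)))" if "t \<in> space N" for t
      using L2_of_scale[OF u[OF that], of c] by simp
    show ?thesis
      by (rule measurable_cong[THEN iffD2, OF eq borel_measurable_times[OF borel_measurable_const mult.IH[OF u]]])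
  qed simp
next
  case (add u v)
  have sq: "square_integrable (\<lambda>q. u (t, q))" "square_integrable (\<lambda>q. v (t, q))" if t: "t \<in> space N" for t
    by (rule square_integrable_bound[OF add.prems[OF t]], rule measurable_section[OF _ t], fact,
        simp add: add.hyps)+
  have eq: "inner (g t) (L2_of (\<lambda>q. v (t, q) + u (t, q))) = inner (g t) (L2_of (\<lambda>q. v (t, q))) + inner (g t) (L2_of (\<lambda>q. u (t, q)))"
    if "t \<in> space N" for t
    using L2_of_add[OF sq(2,1)[OF that]] by (simp add: inner_add_right)
  show ?case
    by (rule measurable_cong[THEN iffD2, OF eq borel_measurable_add[OF add.IH(2)[OF sq(2)] add.IH(1)[OF sq(1)]]])
next
  case (seq U)
  have mono: "U i x \<le> u x" if "x \<in> space (N \<Otimes>\<^sub>M borel)" for i x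
  proof (rule incseq_le[OF _ seq.hyps(4)[OF that]])
    show "incseq (\<lambda>i. U i x)"
      using seq.hyps(3) by (auto simp: incseq_def le_fun_def simp del: split_paired_All)
  qed
  have le: "\<bar>U i (t, q)\<bar> \<le> \<bar>u (t, q)\<bar>" if "t \<in> space N" for i t q
    using mono[of "(t, q)" i] that seq.hyps(2)[of i "(t, q)"] by (simp add: space_pair_measure)
  have meas: "(\<lambda>q. U i (t, q)) \<in> borel_measurable borel" if "t \<in> space N" for i t
    by (rule measurable_section[OF seq.hyps(1) that])
  show ?case
  proof (rule measurable_inner_lim)
    show "(\<lambda>t. inner (g t) (L2_of (\<lambda>q. U i (t, q)))) \<in> borel_measurable N" for i
      by (rule seq.IH) (rule square_integrable_bound[OF seq.prems meas le])
    show "(\<lambda>i. L2_of (\<lambda>q. U i (t, q))) \<longlonglongrightarrow> L2_of (\<lambda>q. u (t, q))" if t: "t \<in> space N" for t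
      by (rule L2_of_tendsto[OF seq.prems[OF t] meas[OF t] le[OF t]])
        (use seq.hyps(4) t in \<open>simp add: space_pair_measure\<close>)
  qed
qed

lemma measurable_inner_L2_of:
  assumes u [measurable]: "case_prod \<psi> \<in> borel_measurable (N \<Otimes>\<^sub>M (borel :: 'b measure))"
    and sq: "\<And>t. t \<in> space N \<Longrightarrow> square_integrable (\<psi> t)"
  shows "(\<lambda>t. inner (g t) (L2_of (\<psi> t))) \<in> borel_measurable N"
proof -
  have sec: "\<psi> t \<in> borel_measurable borel" if "t \<in> space N" for t
    using measurable_section[OF u that] by simp
  have pos: "square_integrable (\<lambda>q. max (\<psi> t q) 0)" and neg: "square_integrable (\<lambda>q. max (- \<psi> t q) 0)"
    if t: "t \<in> space N" for t
    using sec[OF t] by (auto intro!: square_integrable_bound[OF sq[OF t]])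
  have P: "(\<lambda>t. inner (g t) (L2_of (\<lambda>q. max (\<psi> t q) 0))) \<in> borel_measurable N"
    using measurable_inner_nonneg[of "\<lambda>x. max (case_prod \<psi> x) 0"] pos by simp
  have Q: "(\<lambda>t. inner (g t) (L2_of (\<lambda>q. max (- \<psi> t q) 0))) \<in> borel_measurable N"
    using measurable_inner_nonneg[of "\<lambda>x. max (- case_prod \<psi> x) 0"] neg by simp
  have eq: "inner (g t) (L2_of (\<psi> t)) = inner (g t) (L2_of (\<lambda>q. max (\<psi> t q) 0)) - inner (g t) (L2_of (\<lambda>q. max (- \<psi> t q) 0))"
    if t: "t \<in> space N" for t
  proof -
    have "\<psi> t = (\<lambda>q. max (\<psi> t q) 0 - max (- \<psi> t q) 0)"
      by (auto simp: max_def)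
    then have "L2_of (\<psi> t) = L2_of (\<lambda>q. max (\<psi> t q) 0) - L2_of (\<lambda>q. max (- \<psi> t q) 0)"
      using L2_of_diff[OF pos[OF t] neg[OF t]] by simp
    then show ?thesis by (simp add: inner_diff_right)
  qed
  show ?thesis
    by (rule measurable_cong[THEN iffD2, OF eq borel_measurable_diff[OF P Q]])
qed

end

text \<open>The locale is instantiated with the constant map \<open>v\<close>: its theorem then
  pairs a fixed vector with the varying class, and symmetry of the inner product gives weak
  measurability.\<close>

lemma weakly_measurable_L2_of:
  assumes "case_prod \<psi> \<in> borel_measurable (N \<Otimes>\<^sub>M (borel :: 'b::euclidean_space measure))"
    and "\<And>t. t \<in> space N \<Longrightarrow> square_integrable (\<psi> t)"
  shows "weakly_measurable N (\<lambda>t. L2_of (\<psi> t))"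
proof
  fix v :: "'b L2"
  interpret weakly_measurable N "\<lambda>_. v" by unfold_locales simp
  show "(\<lambda>t. inner (L2_of (\<psi> t)) v) \<in> borel_measurable N"
    using measurable_inner_L2_of[OF assms] by (simp add: inner_commute)
qed

text \<open>All functions that are not square integrable have the same class, so they can be replaced by a
  representative of it.\<close>

lemma square_integrable_modification:
  fixes \<phi> :: "'t \<Rightarrow> 'b::euclidean_space \<Rightarrow> real"
  assumes \<phi> [measurable]: "case_prod \<phi> \<in> borel_measurable (N \<Otimes>\<^sub>M (borel :: 'b measure))"
  obtains \<psi> where "case_prod \<psi> \<in> borel_measurable (N \<Otimes>\<^sub>M (borel :: 'b measure))"
    "\<And>t. square_integrable (\<psi> t)" "\<And>t. L2_of (\<psi> t) = L2_of (\<phi> t)"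
proof -
  obtain j :: "'b \<Rightarrow> real" where j: "square_integrable j" "\<And>f. \<not> square_integrable f \<Longrightarrow> L2_of f = L2_of j"
  proof (cases "\<exists>f :: 'b \<Rightarrow> real. \<not> square_integrable f")
    case True
    then obtain f :: "'b \<Rightarrow> real" where f: "\<not> square_integrable f" by blast
    show ?thesis
    proof (rule that)
      show "square_integrable (rep_L2 (L2_of f))" by (rule square_integrable_rep_L2)
      show "L2_of f' = L2_of (rep_L2 (L2_of f))" if "\<not> square_integrable f'" for f'
        unfolding L2_of_rep_L2 using that f by (rule L2_of_not_square_integrable)
    qed
  next
    case False
    then show ?thesis using that[of "\<lambda>_. 0"] by blast
  qed
  define \<psi> where "\<psi> t = (if square_integrable (\<phi> t) then \<phi> t else j)" for t
  have sec: "\<phi> t \<in> borel_measurable borel" if "t \<in> space N" for t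
    using measurable_compose[OF measurable_Pair1'[OF that] \<phi>] by simp
  have [measurable]: "j \<in> borel_measurable borel"
    using j(1) by (simp add: square_integrable_def)
  \<comment> \<open>The times with a square integrable slice are those where an integral depending
    measurably on \<open>t\<close> is finite, so the replacement takes place on a measurable
    set.\<close>
  have sq: "square_integrable (\<phi> t) \<longleftrightarrow> (\<integral>\<^sup>+ q. ennreal ((\<phi> t q)\<^sup>2) \<partial>lborel) < \<infinity>" if "t \<in> space N" for t
    using sec[OF that] by (simp add: square_integrable_def integrable_iff_bounded)
  have [measurable]: "(\<lambda>t. \<integral>\<^sup>+ q. ennreal ((\<phi> t q)\<^sup>2) \<partial>lborel) \<in> borel_measurable N"
    by (rule lborel.borel_measurable_nn_integral) (simp add: measurable_lborel1 split_beta', measurable)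
  have "{t \<in> space N. square_integrable (\<phi> t)} = {t \<in> space N. (\<integral>\<^sup>+ q. ennreal ((\<phi> t q)\<^sup>2) \<partial>lborel) < \<infinity>}"
    using sq by auto
  also have "\<dots> \<in> sets N" by measurable
  finally have S: "Measurable.pred N (\<lambda>t. square_integrable (\<phi> t))"
    by (simp add: pred_def)
  have "(\<lambda>x. if square_integrable (\<phi> (fst x)) then case_prod \<phi> x else j (snd x)) \<in> borel_measurable (N \<Otimes>\<^sub>M borel)"
    using S by measurable
  then have "case_prod \<psi> \<in> borel_measurable (N \<Otimes>\<^sub>M borel)"
    by (rule measurable_cong[THEN iffD1, rotated]) (auto simp: \<psi>_def)
  moreover have "square_integrable (\<psi> t)" "L2_of (\<psi> t) = L2_of (\<phi> t)" for t
    using j by (auto simp: \<psi>_def)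
  ultimately show ?thesis using that by blast
qed

text \<open>Symmetry moves \<open>E B\<close> onto the fixed test vector, so the projected classes
  are weakly measurable as well and can be paired with the classes of \<psi>.\<close>

lemma measurable_inner_spectral:
  fixes \<phi> \<psi> :: "'t \<Rightarrow> 'b::euclidean_space \<Rightarrow> real"
  assumes "pvm E" and B: "B \<in> sets borel"
    and \<phi>: "case_prod \<phi> \<in> borel_measurable (N \<Otimes>\<^sub>M borel)" "\<And>t. square_integrable (\<phi> t)"
    and \<psi>: "case_prod \<psi> \<in> borel_measurable (N \<Otimes>\<^sub>M borel)" "\<And>t. square_integrable (\<psi> t)"
  shows "(\<lambda>t. inner (E B (L2_of (\<phi> t))) (L2_of (\<psi> t))) \<in> borel_measurable N"
proof -
  interpret pvm E by fact
  interpret \<phi>: weakly_measurable N "\<lambda>t. L2_of (\<phi> t)"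
    by (rule weakly_measurable_L2_of[OF \<phi>])
  interpret weakly_measurable N "\<lambda>t. E B (L2_of (\<phi> t))"
    by unfold_locales (simp add: E_sym[OF B])
  show ?thesis
    by (rule measurable_inner_L2_of[OF \<psi>])
qed

text \<open>With \<open>f\<close> the square of \<open>h\<close>, this makes membership in the
  domain of the integral a measurable property of time.\<close>

lemma measurable_nn_integral_spectral:
  fixes \<phi> :: "'t \<Rightarrow> 'b::euclidean_space \<Rightarrow> real"
  assumes "pvm E" and f: "f \<in> borel_measurable borel"
    and \<phi>: "case_prod \<phi> \<in> borel_measurable (N \<Otimes>\<^sub>M borel)" "\<And>t. square_integrable (\<phi> t)"
  shows "(\<lambda>t. \<integral>\<^sup>+ l. f l \<partial>scalar_spectral_measure E (L2_of (\<phi> t))) \<in> borel_measurable N"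
proof -
  interpret pvm E by fact
  show ?thesis
    using f
  proof (induction f rule: borel_measurable_induct)
    case (cong f g)
    have "(\<integral>\<^sup>+ l. f l \<partial>\<mu> u) = (\<integral>\<^sup>+ l. g l \<partial>\<mu> u)" for u
      using cong.hyps(3) by (intro nn_integral_cong) auto
    then show ?case using cong by simp
  next
    case (set B)
    have "(\<lambda>t. ennreal (inner (E B (L2_of (\<phi> t))) (L2_of (\<phi> t)))) \<in> borel_measurable N"
      using measurable_inner_spectral[OF assms(1) set \<phi> \<phi>] by (rule measurable_compose) simp
    then show ?case
      using set by (simp add: emeasure_\<mu> inner_E)
  next
    case (mult f c)
    then show ?case by (simp add: nn_integral_cmult)
  next
    case (add f g)
    then show ?case by (simp add: nn_integral_add)
  next
    case (seq F)
    have "(\<integral>\<^sup>+ l. (SUP i. F i l) \<partial>\<mu> u) = (SUP i. \<integral>\<^sup>+ l. F i l \<partial>\<mu> u)" for u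
      using seq.hyps by (intro nn_integral_monotone_convergence_SUP) auto
    then show ?case
      using seq.IH by (simp add: SUP_apply[abs_def] image_comp)
  qed
qed

text \<open>Here and in the next lemma, inner products with values of the integral become limits of
  finite sums of scalars \<open>inner (E B u) v\<close>, whose sets and coefficients are the same
  for all vectors.\<close>

lemma (in complete_pvm) inner_spectral_integral_limit:
  assumes h: "h \<in> borel_measurable borel" and "(u, g) \<in> spectral_integral E h"
  shows "(\<lambda>k. \<Sum>c\<in>range (simple_approx h k). c * inner (E (simple_approx h k -` {c}) u) v) \<longlonglongrightarrow> inner g v"
  using tendsto_inner[OF spectral_integral_limit[OF assms] tendsto_const, of v]
  by (simp add: simple_spectral_integral_def inner_sum_left)

lemma (in complete_pvm) inner_spectral_integral_limit2:
  assumes h: "h \<in> borel_measurable borel" and "(u, g) \<in> spectral_integral E h" "(v, g') \<in> spectral_integral E h"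
  shows "(\<lambda>k. \<Sum>c\<in>range (simple_approx h k). c\<^sup>2 * inner (E (simple_approx h k -` {c}) u) v) \<longlonglongrightarrow> inner g g'"
  using tendsto_inner[OF spectral_integral_limit[OF assms(1,2)] spectral_integral_limit[OF assms(1,3)]]
  by (simp add: inner_S[OF simple_approx(1)[OF h]])

text \<open>The hypothesis that \<open>n\<close> is constant off the domain of \<open>h(A)\<close> is met by the description operator.\<close>

lemma measurable_inner_functional_calculus:
  fixes \<phi> \<psi> :: "'t \<Rightarrow> 'b::euclidean_space \<Rightarrow> real"
  assumes h [measurable]: "h \<in> borel_measurable borel"
    and n: "\<And>u g. (u, g) \<in> functional_calculus A h \<Longrightarrow> n u = g"
    and J: "\<And>u. u \<notin> Domain (functional_calculus A h) \<Longrightarrow> n u = J"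
    and \<phi>: "case_prod \<phi> \<in> borel_measurable (N \<Otimes>\<^sub>M borel)"
    and \<psi>: "case_prod \<psi> \<in> borel_measurable (N \<Otimes>\<^sub>M borel)"
  shows "(\<lambda>t. inner (n (L2_of (\<phi> t))) (n (L2_of (\<psi> t)))) \<in> borel_measurable N"
proof (cases "\<exists>E. spectral_resolution A E")
  case False
  \<comment> \<open>Without a resolution the functional calculus is the empty relation, and
    \<open>n\<close> is constant.\<close>
  then have "n u = J" for u
    by (intro J) (auto simp: functional_calculus_def)
  then show ?thesis by simp
next
  case True
  then obtain E where E: "spectral_resolution A E" by blast
  interpret complete_pvm E
    using E by unfold_locales (simp add: spectral_resolution_def)
  note fc = functional_calculus_eq[OF E, of h]
  have n': "(u, n u) \<in> spectral_integral E h" if "u \<in> Domain (spectral_integral E h)" for u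
    using that n unfolding fc by blast
  have J': "n u = J" if "u \<notin> Domain (spectral_integral E h)" for u
    using that J unfolding fc by blast
  obtain \<phi>' where \<phi>': "case_prod \<phi>' \<in> borel_measurable (N \<Otimes>\<^sub>M borel)" "\<And>t. square_integrable (\<phi>' t)"
    and \<phi>_eq: "\<And>t. L2_of (\<phi>' t) = L2_of (\<phi> t)"
    using square_integrable_modification[OF \<phi>] by blast
  obtain \<psi>' where \<psi>': "case_prod \<psi>' \<in> borel_measurable (N \<Otimes>\<^sub>M borel)" "\<And>t. square_integrable (\<psi>' t)"
    and \<psi>_eq: "\<And>t. L2_of (\<psi>' t) = L2_of (\<psi> t)"
    using square_integrable_modification[OF \<psi>] by blast
  define u v where "u t = L2_of (\<phi> t)" and "v t = L2_of (\<psi> t)" for t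
  define D where "D = Domain (spectral_integral E h)"
  have D: "w \<in> D \<longleftrightarrow> (\<integral>\<^sup>+ l. ennreal ((h l)\<^sup>2) \<partial>\<mu> w) < \<infinity>" for w
    using Domain_spectral_integral[OF h] by (simp add: D_def)
  have pu: "Measurable.pred N (\<lambda>t. u t \<in> D)" and pv: "Measurable.pred N (\<lambda>t. v t \<in> D)"
    unfolding D u_def v_def \<phi>_eq[symmetric] \<psi>_eq[symmetric]
    using measurable_nn_integral_spectral[OF pvm_axioms _ \<phi>', of "\<lambda>l. ennreal ((h l)\<^sup>2)"]
      measurable_nn_integral_spectral[OF pvm_axioms _ \<psi>', of "\<lambda>l. ennreal ((h l)\<^sup>2)"]
    by simp_all
  have sets: "simple_approx h k -` {c} \<in> sets borel" for k c
    by (rule simple_functionD_borel(2)[OF simple_approx(1)[OF h]])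
  have muv: "(\<lambda>t. inner (E B (u t)) (v t)) \<in> borel_measurable N" if "B \<in> sets borel" for B
    using measurable_inner_spectral[OF pvm_axioms that \<phi>' \<psi>'] by (simp add: u_def v_def \<phi>_eq \<psi>_eq)
  have mu: "(\<lambda>t. inner (E B (u t)) w) \<in> borel_measurable N" if "B \<in> sets borel" for B w
    using weakly_measurable.weak[OF weakly_measurable_L2_of[OF \<phi>'], of "E B w"]
    by (simp add: u_def \<phi>_eq E_sym[OF that])
  have mv: "(\<lambda>t. inner (E B (v t)) w) \<in> borel_measurable N" if "B \<in> sets borel" for B w
    using weakly_measurable.weak[OF weakly_measurable_L2_of[OF \<psi>'], of "E B w"]
    by (simp add: v_def \<psi>_eq E_sym[OF that])
  \<comment> \<open>\<open>lim\<close> is measurable in \<open>t\<close> whether or not the sums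
    converge. Each of the three limits is evaluated only where the relevant vectors lie in the
    domain, and there it is the desired inner product.\<close>
  define L where "L t = lim (\<lambda>k. \<Sum>c\<in>range (simple_approx h k). c\<^sup>2 * inner (E (simple_approx h k -` {c}) (u t)) (v t))" for t
  define Lu where "Lu t = lim (\<lambda>k. \<Sum>c\<in>range (simple_approx h k). c * inner (E (simple_approx h k -` {c}) (u t)) J)" for t
  define Lv where "Lv t = lim (\<lambda>k. \<Sum>c\<in>range (simple_approx h k). c * inner (E (simple_approx h k -` {c}) (v t)) J)" for t
  have mL: "L \<in> borel_measurable N" "Lu \<in> borel_measurable N" "Lv \<in> borel_measurable N"
    unfolding L_def[abs_def] Lu_def[abs_def] Lv_def[abs_def]
    by (intro borel_measurable_lim_metric borel_measurable_sum borel_measurable_times borel_measurable_const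
        muv mu mv sets)+
  have "inner (n (u t)) (n (v t)) =
      (if u t \<in> D then if v t \<in> D then L t else Lu t else if v t \<in> D then Lv t else inner J J)" for t
  proof -
    have "L t = inner (n (u t)) (n (v t))" if "u t \<in> D" "v t \<in> D"
      unfolding L_def by (rule limI, rule inner_spectral_integral_limit2[OF h n' n']) (use that D_def in auto)
    moreover have "Lu t = inner (n (u t)) J" if "u t \<in> D"
      unfolding Lu_def by (rule limI, rule inner_spectral_integral_limit[OF h n']) (use that D_def in auto)
    moreover have "Lv t = inner (n (v t)) J" if "v t \<in> D"
      unfolding Lv_def by (rule limI, rule inner_spectral_integral_limit[OF h n']) (use that D_def in auto)
    ultimately show ?thesis
      using J'[of "u t"] J'[of "v t"] by (auto simp: D_def inner_commute)
  qed
  moreover have "(\<lambda>t. if u t \<in> D then if v t \<in> D then L t else Lu t else if v t \<in> D then Lv t else inner J J) \<in> borel_measurable N"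
    by (intro measurable_If mL pu pv borel_measurable_const) (use pu pv in \<open>simp_all add: pred_def\<close>)
  ultimately show ?thesis
    by (simp add: u_def v_def)
qed

lemma measurable_inner_neg_power:
  fixes \<phi> \<psi> :: "'t \<Rightarrow> 'n::finite heis \<Rightarrow> real"
  assumes "case_prod \<phi> \<in> borel_measurable (N \<Otimes>\<^sub>M borel)" "case_prod \<psi> \<in> borel_measurable (N \<Otimes>\<^sub>M borel)"
  shows "(\<lambda>t. inner (neg_power \<alpha> (L2_of (\<phi> t))) (neg_power \<alpha> (L2_of (\<psi> t)))) \<in> borel_measurable N"
proof (rule measurable_inner_functional_calculus[OF _ _ _ assms])
  show "(\<lambda>l. l powr - \<alpha>) \<in> borel_measurable borel" by measurable
  fix u g :: "'n heis L2"
  show "neg_power \<alpha> u = g"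
    if "(u, g) \<in> functional_calculus {(u, - v) | u v. (u, v) \<in> sub_laplacian_L2} (\<lambda>l. l powr - \<alpha>)"
    using that by (intro neg_power_eqI) (simp add: neg_power_graph_def)
  \<comment> \<open>Off the domain the description has an unsatisfiable predicate, the same for
    every \<open>u\<close>, so its unspecified value does not depend on \<open>u\<close>.\<close>
  show "neg_power \<alpha> u = (THE g. False)"
    if "u \<notin> Domain (functional_calculus {(u, - v) | u v. (u, v) \<in> sub_laplacian_L2} (\<lambda>l. l powr - \<alpha>))"
  proof -
    have "(u, g) \<notin> neg_power_graph \<alpha>" for g
      using that by (auto simp: neg_power_graph_def)
    then show ?thesis by (simp add: neg_power_def)
  qed
qed


section \<open>Translations of the index functions\<close>

lemma measurable_pair_heis_mult:
  assumes "case_prod \<phi> \<in> borel_measurable (N \<Otimes>\<^sub>M borel)"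
  shows "case_prod (\<lambda>t q. \<phi> t (p \<star> q)) \<in> borel_measurable (N \<Otimes>\<^sub>M borel)"
proof -
  have "(\<lambda>x. (fst x, p \<star> snd x)) \<in> measurable (N \<Otimes>\<^sub>M borel) (N \<Otimes>\<^sub>M borel)"
    by measurable
  from measurable_compose[OF this assms] show ?thesis
    by (simp add: case_prod_beta')
qed

lemma sets_half_line_borel: "sets (half_line \<Otimes>\<^sub>M (lborel :: 'b::euclidean_space measure)) = sets (half_line \<Otimes>\<^sub>M borel)"
  by (intro sets_pair_measure_cong) simp_all

lemma L2_half_line_domain_iff:
  "\<phi> \<in> L2_half_line_domain \<alpha> \<longleftrightarrow> case_prod \<phi> \<in> borel_measurable (half_line \<Otimes>\<^sub>M borel) \<and>
     (AE t in half_line. square_integrable (\<phi> t) \<and> L2_of (\<phi> t) \<in> neg_power_domain \<alpha>) \<and>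
     (\<integral>\<^sup>+ t. ennreal ((norm (neg_power \<alpha> (L2_of (\<phi> t))))\<^sup>2) \<partial>half_line) < \<infinity>"
  unfolding L2_half_line_domain_def mem_Collect_eq measurable_cong_sets[OF sets_half_line_borel refl] ..

lemma L2_half_line_domain_translate:
  assumes "\<phi> \<in> L2_half_line_domain \<alpha>"
  shows "(\<lambda>t q. \<phi> t (p \<star> q)) \<in> L2_half_line_domain \<alpha>"
proof -
  note \<phi> = assms[unfolded L2_half_line_domain_iff]
  have AE: "AE t in half_line. L2_of (\<lambda>q. \<phi> t (p \<star> q)) = translate p (L2_of (\<phi> t)) \<and>
      square_integrable (\<phi> t) \<and> L2_of (\<phi> t) \<in> neg_power_domain \<alpha>"
    using \<phi> by (auto simp: translate_L2_of)
  have "(\<integral>\<^sup>+ t. ennreal ((norm (neg_power \<alpha> (L2_of (\<lambda>q. \<phi> t (p \<star> q)))))\<^sup>2) \<partial>half_line)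
      = (\<integral>\<^sup>+ t. ennreal ((norm (neg_power \<alpha> (L2_of (\<phi> t))))\<^sup>2) \<partial>half_line)"
    by (rule nn_integral_cong_AE, use AE in eventually_elim) (simp add: neg_power_translate)
  moreover have "AE t in half_line. square_integrable (\<lambda>q. \<phi> t (p \<star> q)) \<and> L2_of (\<lambda>q. \<phi> t (p \<star> q)) \<in> neg_power_domain \<alpha>"
    using AE by eventually_elim (simp add: square_integrable_heis_mult neg_power_domain_translate)
  ultimately show ?thesis
    using \<phi> by (simp add: L2_half_line_domain_iff measurable_pair_heis_mult)
qed

lemma covariance_translate:
  assumes \<phi>: "\<phi> \<in> L2_half_line_domain \<alpha>" and \<psi>: "\<psi> \<in> L2_half_line_domain \<alpha>"
  shows "(LINT t|half_line. inner (neg_power \<alpha> (L2_of (\<lambda>q. \<phi> t (p \<star> q)))) (neg_power \<alpha> (L2_of (\<lambda>q. \<psi> t (p \<star> q))))) =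
    (LINT t|half_line. inner (neg_power \<alpha> (L2_of (\<phi> t))) (neg_power \<alpha> (L2_of (\<psi> t))))"
proof (rule integral_cong_AE)
  show "(\<lambda>t. inner (neg_power \<alpha> (L2_of (\<phi> t))) (neg_power \<alpha> (L2_of (\<psi> t)))) \<in> borel_measurable half_line"
    using \<phi> \<psi> by (intro measurable_inner_neg_power) (simp_all add: L2_half_line_domain_iff)
  show "(\<lambda>t. inner (neg_power \<alpha> (L2_of (\<lambda>q. \<phi> t (p \<star> q)))) (neg_power \<alpha> (L2_of (\<lambda>q. \<psi> t (p \<star> q))))) \<in> borel_measurable half_line"
    using \<phi> \<psi> by (intro measurable_inner_neg_power measurable_pair_heis_mult) (simp_all add: L2_half_line_domain_iff)
  have "AE t in half_line. square_integrable (\<phi> t) \<and> L2_of (\<phi> t) \<in> neg_power_domain \<alpha>"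
    "AE t in half_line. square_integrable (\<psi> t) \<and> L2_of (\<psi> t) \<in> neg_power_domain \<alpha>"
    using \<phi> \<psi> by (simp_all add: L2_half_line_domain_iff)
  then show "AE t in half_line. inner (neg_power \<alpha> (L2_of (\<lambda>q. \<phi> t (p \<star> q)))) (neg_power \<alpha> (L2_of (\<lambda>q. \<psi> t (p \<star> q)))) =
      inner (neg_power \<alpha> (L2_of (\<phi> t))) (neg_power \<alpha> (L2_of (\<psi> t)))"
    by eventually_elim (simp add: neg_power_translate flip: translate_L2_of)
qed

theorem proposition3p7:
  fixes M :: "'w measure"
    and W :: "(real \<Rightarrow> 'n::finite heis \<Rightarrow> real) \<Rightarrow> 'w \<Rightarrow> real"
    and \<alpha> :: real
    and x :: "'n heis"
  assumes "prob_space M"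
    and "0 < \<alpha>" and "\<alpha> < (real CARD('n) + 1) / 2"
    and "centered_gaussian_family M (L2_half_line_domain \<alpha>) W"
    and "\<And>\<phi> \<psi>. \<phi> \<in> L2_half_line_domain \<alpha> \<Longrightarrow> \<psi> \<in> L2_half_line_domain \<alpha> \<Longrightarrow>
      prob_space.expectation M (\<lambda>\<omega>. W \<phi> \<omega> * W \<psi> \<omega>) =
      (LINT t|half_line. inner (neg_power \<alpha> (L2_of (\<phi> t))) (neg_power \<alpha> (L2_of (\<psi> t))))"
  shows "law_of_family M (L2_half_line_domain \<alpha>) (\<lambda>\<phi>. W (\<lambda>t q. \<phi> t (x \<star> q))) =
    law_of_family M (L2_half_line_domain \<alpha>) W"
proof -
  interpret prob_space M by fact
  let ?T = "\<lambda>(\<phi> :: real \<Rightarrow> 'n heis \<Rightarrow> real) t q. \<phi> t (x \<star> q)"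
  \<comment> \<open>Translating by \<open>- x\<close> is a left inverse. Thus the translated family
    is the old one with its members renamed, and its joint Gaussianity is inherited.\<close>
  have "inj_on ?T (L2_half_line_domain \<alpha>)"
    by (rule inj_on_inverseI[where g = "\<lambda>\<phi> t q. \<phi> t (- x \<star> q)"]) simp
  moreover have "?T ` L2_half_line_domain \<alpha> \<subseteq> L2_half_line_domain \<alpha>"
    using L2_half_line_domain_translate by blast
  ultimately have "centered_gaussian_family M (L2_half_line_domain \<alpha>) (\<lambda>\<phi>. W (?T \<phi>))"
    by (rule centered_gaussian_family_reindex[OF assms(4)])
  then show ?thesis
    by (rule centered_gaussian_law_eqI[OF _ assms(4)])
      (simp add: assms(5) L2_half_line_domain_translate covariance_translate)
qed

end
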